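(* Let $(\mathcal{C},\mathbb{E},\mathfrak{s})$ be a small $R$-linear extriangulated category, and let $A\xrightarrow{x}B\xrightarrow{y}C\overset{\delta}{\dashrightarrow}$ be any $\mathfrak{s}$-triangle. (1) There is a long exact sequence $$\mathcal{C}(-,A)\to\mathcal{C}(-,B)\to\mathcal{C}(-,C)\to\mathbb{E}(-,A)\to\cdots\to\mathbb{E}^{n-1}(-,C)\to\mathbb{E}^n(-,A)\to\mathbb{E}^n(-,B)\to\mathbb{E}^n(-,C)\to\cdots$$ in $\mathrm{Mod}\,\mathcal{C}$, whose maps are $x_*=\mathbb{E}^n(-,x)$, $y_*=\mathbb{E}^n(-,y)$ and $\delta_\sharp\colon\mathbb{E}^{n}(-,C)\to\mathbb{E}^{n+1}(-,A)$ (here $\mathbb{E}^0=\mathcal{C}(-,-)$). (2) Dually, there is a long exact sequence $$\mathcal{C}(C,-)\to\mathcal{C}(B,-)\to\mathcal{C}(A,-)\to\mathbb{E}(C,-)\to\cdots\to\mathbb{E}^{n-1}(A,-)\to\mathbb{E}^n(C,-)\to\mathbb{E}^n(B,-)\to\mathbb{E}^n(A,-)\to\cdots$$ in $\mathcal{C}\,\mathrm{Mod}$, whose maps are $y^*=\mathbb{E}^n(y,-)$, $x^*=\mathbb{E}^n(x,-)$ and $\delta^\sharp\colon\mathbb{E}^{n}(A,-)\to\mathbb{E}^{n+1}(C,-)$.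
   Context: $R$ is a commutative ring with $1$; $\mathcal{C}$ is an additive $R$-linear category. Extriangulated categories: let $\mathbb{E}\colon\mathcal{C}^{\mathrm{op}}\times\mathcal{C}\to\mathrm{Mod}\,R$ be an $R$-bilinear functor. An element $\delta\in\mathbb{E}(C,A)$ is called an extension; for $a\colon A\to A'$ and $c\colon C'\to C$ put $a_*\delta=\mathbb{E}(C,a)(\delta)$ and $c^*\delta=\mathbb{E}(c,A)(\delta)$. A morphism of extensions from $\delta\in\mathbb{E}(C,A)$ to $\delta'\in\mathbb{E}(C',A')$ is a pair $(a\colon A\to A',\,c\colon C\to C')$ with $a_*\delta=c^*\delta'$. The extension $\delta\oplus\delta'\in\mathbb{E}(C\oplus C',A\oplus A')$ is the one with diagonal components $\delta,\delta'$ and zero off-diagonal components. Sequences $A\xrightarrow{x}B\xrightarrow{y}C$ and $A\xrightarrow{x'}B'\xrightarrow{y'}C$ are equivalent if there is an isomorphism $b\colon B\to B'$ with $bx=x'$, $y'b=y$; the class is written $[A\xrightarrow{x}B\xrightarrow{y}C]$. An additive realization $\mathfrak{s}$ assigns to each $\delta\in\mathbb{E}(C,A)$ such a class $\mathfrak{s}(\delta)=[A\xrightarrow{x}B\xrightarrow{y}C]$ so that: for each morphism $(a,c)\colon\delta\to\delta'$ with $\mathfrak{s}(\delta')=[A'\xrightarrow{x'}B'\xrightarrow{y'}C']$ there is $b\colon B\to B'$ with $bx=x'a$, $y'b=cy$; $\mathfrak{s}(0)=[A\to A\oplus C\to C]$ (canonical maps); and $\mathfrak{s}(\delta\oplus\delta')=\mathfrak{s}(\delta)\oplus\mathfrak{s}(\delta')$.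 The triple $(\mathcal{C},\mathbb{E},\mathfrak{s})$ is an ($R$-linear) extriangulated category if moreover: (ET3) if $\mathfrak{s}(\delta)=[A\xrightarrow{x}B\xrightarrow{y}C]$, $\mathfrak{s}(\delta')=[A'\xrightarrow{x'}B'\xrightarrow{y'}C']$ and $bx=x'a$, then there is $c$ with $cy=y'b$ and $a_*\delta=c^*\delta'$; (ET3)$^{\mathrm{op}}$ the dual; (ET4) if $\delta\in\mathbb{E}(D,A)$ and $\delta'\in\mathbb{E}(F,B)$ are realized by $A\xrightarrow{f}B\xrightarrow{f'}D$ and $B\xrightarrow{g}C\xrightarrow{g'}F$, then there are an object $E$, morphisms $d\colon D\to E$, $e\colon E\to F$, $h=gf$, $h'\colon C\to E$ with $h'g=df'$, $eh'=g'$, and $\delta''\in\mathbb{E}(E,A)$ realized by $A\xrightarrow{h}C\xrightarrow{h'}E$, such that $D\xrightarrow{d}E\xrightarrow{e}F$ realizes $f'_*\delta'$, $d^*\delta''=\delta$ and $f_*\delta''=e^*\delta'$; (ET4)$^{\mathrm{op}}$ the dual. If $\mathfrak{s}(\delta)=[A\xrightarrow{x}B\xrightarrow{y}C]$ one writes $A\xrightarrow{x}B\xrightarrow{y}C\overset{\delta}{\dashrightarrow}$ and calls it an $\mathfrak{s}$-triangle; $x$ is an inflation, $y$ a deflation, $A\to B\to C$ a conflation. $\mathrm{Mod}\,\mathcal{C}$ (resp. $\mathcal{C}\,\mathrm{Mod}$) is the category of $R$-linear functors $\mathcal{C}^{\mathrm{op}}\to\mathrm{Mod}\,R$ (resp.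 $\mathcal{C}\to\mathrm{Mod}\,R$). For $\mathcal{C}$ small, positive extensions are defined by $\mathbb{E}^0=\mathcal{C}(-,-)$, $\mathbb{E}^1=\mathbb{E}$ and inductively by the coend $\mathbb{E}^n(X,Y)=\int^{M\in\mathcal{C}}\mathbb{E}^{n-1}(M,Y)\otimes_R\mathbb{E}(X,M)$; there are natural isomorphisms $\mathbb{E}^{s+t}(X,Y)\cong\int^{M}\mathbb{E}^s(M,Y)\otimes_R\mathbb{E}^t(X,M)$. Write $\rho\cup\lambda\in\mathbb{E}^{s+t}(X,Y)$ for the class of $\rho\otimes\lambda$, $\rho\in\mathbb{E}^s(M,Y)$, $\lambda\in\mathbb{E}^t(X,M)$. For $\delta\in\mathbb{E}(C,A)$ and $n\ge0$, $\delta_\sharp\colon\mathbb{E}^n(-,C)\to\mathbb{E}^{n+1}(-,A)$ is $\lambda\mapsto\delta\cup\lambda$ and $\delta^\sharp\colon\mathbb{E}^n(A,-)\to\mathbb{E}^{n+1}(C,-)$ is $\lambda\mapsto\lambda\cup\delta$; for $n=0$ these are $f\mapsto f^*\delta$ and $f\mapsto f_*\delta$. *)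

theory Defs
  imports "HOL-Algebra.Module" "HOL-Algebra.AbelCoset"
begin

section \<open>Linear and additive categories\<close>

text \<open>Categories are small by construction: their objects form a set. A hom-set is a module over
  the base ring; the fields \<open>mult\<close> and \<open>one\<close> that the record type \<open>module\<close> inherits from rings
  are irrelevant throughout.\<close>

record ('r, 'o, 'm) lin_cat =
  Obj  :: "'o set"
  Hom  :: "'o \<Rightarrow> 'o \<Rightarrow> ('r, 'm) module"
  Dom  :: "'m \<Rightarrow> 'o"
  Cod  :: "'m \<Rightarrow> 'o"
  Id   :: "'o \<Rightarrow> 'm"
  Comp :: "'m \<Rightarrow> 'm \<Rightarrow> 'm" (infixl \<open>\<circ>\<index>\<close> 70)

abbreviation arr :: "('r, 'o, 'm) lin_cat \<Rightarrow> 'o \<Rightarrow> 'o \<Rightarrow> 'm set"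
  where "arr \<C> X Y \<equiv> carrier (Hom \<C> X Y)"

locale linear_category = cring R
  for R :: "('r, 'q) ring_scheme" (structure) and \<C> :: "('r, 'o, 'm) lin_cat" +
  assumes Hom_module: "\<lbrakk>X \<in> Obj \<C>; Y \<in> Obj \<C>\<rbrakk> \<Longrightarrow> module R (Hom \<C> X Y)"
    and Dom_Cod: "\<lbrakk>X \<in> Obj \<C>; Y \<in> Obj \<C>; f \<in> arr \<C> X Y\<rbrakk> \<Longrightarrow> Dom \<C> f = X \<and> Cod \<C> f = Y"
    and Id_arr: "X \<in> Obj \<C> \<Longrightarrow> Id \<C> X \<in> arr \<C> X X"
    and Comp_arr: "\<lbrakk>X \<in> Obj \<C>; Y \<in> Obj \<C>; Z \<in> Obj \<C>; f \<in> arr \<C> X Y; g \<in> arr \<C> Y Z\<rbrakk>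
      \<Longrightarrow> g \<circ>\<^bsub>\<C>\<^esub> f \<in> arr \<C> X Z"
    and Comp_Id: "\<lbrakk>X \<in> Obj \<C>; Y \<in> Obj \<C>; f \<in> arr \<C> X Y\<rbrakk>
      \<Longrightarrow> f \<circ>\<^bsub>\<C>\<^esub> Id \<C> X = f \<and> Id \<C> Y \<circ>\<^bsub>\<C>\<^esub> f = f"
    and Comp_assoc: "\<lbrakk>W \<in> Obj \<C>; X \<in> Obj \<C>; Y \<in> Obj \<C>; Z \<in> Obj \<C>;
        f \<in> arr \<C> W X; g \<in> arr \<C> X Y; h \<in> arr \<C> Y Z\<rbrakk>
      \<Longrightarrow> (h \<circ>\<^bsub>\<C>\<^esub> g) \<circ>\<^bsub>\<C>\<^esub> f = h \<circ>\<^bsub>\<C>\<^esub> (g \<circ>\<^bsub>\<C>\<^esub> f)"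
    and Comp_add_left: "\<lbrakk>X \<in> Obj \<C>; Y \<in> Obj \<C>; Z \<in> Obj \<C>;
        f \<in> arr \<C> X Y; g \<in> arr \<C> Y Z; g' \<in> arr \<C> Y Z\<rbrakk>
      \<Longrightarrow> (g \<oplus>\<^bsub>Hom \<C> Y Z\<^esub> g') \<circ>\<^bsub>\<C>\<^esub> f = (g \<circ>\<^bsub>\<C>\<^esub> f) \<oplus>\<^bsub>Hom \<C> X Z\<^esub> (g' \<circ>\<^bsub>\<C>\<^esub> f)"
    and Comp_add_right: "\<lbrakk>X \<in> Obj \<C>; Y \<in> Obj \<C>; Z \<in> Obj \<C>;
        f \<in> arr \<C> X Y; f' \<in> arr \<C> X Y; g \<in> arr \<C> Y Z\<rbrakk>
      \<Longrightarrow> g \<circ>\<^bsub>\<C>\<^esub> (f \<oplus>\<^bsub>Hom \<C> X Y\<^esub> f') = (g \<circ>\<^bsub>\<C>\<^esub> f) \<oplus>\<^bsub>Hom \<C> X Z\<^esub> (g \<circ>\<^bsub>\<C>\<^esub> f')"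
    and Comp_smult_left: "\<lbrakk>X \<in> Obj \<C>; Y \<in> Obj \<C>; Z \<in> Obj \<C>;
        r \<in> carrier R; f \<in> arr \<C> X Y; g \<in> arr \<C> Y Z\<rbrakk>
      \<Longrightarrow> (r \<odot>\<^bsub>Hom \<C> Y Z\<^esub> g) \<circ>\<^bsub>\<C>\<^esub> f = r \<odot>\<^bsub>Hom \<C> X Z\<^esub> (g \<circ>\<^bsub>\<C>\<^esub> f)"
    and Comp_smult_right: "\<lbrakk>X \<in> Obj \<C>; Y \<in> Obj \<C>; Z \<in> Obj \<C>;
        r \<in> carrier R; f \<in> arr \<C> X Y; g \<in> arr \<C> Y Z\<rbrakk>
      \<Longrightarrow> g \<circ>\<^bsub>\<C>\<^esub> (r \<odot>\<^bsub>Hom \<C> X Y\<^esub> f) = r \<odot>\<^bsub>Hom \<C> X Z\<^esub> (g \<circ>\<^bsub>\<C>\<^esub> f)"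

definition zero_object :: "('r, 'o, 'm) lin_cat \<Rightarrow> 'o \<Rightarrow> bool"
  where "zero_object \<C> Z \<longleftrightarrow> Z \<in> Obj \<C> \<and>
    (\<forall>X\<in>Obj \<C>. (\<exists>!f. f \<in> arr \<C> X Z) \<and> (\<exists>!f. f \<in> arr \<C> Z X))"

text \<open>\<open>biproduct \<C> A A' P i i' p p'\<close>: the object \<open>P\<close> is \<open>A \<oplus> A'\<close>, with inclusions \<open>i\<close>, \<open>i'\<close> and
  projections \<open>p\<close>, \<open>p'\<close>.\<close>

definition biproduct ::
  "('r, 'o, 'm) lin_cat \<Rightarrow> 'o \<Rightarrow> 'o \<Rightarrow> 'o \<Rightarrow> 'm \<Rightarrow> 'm \<Rightarrow> 'm \<Rightarrow> 'm \<Rightarrow> bool"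
  where "biproduct \<C> A A' P i i' p p' \<longleftrightarrow> A \<in> Obj \<C> \<and> A' \<in> Obj \<C> \<and> P \<in> Obj \<C> \<and>
    i \<in> arr \<C> A P \<and> i' \<in> arr \<C> A' P \<and> p \<in> arr \<C> P A \<and> p' \<in> arr \<C> P A' \<and>
    p \<circ>\<^bsub>\<C>\<^esub> i = Id \<C> A \<and> p' \<circ>\<^bsub>\<C>\<^esub> i' = Id \<C> A' \<and>
    p' \<circ>\<^bsub>\<C>\<^esub> i = \<zero>\<^bsub>Hom \<C> A A'\<^esub> \<and> p \<circ>\<^bsub>\<C>\<^esub> i' = \<zero>\<^bsub>Hom \<C> A' A\<^esub> \<and>
    (i \<circ>\<^bsub>\<C>\<^esub> p) \<oplus>\<^bsub>Hom \<C> P P\<^esub> (i' \<circ>\<^bsub>\<C>\<^esub> p') = Id \<C> P"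

locale additive_linear_category = linear_category +
  assumes has_zero_object: "\<exists>Z. zero_object \<C> Z"
    and has_biproducts: "\<lbrakk>A \<in> Obj \<C>; A' \<in> Obj \<C>\<rbrakk> \<Longrightarrow> \<exists>P i i' p p'. biproduct \<C> A A' P i i' p p'"

definition op_cat :: "('r, 'o, 'm) lin_cat \<Rightarrow> ('r, 'o, 'm) lin_cat"
  where "op_cat \<C> = \<lparr>Obj = Obj \<C>, Hom = (\<lambda>X Y. Hom \<C> Y X), Dom = Cod \<C>, Cod = Dom \<C>,
    Id = Id \<C>, Comp = (\<lambda>g f. f \<circ>\<^bsub>\<C>\<^esub> g)\<rparr>"


section \<open>Functors to modules\<close>

definition linear_map ::
  "('r, 'q) ring_scheme \<Rightarrow> ('r, 'v) module \<Rightarrow> ('r, 'w) module \<Rightarrow> ('v \<Rightarrow> 'w) \<Rightarrow> bool"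
  where "linear_map R V W h \<longleftrightarrow> h \<in> carrier V \<rightarrow> carrier W \<and>
    (\<forall>u\<in>carrier V. \<forall>v\<in>carrier V. h (u \<oplus>\<^bsub>V\<^esub> v) = h u \<oplus>\<^bsub>W\<^esub> h v) \<and>
    (\<forall>r\<in>carrier R. \<forall>v\<in>carrier V. h (r \<odot>\<^bsub>V\<^esub> v) = r \<odot>\<^bsub>W\<^esub> h v)"

record ('r, 'o, 'm, 'v) mod_functor =
  Fib   :: "'o \<Rightarrow> ('r, 'v) module"
  Trans :: "'m \<Rightarrow> 'v \<Rightarrow> 'v"

text \<open>The objects and morphisms of \<open>Mod \<C>\<close>: contravariant \<open>R\<close>-linear functors from \<open>\<C>\<close> to
  \<open>R\<close>-modules, and natural transformations between them. Covariant functors are the case of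
  \<open>op_cat \<C>\<close>.\<close>

locale Mod_object = linear_category R \<C>
  for R :: "('r, 'q) ring_scheme" (structure) and \<C> :: "('r, 'o, 'm) lin_cat" +
  fixes F :: "('r, 'o, 'm, 'v) mod_functor"
  assumes Fib_module: "X \<in> Obj \<C> \<Longrightarrow> module R (Fib F X)"
    and Trans_linear: "\<lbrakk>X \<in> Obj \<C>; Y \<in> Obj \<C>; f \<in> arr \<C> X Y\<rbrakk>
      \<Longrightarrow> linear_map R (Fib F Y) (Fib F X) (Trans F f)"
    and Trans_Id: "\<lbrakk>X \<in> Obj \<C>; v \<in> carrier (Fib F X)\<rbrakk> \<Longrightarrow> Trans F (Id \<C> X) v = v"
    and Trans_Comp: "\<lbrakk>X \<in> Obj \<C>; Y \<in> Obj \<C>; Z \<in> Obj \<C>; f \<in> arr \<C> X Y; g \<in> arr \<C> Y Z;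
        v \<in> carrier (Fib F Z)\<rbrakk> \<Longrightarrow> Trans F (g \<circ>\<^bsub>\<C>\<^esub> f) v = Trans F f (Trans F g v)"
    and Trans_add: "\<lbrakk>X \<in> Obj \<C>; Y \<in> Obj \<C>; f \<in> arr \<C> X Y; f' \<in> arr \<C> X Y; v \<in> carrier (Fib F Y)\<rbrakk>
      \<Longrightarrow> Trans F (f \<oplus>\<^bsub>Hom \<C> X Y\<^esub> f') v = Trans F f v \<oplus>\<^bsub>Fib F X\<^esub> Trans F f' v"
    and Trans_smult: "\<lbrakk>X \<in> Obj \<C>; Y \<in> Obj \<C>; r \<in> carrier R; f \<in> arr \<C> X Y; v \<in> carrier (Fib F Y)\<rbrakk>
      \<Longrightarrow> Trans F (r \<odot>\<^bsub>Hom \<C> X Y\<^esub> f) v = r \<odot>\<^bsub>Fib F X\<^esub> Trans F f v"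

definition Mod_morphism ::
  "('r, 'q) ring_scheme \<Rightarrow> ('r, 'o, 'm) lin_cat \<Rightarrow> ('r, 'o, 'm, 'v) mod_functor \<Rightarrow>
    ('r, 'o, 'm, 'w) mod_functor \<Rightarrow> ('o \<Rightarrow> 'v \<Rightarrow> 'w) \<Rightarrow> bool"
  where "Mod_morphism R \<C> F G \<phi> \<longleftrightarrow> Mod_object R \<C> F \<and> Mod_object R \<C> G \<and>
    (\<forall>X\<in>Obj \<C>. linear_map R (Fib F X) (Fib G X) (\<phi> X)) \<and>
    (\<forall>X\<in>Obj \<C>. \<forall>Y\<in>Obj \<C>. \<forall>f\<in>arr \<C> X Y. \<forall>v\<in>carrier (Fib F Y).
      \<phi> X (Trans F f v) = Trans G f (\<phi> Y v))"

text \<open>Kernels and images in \<open>Mod \<C>\<close> are computed objectwise.\<close>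

definition Mod_exact ::
  "('r, 'q) ring_scheme \<Rightarrow> ('r, 'o, 'm) lin_cat \<Rightarrow> ('r, 'o, 'm, 'u) mod_functor \<Rightarrow> ('o \<Rightarrow> 'u \<Rightarrow> 'v) \<Rightarrow>
    ('r, 'o, 'm, 'v) mod_functor \<Rightarrow> ('o \<Rightarrow> 'v \<Rightarrow> 'w) \<Rightarrow> ('r, 'o, 'm, 'w) mod_functor \<Rightarrow> bool"
  where "Mod_exact R \<C> F \<phi> G \<psi> H \<longleftrightarrow> Mod_morphism R \<C> F G \<phi> \<and> Mod_morphism R \<C> G H \<psi> \<and>
    (\<forall>X\<in>Obj \<C>. \<phi> X ` carrier (Fib F X) = a_kernel (Fib G X) (Fib H X) (\<psi> X))"

text \<open>Exactness of \<open>F 0 \<rightarrow> G 0 \<rightarrow> H 0 \<rightarrow> F 1 \<rightarrow> G 1 \<rightarrow> H 1 \<rightarrow> F 2 \<rightarrow> \<dots>\<close>, with no condition at the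
  starting term \<open>F 0\<close>.\<close>

definition long_exact_Mod ::
  "('r, 'q) ring_scheme \<Rightarrow> ('r, 'o, 'm) lin_cat \<Rightarrow>
    (nat \<Rightarrow> ('r, 'o, 'm, 'v) mod_functor) \<Rightarrow> (nat \<Rightarrow> 'o \<Rightarrow> 'v \<Rightarrow> 'v) \<Rightarrow>
    (nat \<Rightarrow> ('r, 'o, 'm, 'v) mod_functor) \<Rightarrow> (nat \<Rightarrow> 'o \<Rightarrow> 'v \<Rightarrow> 'v) \<Rightarrow>
    (nat \<Rightarrow> ('r, 'o, 'm, 'v) mod_functor) \<Rightarrow> (nat \<Rightarrow> 'o \<Rightarrow> 'v \<Rightarrow> 'v) \<Rightarrow> bool"
  where "long_exact_Mod R \<C> F \<phi> G \<psi> H \<theta> \<longleftrightarrow> (\<forall>n.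
    Mod_exact R \<C> (F n) (\<phi> n) (G n) (\<psi> n) (H n) \<and>
    Mod_exact R \<C> (G n) (\<psi> n) (H n) (\<theta> n) (F (Suc n)) \<and>
    Mod_exact R \<C> (H n) (\<theta> n) (F (Suc n)) (\<phi> (Suc n)) (G (Suc n)))"

text \<open>A functor from \<open>\<C>\<^sup>o\<^sup>p \<times> \<C>\<close> to \<open>R\<close>-modules. For \<open>c : C' \<rightarrow> C\<close> and \<open>a : A \<rightarrow> A'\<close>, the map
  \<open>Act \<E> c a\<close> goes from \<open>Val \<E> C A\<close> to \<open>Val \<E> C' A'\<close>.\<close>

record ('r, 'o, 'm, 'e) bifunctor =
  Val :: "'o \<Rightarrow> 'o \<Rightarrow> ('r, 'e) module"
  Act :: "'m \<Rightarrow> 'm \<Rightarrow> 'e \<Rightarrow> 'e"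

locale bilinear_functor = linear_category R \<C>
  for R :: "('r, 'q) ring_scheme" (structure) and \<C> :: "('r, 'o, 'm) lin_cat" +
  fixes \<E> :: "('r, 'o, 'm, 'e) bifunctor"
  assumes Val_module: "\<lbrakk>C \<in> Obj \<C>; A \<in> Obj \<C>\<rbrakk> \<Longrightarrow> module R (Val \<E> C A)"
    and Act_linear: "\<lbrakk>C \<in> Obj \<C>; C' \<in> Obj \<C>; A \<in> Obj \<C>; A' \<in> Obj \<C>; c \<in> arr \<C> C' C; a \<in> arr \<C> A A'\<rbrakk>
      \<Longrightarrow> linear_map R (Val \<E> C A) (Val \<E> C' A') (Act \<E> c a)"
    and Act_Id: "\<lbrakk>C \<in> Obj \<C>; A \<in> Obj \<C>; \<delta> \<in> carrier (Val \<E> C A)\<rbrakk> \<Longrightarrow> Act \<E> (Id \<C> C) (Id \<C> A) \<delta> = \<delta>"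
    and Act_Comp: "\<lbrakk>C \<in> Obj \<C>; C' \<in> Obj \<C>; C'' \<in> Obj \<C>; A \<in> Obj \<C>; A' \<in> Obj \<C>; A'' \<in> Obj \<C>;
        c \<in> arr \<C> C' C; c' \<in> arr \<C> C'' C'; a \<in> arr \<C> A A'; a' \<in> arr \<C> A' A'';
        \<delta> \<in> carrier (Val \<E> C A)\<rbrakk>
      \<Longrightarrow> Act \<E> (c \<circ>\<^bsub>\<C>\<^esub> c') (a' \<circ>\<^bsub>\<C>\<^esub> a) \<delta> = Act \<E> c' a' (Act \<E> c a \<delta>)"
    and Act_add_left: "\<lbrakk>C \<in> Obj \<C>; C' \<in> Obj \<C>; A \<in> Obj \<C>; A' \<in> Obj \<C>;
        c \<in> arr \<C> C' C; d \<in> arr \<C> C' C; a \<in> arr \<C> A A'; \<delta> \<in> carrier (Val \<E> C A)\<rbrakk>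
      \<Longrightarrow> Act \<E> (c \<oplus>\<^bsub>Hom \<C> C' C\<^esub> d) a \<delta> = Act \<E> c a \<delta> \<oplus>\<^bsub>Val \<E> C' A'\<^esub> Act \<E> d a \<delta>"
    and Act_add_right: "\<lbrakk>C \<in> Obj \<C>; C' \<in> Obj \<C>; A \<in> Obj \<C>; A' \<in> Obj \<C>;
        c \<in> arr \<C> C' C; a \<in> arr \<C> A A'; b \<in> arr \<C> A A'; \<delta> \<in> carrier (Val \<E> C A)\<rbrakk>
      \<Longrightarrow> Act \<E> c (a \<oplus>\<^bsub>Hom \<C> A A'\<^esub> b) \<delta> = Act \<E> c a \<delta> \<oplus>\<^bsub>Val \<E> C' A'\<^esub> Act \<E> c b \<delta>"
    and Act_smult_left: "\<lbrakk>C \<in> Obj \<C>; C' \<in> Obj \<C>; A \<in> Obj \<C>; A' \<in> Obj \<C>; r \<in> carrier R;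
        c \<in> arr \<C> C' C; a \<in> arr \<C> A A'; \<delta> \<in> carrier (Val \<E> C A)\<rbrakk>
      \<Longrightarrow> Act \<E> (r \<odot>\<^bsub>Hom \<C> C' C\<^esub> c) a \<delta> = r \<odot>\<^bsub>Val \<E> C' A'\<^esub> Act \<E> c a \<delta>"
    and Act_smult_right: "\<lbrakk>C \<in> Obj \<C>; C' \<in> Obj \<C>; A \<in> Obj \<C>; A' \<in> Obj \<C>; r \<in> carrier R;
        c \<in> arr \<C> C' C; a \<in> arr \<C> A A'; \<delta> \<in> carrier (Val \<E> C A)\<rbrakk>
      \<Longrightarrow> Act \<E> c (r \<odot>\<^bsub>Hom \<C> A A'\<^esub> a) \<delta> = r \<odot>\<^bsub>Val \<E> C' A'\<^esub> Act \<E> c a \<delta>"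

text \<open>\<open>push \<C> \<E> C a \<delta>\<close> is \<open>a\<^sub>* \<delta> = \<E>(C, a)(\<delta>)\<close> and \<open>pull \<C> \<E> c A \<delta>\<close> is \<open>c\<^sup>* \<delta> = \<E>(c, A)(\<delta>)\<close>.\<close>

definition push :: "('r, 'o, 'm) lin_cat \<Rightarrow> ('r, 'o, 'm, 'e) bifunctor \<Rightarrow> 'o \<Rightarrow> 'm \<Rightarrow> 'e \<Rightarrow> 'e"
  where "push \<C> \<E> C a \<delta> = Act \<E> (Id \<C> C) a \<delta>"

definition pull :: "('r, 'o, 'm) lin_cat \<Rightarrow> ('r, 'o, 'm, 'e) bifunctor \<Rightarrow> 'm \<Rightarrow> 'o \<Rightarrow> 'e \<Rightarrow> 'e"
  where "pull \<C> \<E> c A \<delta> = Act \<E> c (Id \<C> A) \<delta>"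

definition hom_bifunctor :: "('r, 'o, 'm) lin_cat \<Rightarrow> ('r, 'o, 'm, 'm) bifunctor"
  where "hom_bifunctor \<C> = \<lparr>Val = Hom \<C>, Act = (\<lambda>c a f. a \<circ>\<^bsub>\<C>\<^esub> f \<circ>\<^bsub>\<C>\<^esub> c)\<rparr>"


section \<open>Extriangulated categories\<close>

text \<open>A sequence \<open>A \<rightarrow> B \<rightarrow> C\<close> with fixed ends is a triple consisting of the object \<open>B\<close> and the two
  morphisms.\<close>

definition sequences :: "('r, 'o, 'm) lin_cat \<Rightarrow> 'o \<Rightarrow> 'o \<Rightarrow> ('o \<times> 'm \<times> 'm) set"
  where "sequences \<C> A C = {(B, x, y). B \<in> Obj \<C> \<and> x \<in> arr \<C> A B \<and> y \<in> arr \<C> B C}"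

definition isomorphism :: "('r, 'o, 'm) lin_cat \<Rightarrow> 'o \<Rightarrow> 'o \<Rightarrow> 'm \<Rightarrow> bool"
  where "isomorphism \<C> X Y f \<longleftrightarrow> f \<in> arr \<C> X Y \<and>
    (\<exists>g\<in>arr \<C> Y X. g \<circ>\<^bsub>\<C>\<^esub> f = Id \<C> X \<and> f \<circ>\<^bsub>\<C>\<^esub> g = Id \<C> Y)"

definition equivalent_sequences ::
  "('r, 'o, 'm) lin_cat \<Rightarrow> 'o \<Rightarrow> 'o \<Rightarrow> (('o \<times> 'm \<times> 'm) \<times> ('o \<times> 'm \<times> 'm)) set"
  where "equivalent_sequences \<C> A C = {((B, x, y), (B', x', y')).
    (B, x, y) \<in> sequences \<C> A C \<and> (B', x', y') \<in> sequences \<C> A C \<and>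
    (\<exists>b. isomorphism \<C> B B' b \<and> b \<circ>\<^bsub>\<C>\<^esub> x = x' \<and> y' \<circ>\<^bsub>\<C>\<^esub> b = y)}"

text \<open>\<open>ext_sum\<close> characterises \<open>\<theta> = \<delta> \<oplus> \<delta>'\<close> in \<open>\<E>(C \<oplus> C', A \<oplus> A')\<close> by its four components, for given
  inclusions \<open>j\<close>, \<open>j'\<close> into \<open>C \<oplus> C'\<close> and projections \<open>p\<close>, \<open>p'\<close> from \<open>A \<oplus> A'\<close>.\<close>

definition ext_sum :: "('r, 'o, 'm, 'e) bifunctor \<Rightarrow> 'o \<Rightarrow> 'o \<Rightarrow> 'o \<Rightarrow> 'o \<Rightarrow> 'o \<Rightarrow> 'o \<Rightarrow>
    'm \<Rightarrow> 'm \<Rightarrow> 'm \<Rightarrow> 'm \<Rightarrow> 'e \<Rightarrow> 'e \<Rightarrow> 'e \<Rightarrow> bool"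
  where "ext_sum \<E> C C' S A A' P j j' p p' \<delta> \<delta>' \<theta> \<longleftrightarrow> \<theta> \<in> carrier (Val \<E> S P) \<and>
    Act \<E> j p \<theta> = \<delta> \<and> Act \<E> j' p' \<theta> = \<delta>' \<and>
    Act \<E> j p' \<theta> = \<zero>\<^bsub>Val \<E> C A'\<^esub> \<and> Act \<E> j' p \<theta> = \<zero>\<^bsub>Val \<E> C' A\<^esub>"

definition s_triangle :: "('r, 'o, 'm) lin_cat \<Rightarrow> ('r, 'o, 'm, 'e) bifunctor \<Rightarrow>
    ('o \<Rightarrow> 'o \<Rightarrow> 'e \<Rightarrow> ('o \<times> 'm \<times> 'm) set) \<Rightarrow> 'o \<Rightarrow> 'm \<Rightarrow> 'o \<Rightarrow> 'm \<Rightarrow> 'o \<Rightarrow> 'e \<Rightarrow> bool"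
  where "s_triangle \<C> \<E> \<ss> A x B y C \<delta> \<longleftrightarrow>
    A \<in> Obj \<C> \<and> C \<in> Obj \<C> \<and> \<delta> \<in> carrier (Val \<E> C A) \<and> (B, x, y) \<in> \<ss> C A \<delta>"

locale additive_realization = additive_linear_category R \<C> + bilinear_functor R \<C> \<E>
  for R :: "('r, 'q) ring_scheme" (structure) and \<C> :: "('r, 'o, 'm) lin_cat"
    and \<E> :: "('r, 'o, 'm, 'e) bifunctor" +
  fixes \<ss> :: "'o \<Rightarrow> 'o \<Rightarrow> 'e \<Rightarrow> ('o \<times> 'm \<times> 'm) set"
  assumes s_class: "\<lbrakk>C \<in> Obj \<C>; A \<in> Obj \<C>; \<delta> \<in> carrier (Val \<E> C A)\<rbrakk>
      \<Longrightarrow> \<ss> C A \<delta> \<in> sequences \<C> A C // equivalent_sequences \<C> A C"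
    and s_morphism: "\<lbrakk>s_triangle \<C> \<E> \<ss> A x B y C \<delta>; s_triangle \<C> \<E> \<ss> A' x' B' y' C' \<delta>';
        a \<in> arr \<C> A A'; c \<in> arr \<C> C C'; push \<C> \<E> C a \<delta> = pull \<C> \<E> c A' \<delta>'\<rbrakk>
      \<Longrightarrow> \<exists>b\<in>arr \<C> B B'. b \<circ>\<^bsub>\<C>\<^esub> x = x' \<circ>\<^bsub>\<C>\<^esub> a \<and> y' \<circ>\<^bsub>\<C>\<^esub> b = c \<circ>\<^bsub>\<C>\<^esub> y"
    and s_zero: "biproduct \<C> A C P i i' p p' \<Longrightarrow> (P, i, p') \<in> \<ss> C A \<zero>\<^bsub>Val \<E> C A\<^esub>"
    and s_sum: "\<lbrakk>s_triangle \<C> \<E> \<ss> A x B y C \<delta>; s_triangle \<C> \<E> \<ss> A' x' B' y' C' \<delta>';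
        biproduct \<C> A A' P i i' p p'; biproduct \<C> B B' Q k k' q q'; biproduct \<C> C C' S j j' r r';
        ext_sum \<E> C C' S A A' P j j' p p' \<delta> \<delta>' \<theta>\<rbrakk>
      \<Longrightarrow> (Q, (k \<circ>\<^bsub>\<C>\<^esub> x \<circ>\<^bsub>\<C>\<^esub> p) \<oplus>\<^bsub>Hom \<C> P Q\<^esub> (k' \<circ>\<^bsub>\<C>\<^esub> x' \<circ>\<^bsub>\<C>\<^esub> p'),
              (j \<circ>\<^bsub>\<C>\<^esub> y \<circ>\<^bsub>\<C>\<^esub> q) \<oplus>\<^bsub>Hom \<C> Q S\<^esub> (j' \<circ>\<^bsub>\<C>\<^esub> y' \<circ>\<^bsub>\<C>\<^esub> q')) \<in> \<ss> S P \<theta>"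

locale extriangulated_category = additive_realization +
  assumes ET3: "\<lbrakk>s_triangle \<C> \<E> \<ss> A x B y C \<delta>; s_triangle \<C> \<E> \<ss> A' x' B' y' C' \<delta>';
        a \<in> arr \<C> A A'; b \<in> arr \<C> B B'; b \<circ>\<^bsub>\<C>\<^esub> x = x' \<circ>\<^bsub>\<C>\<^esub> a\<rbrakk>
      \<Longrightarrow> \<exists>c\<in>arr \<C> C C'. c \<circ>\<^bsub>\<C>\<^esub> y = y' \<circ>\<^bsub>\<C>\<^esub> b \<and> push \<C> \<E> C a \<delta> = pull \<C> \<E> c A' \<delta>'"
    and ET3_op: "\<lbrakk>s_triangle \<C> \<E> \<ss> A x B y C \<delta>; s_triangle \<C> \<E> \<ss> A' x' B' y' C' \<delta>';
        b \<in> arr \<C> B B'; c \<in> arr \<C> C C'; c \<circ>\<^bsub>\<C>\<^esub> y = y' \<circ>\<^bsub>\<C>\<^esub> b\<rbrakk>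
      \<Longrightarrow> \<exists>a\<in>arr \<C> A A'. b \<circ>\<^bsub>\<C>\<^esub> x = x' \<circ>\<^bsub>\<C>\<^esub> a \<and> push \<C> \<E> C a \<delta> = pull \<C> \<E> c A' \<delta>'"
    and ET4: "\<lbrakk>s_triangle \<C> \<E> \<ss> A f B f' D \<delta>; s_triangle \<C> \<E> \<ss> B g C g' F \<delta>'\<rbrakk>
      \<Longrightarrow> \<exists>E d e h' \<delta>''. E \<in> Obj \<C> \<and> d \<in> arr \<C> D E \<and> e \<in> arr \<C> E F \<and> h' \<in> arr \<C> C E \<and>
          h' \<circ>\<^bsub>\<C>\<^esub> g = d \<circ>\<^bsub>\<C>\<^esub> f' \<and> e \<circ>\<^bsub>\<C>\<^esub> h' = g' \<and>
          s_triangle \<C> \<E> \<ss> A (g \<circ>\<^bsub>\<C>\<^esub> f) C h' E \<delta>'' \<and>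
          s_triangle \<C> \<E> \<ss> D d E e F (push \<C> \<E> F f' \<delta>') \<and>
          pull \<C> \<E> d A \<delta>'' = \<delta> \<and> push \<C> \<E> E f \<delta>'' = pull \<C> \<E> e B \<delta>'"
    and ET4_op: "\<lbrakk>s_triangle \<C> \<E> \<ss> D f' B f A \<delta>; s_triangle \<C> \<E> \<ss> F g' C g B \<delta>'\<rbrakk>
      \<Longrightarrow> \<exists>E d e h' \<delta>''. E \<in> Obj \<C> \<and> d \<in> arr \<C> E D \<and> e \<in> arr \<C> F E \<and> h' \<in> arr \<C> E C \<and>
          g \<circ>\<^bsub>\<C>\<^esub> h' = f' \<circ>\<^bsub>\<C>\<^esub> d \<and> h' \<circ>\<^bsub>\<C>\<^esub> e = g' \<and>
          s_triangle \<C> \<E> \<ss> E h' C (f \<circ>\<^bsub>\<C>\<^esub> g) A \<delta>'' \<and>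
          s_triangle \<C> \<E> \<ss> F e E d D (pull \<C> \<E> f' F \<delta>') \<and>
          push \<C> \<E> A d \<delta>'' = \<delta> \<and> pull \<C> \<E> f E \<delta>'' = push \<C> \<E> B e \<delta>'"


section \<open>Coends\<close>

text \<open>The coend \<open>\<integral>\<^sup>M F(M,Y) \<otimes>\<^sub>R G(X,M)\<close> is the module of formal sums of symbols \<open>\<rho> \<otimes> \<sigma>\<close>, where
  \<open>\<rho> \<in> F(M,Y)\<close> and \<open>\<sigma> \<in> G(X,M)\<close> for some object \<open>M\<close>, modulo bilinearity and the coend relations
  \<open>f\<^sup>*\<rho> \<otimes> \<sigma> = \<rho> \<otimes> f\<^sub>*\<sigma>\<close>. Formal sums are lists of triples \<open>(M, \<rho>, \<sigma>)\<close>, added by concatenation; no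
  formal coefficients or negatives are needed, as \<open>r (\<rho> \<otimes> \<sigma>) = (r \<rho>) \<otimes> \<sigma>\<close>.\<close>

definition tensors :: "('r, 'o, 'm) lin_cat \<Rightarrow> ('r, 'o, 'm, 'f) bifunctor \<Rightarrow>
    ('r, 'o, 'm, 'g) bifunctor \<Rightarrow> 'o \<Rightarrow> 'o \<Rightarrow> ('o \<times> 'f \<times> 'g) list set"
  where "tensors \<C> F G X Y =
    lists {(M, \<rho>, \<sigma>). M \<in> Obj \<C> \<and> \<rho> \<in> carrier (Val F M Y) \<and> \<sigma> \<in> carrier (Val G X M)}"

inductive coend_rel :: "('r, 'q) ring_scheme \<Rightarrow> ('r, 'o, 'm) lin_cat \<Rightarrow>
    ('r, 'o, 'm, 'f) bifunctor \<Rightarrow> ('r, 'o, 'm, 'g) bifunctor \<Rightarrow> 'o \<Rightarrow> 'o \<Rightarrow>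
    ('o \<times> 'f \<times> 'g) list \<Rightarrow> ('o \<times> 'f \<times> 'g) list \<Rightarrow> bool"
  for R :: "('r, 'q) ring_scheme" and \<C> :: "('r, 'o, 'm) lin_cat" and F G X Y
  where
    refl: "k \<in> tensors \<C> F G X Y \<Longrightarrow> coend_rel R \<C> F G X Y k k"
  | sym: "coend_rel R \<C> F G X Y k l \<Longrightarrow> coend_rel R \<C> F G X Y l k"
  | trans: "\<lbrakk>coend_rel R \<C> F G X Y k l; coend_rel R \<C> F G X Y l m\<rbrakk> \<Longrightarrow> coend_rel R \<C> F G X Y k m"
  | append: "\<lbrakk>coend_rel R \<C> F G X Y k k'; coend_rel R \<C> F G X Y l l'\<rbrakk>
      \<Longrightarrow> coend_rel R \<C> F G X Y (k @ l) (k' @ l')"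
  | commute: "\<lbrakk>k \<in> tensors \<C> F G X Y; l \<in> tensors \<C> F G X Y\<rbrakk>
      \<Longrightarrow> coend_rel R \<C> F G X Y (k @ l) (l @ k)"
  | zero: "\<lbrakk>M \<in> Obj \<C>; \<sigma> \<in> carrier (Val G X M)\<rbrakk>
      \<Longrightarrow> coend_rel R \<C> F G X Y [(M, \<zero>\<^bsub>Val F M Y\<^esub>, \<sigma>)] []"
  | add_left: "\<lbrakk>M \<in> Obj \<C>; \<rho> \<in> carrier (Val F M Y); \<rho>' \<in> carrier (Val F M Y); \<sigma> \<in> carrier (Val G X M)\<rbrakk>
      \<Longrightarrow> coend_rel R \<C> F G X Y [(M, \<rho> \<oplus>\<^bsub>Val F M Y\<^esub> \<rho>', \<sigma>)] [(M, \<rho>, \<sigma>), (M, \<rho>', \<sigma>)]"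
  | add_right: "\<lbrakk>M \<in> Obj \<C>; \<rho> \<in> carrier (Val F M Y); \<sigma> \<in> carrier (Val G X M); \<sigma>' \<in> carrier (Val G X M)\<rbrakk>
      \<Longrightarrow> coend_rel R \<C> F G X Y [(M, \<rho>, \<sigma> \<oplus>\<^bsub>Val G X M\<^esub> \<sigma>')] [(M, \<rho>, \<sigma>), (M, \<rho>, \<sigma>')]"
  | smult: "\<lbrakk>M \<in> Obj \<C>; r \<in> carrier R; \<rho> \<in> carrier (Val F M Y); \<sigma> \<in> carrier (Val G X M)\<rbrakk>
      \<Longrightarrow> coend_rel R \<C> F G X Y [(M, r \<odot>\<^bsub>Val F M Y\<^esub> \<rho>, \<sigma>)] [(M, \<rho>, r \<odot>\<^bsub>Val G X M\<^esub> \<sigma>)]"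
  | dinatural: "\<lbrakk>M \<in> Obj \<C>; N \<in> Obj \<C>; f \<in> arr \<C> M N; \<rho> \<in> carrier (Val F N Y); \<sigma> \<in> carrier (Val G X M)\<rbrakk>
      \<Longrightarrow> coend_rel R \<C> F G X Y [(M, pull \<C> F f Y \<rho>, \<sigma>)] [(N, \<rho>, push \<C> G X f \<sigma>)]"

text \<open>The iterated coends below have to live in one type, so the class of a formal sum is
  represented by a chosen element of it: \<open>coend_class k = coend_class l\<close> iff \<open>coend_rel k l\<close>.\<close>

definition coend_class :: "('r, 'q) ring_scheme \<Rightarrow> ('r, 'o, 'm) lin_cat \<Rightarrow>
    ('r, 'o, 'm, 'f) bifunctor \<Rightarrow> ('r, 'o, 'm, 'g) bifunctor \<Rightarrow> 'o \<Rightarrow> 'o \<Rightarrow>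
    ('o \<times> 'f \<times> 'g) list \<Rightarrow> ('o \<times> 'f \<times> 'g) list"
  where "coend_class R \<C> F G X Y k = (SOME l. coend_rel R \<C> F G X Y k l)"

lemma coend_class_eq_iff:
  assumes "k \<in> tensors \<C> F G X Y" "l \<in> tensors \<C> F G X Y"
  shows "coend_class R \<C> F G X Y k = coend_class R \<C> F G X Y l \<longleftrightarrow> coend_rel R \<C> F G X Y k l"
proof
  have *: "coend_rel R \<C> F G X Y m (coend_class R \<C> F G X Y m)" if "m \<in> tensors \<C> F G X Y" for m
    unfolding coend_class_def using coend_rel.refl[OF that] by (rule someI)
  show "coend_rel R \<C> F G X Y k l" if "coend_class R \<C> F G X Y k = coend_class R \<C> F G X Y l"
    using *[OF assms(1)] *[OF assms(2)] that by (metis coend_rel.sym coend_rel.trans)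
  show "coend_class R \<C> F G X Y k = coend_class R \<C> F G X Y l" if "coend_rel R \<C> F G X Y k l"
  proof -
    have "coend_rel R \<C> F G X Y k = coend_rel R \<C> F G X Y l"
      using that by (blast intro: coend_rel.sym coend_rel.trans)
    then show ?thesis
      by (simp add: coend_class_def)
  qed
qed

definition coend :: "('r, 'q) ring_scheme \<Rightarrow> ('r, 'o, 'm) lin_cat \<Rightarrow> ('r, 'o, 'm, 'f) bifunctor \<Rightarrow>
    ('r, 'o, 'm, 'g) bifunctor \<Rightarrow> ('r, 'o, 'm, ('o \<times> 'f \<times> 'g) list) bifunctor"
  where "coend R \<C> F G = \<lparr>
    Val = (\<lambda>X Y. \<lparr>
      carrier = coend_class R \<C> F G X Y ` tensors \<C> F G X Y,
      mult = undefined, one = undefined,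
      zero = coend_class R \<C> F G X Y [],
      add = (\<lambda>k l. coend_class R \<C> F G X Y (k @ l)),
      smult = (\<lambda>r k. coend_class R \<C> F G X Y (map (\<lambda>(M, \<rho>, \<sigma>). (M, r \<odot>\<^bsub>Val F M Y\<^esub> \<rho>, \<sigma>)) k))\<rparr>),
    Act = (\<lambda>c a k. coend_class R \<C> F G (Dom \<C> c) (Cod \<C> a)
      (map (\<lambda>(M, \<rho>, \<sigma>). (M, push \<C> F M a \<rho>, pull \<C> G c M \<sigma>)) k))\<rparr>"


section \<open>Positive extensions\<close>

text \<open>A common type for the elements of all \<open>\<E>\<^sup>n(X,Y)\<close>: those of degree 0 and 1 are tagged, and those
  of higher degree are elements of an iterated coend.\<close>

datatype ('o, 'm, 'e) ext =
    Mor (un_Mor: 'm)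
  | Ext (un_Ext: 'e)
  | Ten (un_Ten: "('o \<times> ('o, 'm, 'e) ext \<times> 'e) list")

definition transport :: "('u \<Rightarrow> 'v) \<Rightarrow> ('v \<Rightarrow> 'u) \<Rightarrow> ('r, 'o, 'm, 'u) bifunctor \<Rightarrow> ('r, 'o, 'm, 'v) bifunctor"
  where "transport emb prj F = \<lparr>
    Val = (\<lambda>X Y. \<lparr>
      carrier = emb ` carrier (Val F X Y),
      mult = undefined, one = undefined,
      zero = emb \<zero>\<^bsub>Val F X Y\<^esub>,
      add = (\<lambda>u v. emb (prj u \<oplus>\<^bsub>Val F X Y\<^esub> prj v)),
      smult = (\<lambda>r u. emb (r \<odot>\<^bsub>Val F X Y\<^esub> prj u))\<rparr>),
    Act = (\<lambda>c a u. emb (Act F c a (prj u)))\<rparr>"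

fun pos_ext :: "('r, 'q) ring_scheme \<Rightarrow> ('r, 'o, 'm) lin_cat \<Rightarrow> ('r, 'o, 'm, 'e) bifunctor \<Rightarrow>
    nat \<Rightarrow> ('r, 'o, 'm, ('o, 'm, 'e) ext) bifunctor"
  where
    "pos_ext R \<C> \<E> 0 = transport Mor un_Mor (hom_bifunctor \<C>)"
  | "pos_ext R \<C> \<E> (Suc 0) = transport Ext un_Ext \<E>"
  | "pos_ext R \<C> \<E> (Suc (Suc n)) = transport Ten un_Ten (coend R \<C> (pos_ext R \<C> \<E> (Suc n)) \<E>)"

text \<open>\<open>cup R \<C> \<E> X M Y s t \<rho> \<sigma>\<close> is \<open>\<rho> \<union> \<sigma> \<in> \<E>\<^sup>s\<^sup>+\<^sup>t(X,Y)\<close> for \<open>\<rho> \<in> \<E>\<^sup>s(M,Y)\<close> and \<open>\<sigma> \<in> \<E>\<^sup>t(X,M)\<close>: the image of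
  \<open>\<rho> \<otimes> \<sigma>\<close> under the canonical isomorphism of \<open>\<integral>\<^sup>M \<E>\<^sup>s(M,Y) \<otimes> \<E>\<^sup>t(X,M)\<close> with \<open>\<E>\<^sup>s\<^sup>+\<^sup>t(X,Y)\<close>. This isomorphism
  comes from the co-Yoneda lemma when \<open>s\<close> or \<open>t\<close> is 0, is the identity when \<open>s > 0\<close> and \<open>t = 1\<close>, and
  is obtained inductively from the associativity of tensor products when \<open>s > 0\<close> and \<open>t \<ge> 2\<close>, so that
  \<open>\<rho> \<union> (\<mu> \<otimes> \<sigma>) = (\<rho> \<union> \<mu>) \<otimes> \<sigma>\<close>.\<close>

fun cup :: "('r, 'q) ring_scheme \<Rightarrow> ('r, 'o, 'm) lin_cat \<Rightarrow> ('r, 'o, 'm, 'e) bifunctor \<Rightarrow>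
    'o \<Rightarrow> 'o \<Rightarrow> 'o \<Rightarrow> nat \<Rightarrow> nat \<Rightarrow> ('o, 'm, 'e) ext \<Rightarrow> ('o, 'm, 'e) ext \<Rightarrow> ('o, 'm, 'e) ext"
  where
    "cup R \<C> \<E> X M Y s 0 \<rho> \<sigma> = pull \<C> (pos_ext R \<C> \<E> s) (un_Mor \<sigma>) Y \<rho>"
  | "cup R \<C> \<E> X M Y 0 (Suc t) \<rho> \<sigma> = push \<C> (pos_ext R \<C> \<E> (Suc t)) X (un_Mor \<rho>) \<sigma>"
  | "cup R \<C> \<E> X M Y (Suc s) (Suc 0) \<rho> \<sigma> =
      Ten (coend_class R \<C> (pos_ext R \<C> \<E> (Suc s)) \<E> X Y [(M, \<rho>, un_Ext \<sigma>)])"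
  | "cup R \<C> \<E> X M Y (Suc s) (Suc (Suc t)) \<rho> \<sigma> =
      Ten (coend_class R \<C> (pos_ext R \<C> \<E> (Suc s + Suc t)) \<E> X Y
        (map (\<lambda>(N, \<mu>, \<kappa>). (N, cup R \<C> \<E> N M Y (Suc s) (Suc t) \<rho> \<mu>, \<kappa>)) (un_Ten \<sigma>)))"

definition delta_lower_sharp :: "('r, 'q) ring_scheme \<Rightarrow> ('r, 'o, 'm) lin_cat \<Rightarrow>
    ('r, 'o, 'm, 'e) bifunctor \<Rightarrow> 'o \<Rightarrow> 'o \<Rightarrow> 'e \<Rightarrow> nat \<Rightarrow> 'o \<Rightarrow> ('o, 'm, 'e) ext \<Rightarrow> ('o, 'm, 'e) ext"
  where "delta_lower_sharp R \<C> \<E> C A \<delta> n X \<sigma> = cup R \<C> \<E> X C A 1 n (Ext \<delta>) \<sigma>"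

definition delta_upper_sharp :: "('r, 'q) ring_scheme \<Rightarrow> ('r, 'o, 'm) lin_cat \<Rightarrow>
    ('r, 'o, 'm, 'e) bifunctor \<Rightarrow> 'o \<Rightarrow> 'o \<Rightarrow> 'e \<Rightarrow> nat \<Rightarrow> 'o \<Rightarrow> ('o, 'm, 'e) ext \<Rightarrow> ('o, 'm, 'e) ext"
  where "delta_upper_sharp R \<C> \<E> C A \<delta> n Y \<sigma> = cup R \<C> \<E> C A Y n 1 \<sigma> (Ext \<delta>)"

text \<open>The functors \<open>\<E>\<^sup>n(-,Y)\<close> in \<open>Mod \<C>\<close> and \<open>\<E>\<^sup>n(X,-)\<close> in \<open>\<C> Mod\<close>.\<close>

definition ext_to :: "('r, 'q) ring_scheme \<Rightarrow> ('r, 'o, 'm) lin_cat \<Rightarrow> ('r, 'o, 'm, 'e) bifunctor \<Rightarrow>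
    'o \<Rightarrow> nat \<Rightarrow> ('r, 'o, 'm, ('o, 'm, 'e) ext) mod_functor"
  where "ext_to R \<C> \<E> Y n = \<lparr>
    Fib = (\<lambda>X. Val (pos_ext R \<C> \<E> n) X Y),
    Trans = (\<lambda>c. pull \<C> (pos_ext R \<C> \<E> n) c Y)\<rparr>"

definition ext_from :: "('r, 'q) ring_scheme \<Rightarrow> ('r, 'o, 'm) lin_cat \<Rightarrow> ('r, 'o, 'm, 'e) bifunctor \<Rightarrow>
    'o \<Rightarrow> nat \<Rightarrow> ('r, 'o, 'm, ('o, 'm, 'e) ext) mod_functor"
  where "ext_from R \<C> \<E> X n = \<lparr>
    Fib = (\<lambda>Y. Val (pos_ext R \<C> \<E> n) X Y),
    Trans = (\<lambda>a. push \<C> (pos_ext R \<C> \<E> n) X a)\<rparr>"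

end

theory Submission
  imports Defs
begin

text \<open>The coend defining \<open>\<E>\<^sup>n\<^sup>+\<^sup>1\<close> is a tensor product, which is only right exact, so exactness of the
  long sequences is not formal. What makes it true is a description of the vanishing tensors. Call a
  contravariant functor half exact if it is exact at the middle of \<open>F(C) \<rightarrow> F(B) \<rightarrow> F(A)\<close> for every
  conflation \<open>A \<rightarrow> B \<rightarrow> C\<close>. If \<open>F\<close> is half exact, then \<open>\<rho> \<otimes> \<sigma> = 0\<close> in \<open>\<integral>\<^sup>M F(M) \<otimes> \<E>(X,M)\<close> holds only for the
  evident reason: there are \<open>f : M \<rightarrow> N\<close> and \<open>\<tau> \<in> F(N)\<close> with \<open>\<rho> = f\<^sup>*\<tau>\<close> and \<open>f\<^sub>*\<sigma> = 0\<close>, so that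
  \<open>\<rho> \<otimes> \<sigma> = \<tau> \<otimes> f\<^sub>*\<sigma> = 0\<close> (lemma \<open>tensor_vanishes\<close>). The point is that such witnesses can be transported
  along the defining relations of the coend. The relation behind all of them is
  \<open>f\<^sup>*\<rho> \<otimes> \<sigma> = \<rho> \<otimes> f\<^sub>*\<sigma>\<close>, and there half exactness is used through \<open>half_exact_annihilate\<close>: an element
  of \<open>F\<close> that dies along \<open>\<phi> : M \<rightarrow> P\<close> extends over a morphism \<open>P \<rightarrow> Q\<close> that kills \<open>\<phi>\<^sub>*\<sigma>\<close>.

  Given this criterion, and the fact that biproducts combine a sum of tensors into a single one, the
  exactness of
  \<open>F(B) \<rightarrow> F(A) \<rightarrow> (F \<otimes> \<E>)(C) \<rightarrow> (F \<otimes> \<E>)(B) \<rightarrow> (F \<otimes> \<E>)(A)\<close>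
  is reduced to that of the classical rows of \<open>\<C>(-,N)\<close> and \<open>\<E>(-,N)\<close>: a vanishing product is first moved
  along \<open>f\<close>, and then only its factor in \<open>\<E>\<close> has to be lifted. The locale \<open>cup_presentation\<close> records what
  this argument uses. In particular \<open>F \<otimes> \<E>\<close> is half exact again, and induction starting from the half
  exact functor \<open>\<C>(-,Y)\<close> gives the sequence of the functors \<open>\<E>\<^sup>n(C,-)\<close>.

  For the sequence of the functors \<open>\<E>\<^sup>n(-,A)\<close> the same argument is applied in the opposite category, to the
  products \<open>\<rho> \<union> \<sigma>\<close> of \<open>\<rho> \<in> \<E>(M,Y)\<close> with \<open>\<sigma> \<in> \<E>\<^sup>n(X,M)\<close>. The coend splits off a factor \<open>\<E>\<close> on the other side,
  so the criterion for \<open>\<rho> \<union> \<sigma> = 0\<close> is no longer an instance of the one for coends. It is proved by induction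
  on \<open>n\<close> (lemma \<open>cupl_vanishes\<close>): for \<open>\<sigma> = \<mu> \<union> \<kappa>\<close> one has \<open>\<rho> \<union> \<sigma> = (\<rho> \<union> \<mu>) \<union> \<kappa>\<close>, to which the
  criterion for the last factor and then the induction hypothesis for \<open>\<rho> \<union> \<mu>\<close> apply.\<close>

section \<open>Linear maps and bilinear functors\<close>

text \<open>The axioms of linear categories and bilinear functors are relative to the set of objects. Bundling
  the membership of the end points into the sets of morphisms and of elements removes most of these side
  conditions below.\<close>

definition homs :: "('r, 'o, 'm) lin_cat \<Rightarrow> 'o \<Rightarrow> 'o \<Rightarrow> 'm set"
  where "homs \<C> X Y = {f \<in> arr \<C> X Y. X \<in> Obj \<C> \<and> Y \<in> Obj \<C>}"

definition elts :: "('r, 'o, 'm) lin_cat \<Rightarrow> ('r, 'o, 'm, 'e) bifunctor \<Rightarrow> 'o \<Rightarrow> 'o \<Rightarrow> 'e set"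
  where "elts \<C> F X Y = {\<rho> \<in> carrier (Val F X Y). X \<in> Obj \<C> \<and> Y \<in> Obj \<C>}"

lemma homs_iff: "f \<in> homs \<C> X Y \<longleftrightarrow> f \<in> arr \<C> X Y \<and> X \<in> Obj \<C> \<and> Y \<in> Obj \<C>"
  by (simp add: homs_def)

lemma elts_iff: "\<rho> \<in> elts \<C> F X Y \<longleftrightarrow> \<rho> \<in> carrier (Val F X Y) \<and> X \<in> Obj \<C> \<and> Y \<in> Obj \<C>"
  by (simp add: elts_def)

text \<open>This is how additivity alone yields preservation of zero, for maps and for actions of zero
  morphisms.\<close>

lemma (in abelian_group) double_eq_zero:
  assumes "v \<in> carrier G" "v \<oplus> v = v"
  shows "v = \<zero>"
  using assms by (metis add.r_cancel_one')

lemma linear_map_zero: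
  assumes "linear_map R V W h" "module R V" "module R W"
  shows "h \<zero>\<^bsub>V\<^esub> = \<zero>\<^bsub>W\<^esub>"
proof -
  interpret V: module R V by fact
  interpret W: module R W by fact
  have "h \<zero>\<^bsub>V\<^esub> \<in> carrier W" and "h \<zero>\<^bsub>V\<^esub> \<oplus>\<^bsub>W\<^esub> h \<zero>\<^bsub>V\<^esub> = h \<zero>\<^bsub>V\<^esub>"
    using assms(1) V.M.zero_closed V.M.l_zero unfolding linear_map_def by (force, metis)
  then show ?thesis
    by (rule W.double_eq_zero)
qed

lemma linear_map_neg:
  assumes "linear_map R V W h" "module R V" "module R W" "v \<in> carrier V"
  shows "h (\<ominus>\<^bsub>V\<^esub> v) = \<ominus>\<^bsub>W\<^esub> h v"
proof -
  interpret V: module R V by fact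
  interpret W: module R W by fact
  have "h (\<ominus>\<^bsub>V\<^esub> v) \<oplus>\<^bsub>W\<^esub> h v = h (\<ominus>\<^bsub>V\<^esub> v \<oplus>\<^bsub>V\<^esub> v)"
    using assms(1,4) unfolding linear_map_def by simp
  also have "\<dots> = \<zero>\<^bsub>W\<^esub>"
    using assms by (simp add: V.M.l_neg linear_map_zero)
  finally show ?thesis
    using assms(1,4) unfolding linear_map_def
    by (intro W.M.minus_equality[symmetric]) (auto simp: Pi_iff)
qed

context linear_category
begin

lemma homs_group: "X \<in> Obj \<C> \<Longrightarrow> Y \<in> Obj \<C> \<Longrightarrow> abelian_group (Hom \<C> X Y)"
  using Hom_module by (simp add: module_def)

lemma zero_homs [intro]: "X \<in> Obj \<C> \<Longrightarrow> Y \<in> Obj \<C> \<Longrightarrow> \<zero>\<^bsub>Hom \<C> X Y\<^esub> \<in> homs \<C> X Y"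
  by (simp add: homs_iff abelian_group.axioms(1) abelian_monoid.zero_closed homs_group)

lemma Id_homs [intro]: "X \<in> Obj \<C> \<Longrightarrow> Id \<C> X \<in> homs \<C> X X"
  by (simp add: homs_iff Id_arr)

lemma Comp_homs [intro]: "f \<in> homs \<C> X Y \<Longrightarrow> g \<in> homs \<C> Y Z \<Longrightarrow> g \<circ>\<^bsub>\<C>\<^esub> f \<in> homs \<C> X Z"
  by (auto simp: homs_iff intro: Comp_arr)

lemma add_homs [intro]: "f \<in> homs \<C> X Y \<Longrightarrow> g \<in> homs \<C> X Y \<Longrightarrow> f \<oplus>\<^bsub>Hom \<C> X Y\<^esub> g \<in> homs \<C> X Y"
  by (simp add: homs_iff abelian_group.axioms(1) abelian_monoid.a_closed homs_group)

lemma smult_homs [intro]: "r \<in> carrier R \<Longrightarrow> f \<in> homs \<C> X Y \<Longrightarrow> r \<odot>\<^bsub>Hom \<C> X Y\<^esub> f \<in> homs \<C> X Y"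
  by (simp add: homs_iff module.smult_closed[OF Hom_module])

lemma Comp_Id_right: "f \<in> homs \<C> X Y \<Longrightarrow> f \<circ>\<^bsub>\<C>\<^esub> Id \<C> X = f"
  using Comp_Id[of X Y f] by (simp add: homs_iff)

lemma Comp_Id_left: "f \<in> homs \<C> X Y \<Longrightarrow> Id \<C> Y \<circ>\<^bsub>\<C>\<^esub> f = f"
  using Comp_Id[of X Y f] by (simp add: homs_iff)

lemma Comp_assoc': "f \<in> homs \<C> W X \<Longrightarrow> g \<in> homs \<C> X Y \<Longrightarrow> h \<in> homs \<C> Y Z
    \<Longrightarrow> (h \<circ>\<^bsub>\<C>\<^esub> g) \<circ>\<^bsub>\<C>\<^esub> f = h \<circ>\<^bsub>\<C>\<^esub> (g \<circ>\<^bsub>\<C>\<^esub> f)"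
  by (simp add: homs_iff Comp_assoc[of W X Y Z])

lemma Comp_distrib_left: "f \<in> homs \<C> X Y \<Longrightarrow> g \<in> homs \<C> Y Z \<Longrightarrow> g' \<in> homs \<C> Y Z
    \<Longrightarrow> (g \<oplus>\<^bsub>Hom \<C> Y Z\<^esub> g') \<circ>\<^bsub>\<C>\<^esub> f = (g \<circ>\<^bsub>\<C>\<^esub> f) \<oplus>\<^bsub>Hom \<C> X Z\<^esub> (g' \<circ>\<^bsub>\<C>\<^esub> f)"
  by (simp add: homs_iff Comp_add_left)

lemma Comp_distrib_right: "f \<in> homs \<C> X Y \<Longrightarrow> f' \<in> homs \<C> X Y \<Longrightarrow> g \<in> homs \<C> Y Z
    \<Longrightarrow> g \<circ>\<^bsub>\<C>\<^esub> (f \<oplus>\<^bsub>Hom \<C> X Y\<^esub> f') = (g \<circ>\<^bsub>\<C>\<^esub> f) \<oplus>\<^bsub>Hom \<C> X Z\<^esub> (g \<circ>\<^bsub>\<C>\<^esub> f')"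
  by (simp add: homs_iff Comp_add_right)

lemma Comp_zero_left:
  assumes "f \<in> homs \<C> X Y" "Z \<in> Obj \<C>"
  shows "\<zero>\<^bsub>Hom \<C> Y Z\<^esub> \<circ>\<^bsub>\<C>\<^esub> f = \<zero>\<^bsub>Hom \<C> X Z\<^esub>"
proof -
  interpret XZ: abelian_group "Hom \<C> X Z" using assms by (simp add: homs_iff homs_group)
  interpret YZ: abelian_group "Hom \<C> Y Z" using assms by (simp add: homs_iff homs_group)
  have z: "\<zero>\<^bsub>Hom \<C> Y Z\<^esub> \<in> homs \<C> Y Z" using assms by (auto simp: homs_iff)
  have "\<zero>\<^bsub>Hom \<C> Y Z\<^esub> \<circ>\<^bsub>\<C>\<^esub> f \<in> carrier (Hom \<C> X Z)"
    using Comp_homs[OF assms(1) z] by (simp add: homs_iff)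
  then show ?thesis
    using Comp_distrib_left[OF assms(1) z z] by (auto intro: XZ.double_eq_zero)
qed

lemma Comp_zero_right:
  assumes "g \<in> homs \<C> Y Z" "X \<in> Obj \<C>"
  shows "g \<circ>\<^bsub>\<C>\<^esub> \<zero>\<^bsub>Hom \<C> X Y\<^esub> = \<zero>\<^bsub>Hom \<C> X Z\<^esub>"
proof -
  interpret XZ: abelian_group "Hom \<C> X Z" using assms by (simp add: homs_iff homs_group)
  interpret XY: abelian_group "Hom \<C> X Y" using assms by (simp add: homs_iff homs_group)
  have z: "\<zero>\<^bsub>Hom \<C> X Y\<^esub> \<in> homs \<C> X Y" using assms by (auto simp: homs_iff)
  have "g \<circ>\<^bsub>\<C>\<^esub> \<zero>\<^bsub>Hom \<C> X Y\<^esub> \<in> carrier (Hom \<C> X Z)"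
    using Comp_homs[OF z assms(1)] by (simp add: homs_iff)
  then show ?thesis
    using Comp_distrib_right[OF z z assms(1)] by (auto intro: XZ.double_eq_zero)
qed

end

context bilinear_functor
begin

lemma elts_group: "X \<in> Obj \<C> \<Longrightarrow> Y \<in> Obj \<C> \<Longrightarrow> abelian_group (Val \<E> X Y)"
  using Val_module by (simp add: module_def)

lemma zero_elts [intro]: "X \<in> Obj \<C> \<Longrightarrow> Y \<in> Obj \<C> \<Longrightarrow> \<zero>\<^bsub>Val \<E> X Y\<^esub> \<in> elts \<C> \<E> X Y"
  by (simp add: elts_iff abelian_group.axioms(1) abelian_monoid.zero_closed elts_group)

lemma add_elts [intro]: "\<rho> \<in> elts \<C> \<E> X Y \<Longrightarrow> \<sigma> \<in> elts \<C> \<E> X Y \<Longrightarrow> \<rho> \<oplus>\<^bsub>Val \<E> X Y\<^esub> \<sigma> \<in> elts \<C> \<E> X Y"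
  by (simp add: elts_iff abelian_group.axioms(1) abelian_monoid.a_closed elts_group)

lemma neg_elts [intro]: "\<rho> \<in> elts \<C> \<E> X Y \<Longrightarrow> \<ominus>\<^bsub>Val \<E> X Y\<^esub> \<rho> \<in> elts \<C> \<E> X Y"
  by (simp add: elts_iff abelian_group.a_inv_closed elts_group)

lemma smult_elts [intro]: "r \<in> carrier R \<Longrightarrow> \<rho> \<in> elts \<C> \<E> X Y \<Longrightarrow> r \<odot>\<^bsub>Val \<E> X Y\<^esub> \<rho> \<in> elts \<C> \<E> X Y"
  by (simp add: elts_iff module.smult_closed[OF Val_module])

lemma add_zero_elts: "\<rho> \<in> elts \<C> \<E> X Y \<Longrightarrow> \<rho> \<oplus>\<^bsub>Val \<E> X Y\<^esub> \<zero>\<^bsub>Val \<E> X Y\<^esub> = \<rho>"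
  "\<rho> \<in> elts \<C> \<E> X Y \<Longrightarrow> \<zero>\<^bsub>Val \<E> X Y\<^esub> \<oplus>\<^bsub>Val \<E> X Y\<^esub> \<rho> = \<rho>"
  by (simp_all add: elts_iff abelian_group.axioms(1) abelian_monoid.r_zero abelian_monoid.l_zero
      elts_group)

lemma add_neg_elts: "\<rho> \<in> elts \<C> \<E> X Y \<Longrightarrow> \<rho> \<oplus>\<^bsub>Val \<E> X Y\<^esub> \<ominus>\<^bsub>Val \<E> X Y\<^esub> \<rho> = \<zero>\<^bsub>Val \<E> X Y\<^esub>"
  by (simp add: elts_iff abelian_group.r_neg elts_group)

lemma neg_unique:
  assumes "\<rho> \<in> elts \<C> \<E> X Y" "\<sigma> \<in> elts \<C> \<E> X Y" "\<rho> \<oplus>\<^bsub>Val \<E> X Y\<^esub> \<sigma> = \<zero>\<^bsub>Val \<E> X Y\<^esub>"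
  shows "\<rho> = \<ominus>\<^bsub>Val \<E> X Y\<^esub> \<sigma>"
proof -
  interpret abelian_group "Val \<E> X Y" using assms by (simp add: elts_iff elts_group)
  show ?thesis using assms by (simp add: elts_iff minus_equality)
qed

lemma neg_zero_elts: "X \<in> Obj \<C> \<Longrightarrow> Y \<in> Obj \<C> \<Longrightarrow> \<ominus>\<^bsub>Val \<E> X Y\<^esub> \<zero>\<^bsub>Val \<E> X Y\<^esub> = \<zero>\<^bsub>Val \<E> X Y\<^esub>"
  using neg_unique[of "\<zero>\<^bsub>Val \<E> X Y\<^esub>" X Y "\<zero>\<^bsub>Val \<E> X Y\<^esub>"] zero_elts add_zero_elts by metis

lemma push_linear:
  assumes "a \<in> homs \<C> Y Y'" "X \<in> Obj \<C>"
  shows "linear_map R (Val \<E> X Y) (Val \<E> X Y') (push \<C> \<E> X a)"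
  using Act_linear[OF _ _ _ _ Id_arr, of X Y Y' a] assms
  by (simp add: push_def[abs_def] homs_iff)

lemma pull_linear:
  assumes "c \<in> homs \<C> X' X" "Y \<in> Obj \<C>"
  shows "linear_map R (Val \<E> X Y) (Val \<E> X' Y) (pull \<C> \<E> c Y)"
  using Act_linear[OF _ _ _ _ _ Id_arr, of X X' Y c] assms
  by (simp add: pull_def[abs_def] homs_iff)

lemma push_elts [intro]: "a \<in> homs \<C> Y Y' \<Longrightarrow> \<rho> \<in> elts \<C> \<E> X Y \<Longrightarrow> push \<C> \<E> X a \<rho> \<in> elts \<C> \<E> X Y'"
  using push_linear[of a Y Y' X] by (auto simp: elts_iff homs_iff linear_map_def)

lemma pull_elts [intro]: "c \<in> homs \<C> X' X \<Longrightarrow> \<rho> \<in> elts \<C> \<E> X Y \<Longrightarrow> pull \<C> \<E> c Y \<rho> \<in> elts \<C> \<E> X' Y"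
  using pull_linear[of c X' X Y] by (auto simp: elts_iff homs_iff linear_map_def)

lemma push_zero: "a \<in> homs \<C> Y Y' \<Longrightarrow> X \<in> Obj \<C> \<Longrightarrow> push \<C> \<E> X a \<zero>\<^bsub>Val \<E> X Y\<^esub> = \<zero>\<^bsub>Val \<E> X Y'\<^esub>"
  by (rule linear_map_zero[OF push_linear]) (auto simp: homs_iff Val_module)

lemma pull_zero: "c \<in> homs \<C> X' X \<Longrightarrow> Y \<in> Obj \<C> \<Longrightarrow> pull \<C> \<E> c Y \<zero>\<^bsub>Val \<E> X Y\<^esub> = \<zero>\<^bsub>Val \<E> X' Y\<^esub>"
  by (rule linear_map_zero[OF pull_linear]) (auto simp: homs_iff Val_module)

lemma pull_neg: "c \<in> homs \<C> X' X \<Longrightarrow> \<rho> \<in> elts \<C> \<E> X Y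
    \<Longrightarrow> pull \<C> \<E> c Y (\<ominus>\<^bsub>Val \<E> X Y\<^esub> \<rho>) = \<ominus>\<^bsub>Val \<E> X' Y\<^esub> pull \<C> \<E> c Y \<rho>"
  by (rule linear_map_neg[OF pull_linear]) (auto simp: homs_iff elts_iff Val_module)

lemma push_add: "a \<in> homs \<C> Y Y' \<Longrightarrow> \<rho> \<in> elts \<C> \<E> X Y \<Longrightarrow> \<sigma> \<in> elts \<C> \<E> X Y
    \<Longrightarrow> push \<C> \<E> X a (\<rho> \<oplus>\<^bsub>Val \<E> X Y\<^esub> \<sigma>) = push \<C> \<E> X a \<rho> \<oplus>\<^bsub>Val \<E> X Y'\<^esub> push \<C> \<E> X a \<sigma>"
  using push_linear[of a Y Y' X] by (auto simp: elts_iff linear_map_def)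

lemma pull_add: "c \<in> homs \<C> X' X \<Longrightarrow> \<rho> \<in> elts \<C> \<E> X Y \<Longrightarrow> \<sigma> \<in> elts \<C> \<E> X Y
    \<Longrightarrow> pull \<C> \<E> c Y (\<rho> \<oplus>\<^bsub>Val \<E> X Y\<^esub> \<sigma>) = pull \<C> \<E> c Y \<rho> \<oplus>\<^bsub>Val \<E> X' Y\<^esub> pull \<C> \<E> c Y \<sigma>"
  using pull_linear[of c X' X Y] by (auto simp: elts_iff linear_map_def)

lemma push_smult: "a \<in> homs \<C> Y Y' \<Longrightarrow> \<rho> \<in> elts \<C> \<E> X Y \<Longrightarrow> r \<in> carrier R
    \<Longrightarrow> push \<C> \<E> X a (r \<odot>\<^bsub>Val \<E> X Y\<^esub> \<rho>) = r \<odot>\<^bsub>Val \<E> X Y'\<^esub> push \<C> \<E> X a \<rho>"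
  using push_linear[of a Y Y' X] by (auto simp: elts_iff linear_map_def)

lemma pull_smult: "c \<in> homs \<C> X' X \<Longrightarrow> \<rho> \<in> elts \<C> \<E> X Y \<Longrightarrow> r \<in> carrier R
    \<Longrightarrow> pull \<C> \<E> c Y (r \<odot>\<^bsub>Val \<E> X Y\<^esub> \<rho>) = r \<odot>\<^bsub>Val \<E> X' Y\<^esub> pull \<C> \<E> c Y \<rho>"
  using pull_linear[of c X' X Y] by (auto simp: elts_iff linear_map_def)

lemma push_Id: "\<rho> \<in> elts \<C> \<E> X Y \<Longrightarrow> push \<C> \<E> X (Id \<C> Y) \<rho> = \<rho>"
  by (simp add: push_def elts_iff Act_Id)

lemma pull_Id: "\<rho> \<in> elts \<C> \<E> X Y \<Longrightarrow> pull \<C> \<E> (Id \<C> X) Y \<rho> = \<rho>"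
  by (simp add: pull_def elts_iff Act_Id)

lemma Act_Comp': "c \<in> homs \<C> X' X \<Longrightarrow> c' \<in> homs \<C> X'' X' \<Longrightarrow> a \<in> homs \<C> Y Y' \<Longrightarrow> a' \<in> homs \<C> Y' Y''
    \<Longrightarrow> \<rho> \<in> elts \<C> \<E> X Y \<Longrightarrow> Act \<E> (c \<circ>\<^bsub>\<C>\<^esub> c') (a' \<circ>\<^bsub>\<C>\<^esub> a) \<rho> = Act \<E> c' a' (Act \<E> c a \<rho>)"
  by (rule Act_Comp[of X X' X'' Y Y' Y'']) (auto simp: homs_iff elts_iff)

lemma push_Comp: "a \<in> homs \<C> Y Y' \<Longrightarrow> a' \<in> homs \<C> Y' Y'' \<Longrightarrow> \<rho> \<in> elts \<C> \<E> X Y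
    \<Longrightarrow> push \<C> \<E> X (a' \<circ>\<^bsub>\<C>\<^esub> a) \<rho> = push \<C> \<E> X a' (push \<C> \<E> X a \<rho>)"
  using Act_Comp'[OF Id_homs Id_homs, of X a Y Y' a' Y'' \<rho>]
  by (auto simp: push_def elts_iff Comp_Id_right[OF Id_homs])

lemma pull_Comp: "c \<in> homs \<C> X' X \<Longrightarrow> c' \<in> homs \<C> X'' X' \<Longrightarrow> \<rho> \<in> elts \<C> \<E> X Y
    \<Longrightarrow> pull \<C> \<E> (c \<circ>\<^bsub>\<C>\<^esub> c') Y \<rho> = pull \<C> \<E> c' Y (pull \<C> \<E> c Y \<rho>)"
  using Act_Comp'[OF _ _ Id_homs Id_homs, of c X' X c' X'' Y \<rho>]
  by (auto simp: pull_def elts_iff Comp_Id_right[OF Id_homs])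

text \<open>Every action of a bilinear functor is a pullback followed by a pushforward, in either order. The
  one-sided actions are easier to calculate with.\<close>

lemma Act_push_pull: "c \<in> homs \<C> X' X \<Longrightarrow> a \<in> homs \<C> Y Y' \<Longrightarrow> \<rho> \<in> elts \<C> \<E> X Y
    \<Longrightarrow> Act \<E> c a \<rho> = push \<C> \<E> X' a (pull \<C> \<E> c Y \<rho>)"
  using Act_Comp'[OF _ Id_homs Id_homs, of c X' X Y a Y' \<rho>]
  by (auto simp: push_def pull_def homs_iff Comp_Id_right[of c X' X] Comp_Id_right[of a Y Y'])

lemma Act_pull_push: "c \<in> homs \<C> X' X \<Longrightarrow> a \<in> homs \<C> Y Y' \<Longrightarrow> \<rho> \<in> elts \<C> \<E> X Y
    \<Longrightarrow> Act \<E> c a \<rho> = pull \<C> \<E> c Y' (push \<C> \<E> X a \<rho>)"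
  using Act_Comp'[OF Id_homs _ _ Id_homs, of X c X' a Y Y' \<rho>]
  by (auto simp: push_def pull_def homs_iff Comp_Id_left[of c X' X] Comp_Id_left[of a Y Y'])

lemma push_pull: "c \<in> homs \<C> X' X \<Longrightarrow> a \<in> homs \<C> Y Y' \<Longrightarrow> \<rho> \<in> elts \<C> \<E> X Y
    \<Longrightarrow> push \<C> \<E> X' a (pull \<C> \<E> c Y \<rho>) = pull \<C> \<E> c Y' (push \<C> \<E> X a \<rho>)"
  using Act_push_pull[of c X' X a Y Y' \<rho>] Act_pull_push[of c X' X a Y Y' \<rho>] by simp

lemma push_add_arr: "a \<in> homs \<C> Y Y' \<Longrightarrow> b \<in> homs \<C> Y Y' \<Longrightarrow> \<rho> \<in> elts \<C> \<E> X Y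
    \<Longrightarrow> push \<C> \<E> X (a \<oplus>\<^bsub>Hom \<C> Y Y'\<^esub> b) \<rho> = push \<C> \<E> X a \<rho> \<oplus>\<^bsub>Val \<E> X Y'\<^esub> push \<C> \<E> X b \<rho>"
  using Act_add_right[of X X Y Y' "Id \<C> X" a b \<rho>] by (simp add: push_def elts_iff homs_iff Id_arr)

lemma pull_add_arr: "c \<in> homs \<C> X' X \<Longrightarrow> d \<in> homs \<C> X' X \<Longrightarrow> \<rho> \<in> elts \<C> \<E> X Y
    \<Longrightarrow> pull \<C> \<E> (c \<oplus>\<^bsub>Hom \<C> X' X\<^esub> d) Y \<rho> = pull \<C> \<E> c Y \<rho> \<oplus>\<^bsub>Val \<E> X' Y\<^esub> pull \<C> \<E> d Y \<rho>"
  using Act_add_left[of X X' Y Y c d "Id \<C> Y" \<rho>] by (simp add: pull_def elts_iff homs_iff Id_arr)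

lemma push_smult_arr: "a \<in> homs \<C> Y Y' \<Longrightarrow> r \<in> carrier R \<Longrightarrow> \<rho> \<in> elts \<C> \<E> X Y
    \<Longrightarrow> push \<C> \<E> X (r \<odot>\<^bsub>Hom \<C> Y Y'\<^esub> a) \<rho> = r \<odot>\<^bsub>Val \<E> X Y'\<^esub> push \<C> \<E> X a \<rho>"
  using Act_smult_right[of X X Y Y' r "Id \<C> X" a \<rho>] by (simp add: push_def elts_iff homs_iff Id_arr)

lemma pull_smult_arr: "c \<in> homs \<C> X' X \<Longrightarrow> r \<in> carrier R \<Longrightarrow> \<rho> \<in> elts \<C> \<E> X Y
    \<Longrightarrow> pull \<C> \<E> (r \<odot>\<^bsub>Hom \<C> X' X\<^esub> c) Y \<rho> = r \<odot>\<^bsub>Val \<E> X' Y\<^esub> pull \<C> \<E> c Y \<rho>"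
  using Act_smult_left[of X X' Y Y r c "Id \<C> Y" \<rho>] by (simp add: pull_def elts_iff homs_iff Id_arr)

lemma push_zero_arr:
  assumes "Y' \<in> Obj \<C>" "\<rho> \<in> elts \<C> \<E> X Y"
  shows "push \<C> \<E> X \<zero>\<^bsub>Hom \<C> Y Y'\<^esub> \<rho> = \<zero>\<^bsub>Val \<E> X Y'\<^esub>"
proof -
  have z: "\<zero>\<^bsub>Hom \<C> Y Y'\<^esub> \<in> homs \<C> Y Y'" using assms by (auto simp: elts_iff)
  interpret V: abelian_group "Val \<E> X Y'" using assms by (simp add: elts_iff elts_group)
  interpret H: abelian_group "Hom \<C> Y Y'" using assms by (simp add: elts_iff homs_group)
  show ?thesis
    using push_add_arr[OF z z assms(2)] push_elts[OF z assms(2)]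
    by (auto simp: elts_iff intro: V.double_eq_zero)
qed

lemma pull_zero_arr:
  assumes "X' \<in> Obj \<C>" "\<rho> \<in> elts \<C> \<E> X Y"
  shows "pull \<C> \<E> \<zero>\<^bsub>Hom \<C> X' X\<^esub> Y \<rho> = \<zero>\<^bsub>Val \<E> X' Y\<^esub>"
proof -
  have z: "\<zero>\<^bsub>Hom \<C> X' X\<^esub> \<in> homs \<C> X' X" using assms by (auto simp: elts_iff)
  interpret V: abelian_group "Val \<E> X' Y" using assms by (simp add: elts_iff elts_group)
  interpret H: abelian_group "Hom \<C> X' X" using assms by (simp add: elts_iff homs_group)
  show ?thesis
    using pull_add_arr[OF z z assms(2)] pull_elts[OF z assms(2)]
    by (auto simp: elts_iff intro: V.double_eq_zero)
qed

end

section \<open>Passage to the opposite category\<close>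

text \<open>Each half of the theory of triangles is proved once and read again in the opposite category. The
  simplification rules below make such readings definitional, as pushforward and pullback are exchanged.\<close>

definition op_bif :: "('r, 'o, 'm, 'e) bifunctor \<Rightarrow> ('r, 'o, 'm, 'e) bifunctor"
  where "op_bif F = \<lparr>Val = (\<lambda>X Y. Val F Y X), Act = (\<lambda>c a. Act F a c)\<rparr>"

lemma op_cat_simps [simp]:
  "Obj (op_cat \<C>) = Obj \<C>" "Hom (op_cat \<C>) X Y = Hom \<C> Y X" "Dom (op_cat \<C>) = Cod \<C>"
  "Cod (op_cat \<C>) = Dom \<C>" "Id (op_cat \<C>) = Id \<C>" "g \<circ>\<^bsub>op_cat \<C>\<^esub> f = f \<circ>\<^bsub>\<C>\<^esub> g"
  by (simp_all add: op_cat_def)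

lemma op_bif_simps [simp]:
  "Val (op_bif F) X Y = Val F Y X" "Act (op_bif F) c a = Act F a c"
  by (simp_all add: op_bif_def)

lemma op_homs [simp]: "homs (op_cat \<C>) X Y = homs \<C> Y X"
  by (auto simp: homs_iff)

lemma op_elts [simp]: "elts (op_cat \<C>) (op_bif F) X Y = elts \<C> F Y X"
  by (auto simp: elts_iff)

lemma op_push_pull [simp]:
  "push (op_cat \<C>) (op_bif F) X a = pull \<C> F a X"
  "pull (op_cat \<C>) (op_bif F) c Y = push \<C> F Y c"
  by (simp_all add: push_def[abs_def] pull_def[abs_def] fun_eq_iff)

lemma op_biproduct [simp]:
  "biproduct (op_cat \<C>) A A' P i i' p p' \<longleftrightarrow> biproduct \<C> A A' P p p' i i'"
  by (auto simp: biproduct_def)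

lemma op_zero_object [simp]: "zero_object (op_cat \<C>) Z \<longleftrightarrow> zero_object \<C> Z"
  by (auto simp: zero_object_def)

lemma (in linear_category) linear_category_op: "linear_category R (op_cat \<C>)"
proof (intro linear_category.intro linear_category_axioms.intro cring_axioms, goal_cases)
  case (6 W X Y Z f g h)
  then show ?case by (simp add: Comp_assoc[of Z Y X W h g f])
next
  case (4 X Y Z f g)
  then show ?case using Comp_arr[of Z Y X g f] by simp
next
  case (5 X Y f)
  then show ?case using Comp_Id[of Y X f] by simp
qed (simp_all add: Hom_module Dom_Cod Id_arr Comp_add_left Comp_add_right
    Comp_smult_left Comp_smult_right)

lemma (in additive_linear_category) additive_linear_category_op:
  "additive_linear_category R (op_cat \<C>)"
proof -
  interpret op: linear_category R "op_cat \<C>" by (rule linear_category_op)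
  show ?thesis
    using has_zero_object has_biproducts
    by (intro additive_linear_category.intro additive_linear_category_axioms.intro
        op.linear_category_axioms) (simp, simp, blast)
qed

lemma (in bilinear_functor) bilinear_functor_op: "bilinear_functor R (op_cat \<C>) (op_bif \<E>)"
proof -
  interpret op: linear_category R "op_cat \<C>" by (rule linear_category_op)
  show ?thesis
  proof (intro bilinear_functor.intro bilinear_functor_axioms.intro op.linear_category_axioms, goal_cases)
    case (4 C C' C'' A A' A'' c c' a a' \<delta>)
    then show ?case by (simp add: Act_Comp[of A A' A'' C C' C''])
  qed (simp_all add: Val_module Act_linear Act_Id Act_add_left Act_add_right Act_smult_left
      Act_smult_right)
qed

section \<open>Triangles and their exact rows\<close>

lemma biproductD:
  assumes "biproduct \<C> A A' P i i' p p'"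
  shows "i \<in> homs \<C> A P" "i' \<in> homs \<C> A' P" "p \<in> homs \<C> P A" "p' \<in> homs \<C> P A'"
    "p \<circ>\<^bsub>\<C>\<^esub> i = Id \<C> A" "p' \<circ>\<^bsub>\<C>\<^esub> i' = Id \<C> A'"
    "p' \<circ>\<^bsub>\<C>\<^esub> i = \<zero>\<^bsub>Hom \<C> A A'\<^esub>" "p \<circ>\<^bsub>\<C>\<^esub> i' = \<zero>\<^bsub>Hom \<C> A' A\<^esub>"
    "(i \<circ>\<^bsub>\<C>\<^esub> p) \<oplus>\<^bsub>Hom \<C> P P\<^esub> (i' \<circ>\<^bsub>\<C>\<^esub> p') = Id \<C> P"
  using assms by (auto simp: biproduct_def homs_iff)

lemma (in linear_category) biproduct_swap:
  assumes "biproduct \<C> A A' P i i' p p'"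
  shows "biproduct \<C> A' A P i' i p' p"
proof -
  have P: "P \<in> Obj \<C>" using assms by (simp add: biproduct_def)
  interpret H: abelian_group "Hom \<C> P P" using P by (simp add: homs_group)
  have "i \<circ>\<^bsub>\<C>\<^esub> p \<in> homs \<C> P P" "i' \<circ>\<^bsub>\<C>\<^esub> p' \<in> homs \<C> P P"
    using biproductD[OF assms] by blast+
  then show ?thesis
    using assms by (simp add: biproduct_def homs_iff H.a_comm)
qed

text \<open>A self-dual selection of the properties of the triangles of an extriangulated category: passing to
  the opposite category exchanges the two forms of ET3 and of ET4. Of ET4 it keeps the triangle of the
  composite, the triangle of the cones, and the identity \<open>f\<^sub>*\<delta>'' = e\<^sup>*\<delta>'\<close>.\<close>

locale triangle_category = additive_linear_category R \<C> + bilinear_functor R \<C> \<E>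
  for R :: "('r, 'q) ring_scheme" (structure) and \<C> :: "('r, 'o, 'm) lin_cat"
    and \<E> :: "('r, 'o, 'm, 'e) bifunctor" +
  fixes T :: "'o \<Rightarrow> 'm \<Rightarrow> 'o \<Rightarrow> 'm \<Rightarrow> 'o \<Rightarrow> 'e \<Rightarrow> bool"
  assumes triangle_closed: "T A x B y C \<delta> \<Longrightarrow> x \<in> homs \<C> A B \<and> y \<in> homs \<C> B C \<and> \<delta> \<in> elts \<C> \<E> C A"
    and triangle_exists: "\<delta> \<in> elts \<C> \<E> C A \<Longrightarrow> \<exists>B x y. T A x B y C \<delta>"
    and triangle_split: "biproduct \<C> A C P i i' p p' \<Longrightarrow> T A i P p' C \<zero>\<^bsub>Val \<E> C A\<^esub>"
    and triangle_morphism: "\<lbrakk>T A x B y C \<delta>; T A' x' B' y' C' \<delta>'; a \<in> homs \<C> A A'; c \<in> homs \<C> C C';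
        push \<C> \<E> C a \<delta> = pull \<C> \<E> c A' \<delta>'\<rbrakk>
      \<Longrightarrow> \<exists>b\<in>homs \<C> B B'. b \<circ>\<^bsub>\<C>\<^esub> x = x' \<circ>\<^bsub>\<C>\<^esub> a \<and> y' \<circ>\<^bsub>\<C>\<^esub> b = c \<circ>\<^bsub>\<C>\<^esub> y"
    and triangle_ET3: "\<lbrakk>T A x B y C \<delta>; T A' x' B' y' C' \<delta>'; a \<in> homs \<C> A A'; b \<in> homs \<C> B B';
        b \<circ>\<^bsub>\<C>\<^esub> x = x' \<circ>\<^bsub>\<C>\<^esub> a\<rbrakk>
      \<Longrightarrow> \<exists>c\<in>homs \<C> C C'. c \<circ>\<^bsub>\<C>\<^esub> y = y' \<circ>\<^bsub>\<C>\<^esub> b \<and> push \<C> \<E> C a \<delta> = pull \<C> \<E> c A' \<delta>'"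
    and triangle_ET3_op: "\<lbrakk>T A x B y C \<delta>; T A' x' B' y' C' \<delta>'; b \<in> homs \<C> B B'; c \<in> homs \<C> C C';
        c \<circ>\<^bsub>\<C>\<^esub> y = y' \<circ>\<^bsub>\<C>\<^esub> b\<rbrakk>
      \<Longrightarrow> \<exists>a\<in>homs \<C> A A'. b \<circ>\<^bsub>\<C>\<^esub> x = x' \<circ>\<^bsub>\<C>\<^esub> a \<and> push \<C> \<E> C a \<delta> = pull \<C> \<E> c A' \<delta>'"
    and triangle_ET4: "\<lbrakk>T A f B f' D \<delta>; T B g C g' F \<delta>'\<rbrakk>
      \<Longrightarrow> \<exists>E d e h' \<delta>''. T A (g \<circ>\<^bsub>\<C>\<^esub> f) C h' E \<delta>'' \<and> T D d E e F (push \<C> \<E> F f' \<delta>') \<and>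
          push \<C> \<E> E f \<delta>'' = pull \<C> \<E> e B \<delta>'"
    and triangle_ET4_op: "\<lbrakk>T D f' B f A \<delta>; T F g' C g B \<delta>'\<rbrakk>
      \<Longrightarrow> \<exists>E d e h' \<delta>''. T E h' C (f \<circ>\<^bsub>\<C>\<^esub> g) A \<delta>'' \<and> T F e E d D (pull \<C> \<E> f' F \<delta>') \<and>
          pull \<C> \<E> f E \<delta>'' = push \<C> \<E> B e \<delta>'"
begin

lemma triangle_category_op: "triangle_category R (op_cat \<C>) (op_bif \<E>) (\<lambda>A x B y C. T C y B x A)"
proof (intro triangle_category.intro triangle_category_axioms.intro
    additive_linear_category_op bilinear_functor_op, goal_cases)
  case (1 A x B y C \<delta>)
  then show ?case using triangle_closed[of C y B x A \<delta>] by simp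
next
  case (2 \<delta> C A)
  then show ?case using triangle_exists[of \<delta> A C] by auto
next
  case (3 A C P i i' p p')
  then show ?case using triangle_split[OF biproduct_swap, of A C P p p' i i'] by simp
next
  case (4 A x B y C \<delta> A' x' B' y' C' \<delta>' a c)
  then show ?case using triangle_morphism[of C' y' B' x' A' \<delta>' C y B x A \<delta> c a] by auto
next
  case (5 A x B y C \<delta> A' x' B' y' C' \<delta>' a b)
  then show ?case using triangle_ET3_op[of C' y' B' x' A' \<delta>' C y B x A \<delta> b a] by auto
next
  case (6 A x B y C \<delta> A' x' B' y' C' \<delta>' b c)
  then show ?case using triangle_ET3[of C' y' B' x' A' \<delta>' C y B x A \<delta> c b] by simp metis
next
  case (7 A f B f' D \<delta> g C g' F \<delta>')
  then show ?case using triangle_ET4_op[of D f' B f A \<delta> F g' C g \<delta>'] by auto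
next
  case (8 D f' B f A \<delta> F g' C g \<delta>')
  then show ?case using triangle_ET4[of A f B f' D \<delta> g C g' F \<delta>'] by auto
qed

lemma zero_object_exists:
  obtains Z where "Z \<in> Obj \<C>" "Id \<C> Z = \<zero>\<^bsub>Hom \<C> Z Z\<^esub>"
    "\<And>X f. f \<in> homs \<C> X Z \<Longrightarrow> f = \<zero>\<^bsub>Hom \<C> X Z\<^esub>" "\<And>X f. f \<in> homs \<C> Z X \<Longrightarrow> f = \<zero>\<^bsub>Hom \<C> Z X\<^esub>"
proof -
  obtain Z where Z: "zero_object \<C> Z"
    using has_zero_object by blast
  then have o: "Z \<in> Obj \<C>"
    by (simp add: zero_object_def)
  have 1: "f = \<zero>\<^bsub>Hom \<C> X Z\<^esub>" if "f \<in> homs \<C> X Z" for X f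
    using that zero_homs[of X Z] Z unfolding zero_object_def homs_iff by blast
  have 2: "f = \<zero>\<^bsub>Hom \<C> Z X\<^esub>" if "f \<in> homs \<C> Z X" for X f
    using that zero_homs[of Z X] Z unfolding zero_object_def homs_iff by blast
  show thesis
    using that[OF o 1[OF Id_homs[OF o]] 1 2] .
qed

text \<open>Split triangles on \<open>A \<oplus> 0 = A\<close>. Comparing other triangles with them via ET3 turns statements about
  single morphisms into statements about morphisms of triangles.\<close>

lemma triangle_identity_left:
  assumes "A \<in> Obj \<C>" "Z \<in> Obj \<C>" "Id \<C> Z = \<zero>\<^bsub>Hom \<C> Z Z\<^esub>"
  shows "T A (Id \<C> A) A \<zero>\<^bsub>Hom \<C> A Z\<^esub> Z \<zero>\<^bsub>Val \<E> Z A\<^esub>"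
proof (rule triangle_split)
  interpret H: abelian_group "Hom \<C> A A" using assms by (simp add: homs_group)
  show "biproduct \<C> A Z A (Id \<C> A) \<zero>\<^bsub>Hom \<C> Z A\<^esub> (Id \<C> A) \<zero>\<^bsub>Hom \<C> A Z\<^esub>"
    using assms zero_homs[of A Z] zero_homs[of Z A] Id_homs[of A] Comp_zero_left[of _ A Z A]
      Comp_zero_left[of _ A A Z] Comp_zero_right[of _ A A Z] Comp_zero_left[of _ Z A Z]
    by (simp add: biproduct_def homs_iff Comp_Id_left[OF Id_homs])
qed

lemma triangle_identity_right:
  assumes "A \<in> Obj \<C>" "Z \<in> Obj \<C>" "Id \<C> Z = \<zero>\<^bsub>Hom \<C> Z Z\<^esub>"
  shows "T Z \<zero>\<^bsub>Hom \<C> Z A\<^esub> A (Id \<C> A) A \<zero>\<^bsub>Val \<E> A Z\<^esub>"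
  using triangle_category.triangle_identity_left[OF triangle_category_op, of A Z] assms by simp

lemma triangle_comp_zero:
  assumes T: "T A x B y C \<delta>"
  shows "y \<circ>\<^bsub>\<C>\<^esub> x = \<zero>\<^bsub>Hom \<C> A C\<^esub>"
proof -
  note c = triangle_closed[OF T]
  obtain Z where Z: "Z \<in> Obj \<C>" "Id \<C> Z = \<zero>\<^bsub>Hom \<C> Z Z\<^esub>"
      "\<And>X f. f \<in> homs \<C> Z X \<Longrightarrow> f = \<zero>\<^bsub>Hom \<C> Z X\<^esub>"
    using zero_object_exists by metis
  have A: "A \<in> Obj \<C>" "C \<in> Obj \<C>" using c by (auto simp: homs_iff)
  obtain w where "w \<in> homs \<C> Z C" "w \<circ>\<^bsub>\<C>\<^esub> \<zero>\<^bsub>Hom \<C> A Z\<^esub> = y \<circ>\<^bsub>\<C>\<^esub> x"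
    using triangle_ET3[OF triangle_identity_left[OF A(1) Z(1,2)] T Id_homs[OF A(1)], of x] c by auto
  then show ?thesis
    using A Comp_zero_right by metis
qed

lemma hom_row_middle:
  assumes T: "T A x B y C \<delta>" and g: "g \<in> homs \<C> B Y" "g \<circ>\<^bsub>\<C>\<^esub> x = \<zero>\<^bsub>Hom \<C> A Y\<^esub>"
  obtains h where "h \<in> homs \<C> C Y" "g = h \<circ>\<^bsub>\<C>\<^esub> y"
proof -
  note c = triangle_closed[OF T]
  obtain Z where Z: "Z \<in> Obj \<C>" "Id \<C> Z = \<zero>\<^bsub>Hom \<C> Z Z\<^esub>"
    using zero_object_exists by metis
  have o: "A \<in> Obj \<C>" "Y \<in> Obj \<C>" using c g by (auto simp: homs_iff)
  obtain h where "h \<in> homs \<C> C Y" "h \<circ>\<^bsub>\<C>\<^esub> y = Id \<C> Y \<circ>\<^bsub>\<C>\<^esub> g"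
    using triangle_ET3[OF T triangle_identity_right[OF o(2) Z] zero_homs[OF o(1) Z(1)] g(1)] g
      Comp_zero_left[OF zero_homs[OF o(1) Z(1)] o(2)] by auto
  then show thesis
    using that g Comp_Id_left by metis
qed

lemma push_inflation_zero:
  assumes T: "T A x B y C \<delta>"
  shows "push \<C> \<E> C x \<delta> = \<zero>\<^bsub>Val \<E> C B\<^esub>"
proof -
  note c = triangle_closed[OF T]
  obtain Z where Z: "Z \<in> Obj \<C>" "Id \<C> Z = \<zero>\<^bsub>Hom \<C> Z Z\<^esub>"
    using zero_object_exists by metis
  have o: "B \<in> Obj \<C>" using c by (auto simp: homs_iff)
  obtain w where "w \<in> homs \<C> C Z" "push \<C> \<E> C x \<delta> = pull \<C> \<E> w B \<zero>\<^bsub>Val \<E> Z B\<^esub>"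
    using triangle_ET3[OF T triangle_identity_left[OF o Z], of x "Id \<C> B"] c o by auto
  then show ?thesis
    using pull_zero o by metis
qed

lemma push_zero_imp_extends:
  assumes T: "T A x B y C \<delta>" and a: "a \<in> homs \<C> A Y" "push \<C> \<E> C a \<delta> = \<zero>\<^bsub>Val \<E> C Y\<^esub>"
  obtains b where "b \<in> homs \<C> B Y" "a = b \<circ>\<^bsub>\<C>\<^esub> x"
proof -
  note c = triangle_closed[OF T]
  obtain Z where Z: "Z \<in> Obj \<C>" "Id \<C> Z = \<zero>\<^bsub>Hom \<C> Z Z\<^esub>"
    using zero_object_exists by metis
  have o: "Y \<in> Obj \<C>" "C \<in> Obj \<C>" using c a by (auto simp: homs_iff)
  obtain b where "b \<in> homs \<C> B Y" "b \<circ>\<^bsub>\<C>\<^esub> x = Id \<C> Y \<circ>\<^bsub>\<C>\<^esub> a"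
    using triangle_morphism[OF T triangle_identity_left[OF o(1) Z] a(1) zero_homs[OF o(2) Z(1)]]
      pull_zero[OF zero_homs[OF o(2) Z(1)] o(1)] a by auto
  then show thesis
    using that a Comp_Id_left by metis
qed

lemma pull_deflation_zero:
  assumes "T A x B y C \<delta>"
  shows "pull \<C> \<E> y A \<delta> = \<zero>\<^bsub>Val \<E> B A\<^esub>"
  using triangle_category.push_inflation_zero[OF triangle_category_op, of A x B y C \<delta>] assms by simp

lemma pull_zero_imp_lifts:
  assumes "T A x B y C \<delta>" "c \<in> homs \<C> X C" "pull \<C> \<E> c A \<delta> = \<zero>\<^bsub>Val \<E> X A\<^esub>"
  obtains b where "b \<in> homs \<C> X B" "c = y \<circ>\<^bsub>\<C>\<^esub> b"
  using triangle_category.push_zero_imp_extends[OF triangle_category_op, of A x B y C \<delta> c X] assms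
  by auto

text \<open>If \<open>y\<^sup>*\<rho> = 0\<close>, then \<open>y\<close> lifts to the middle term of the triangle of \<open>\<rho>\<close>, and the dual of ET3 completes this lift to a
  morphism of triangles over the identity of \<open>C\<close>, whose component on \<open>A\<close> pushes \<open>\<delta>\<close> to \<open>\<rho>\<close>.\<close>

lemma pull_deflation_zero_imp_push:
  assumes T: "T A x B y C \<delta>" and r: "\<rho> \<in> elts \<C> \<E> C Y" "pull \<C> \<E> y Y \<rho> = \<zero>\<^bsub>Val \<E> B Y\<^esub>"
  obtains a where "a \<in> homs \<C> A Y" "\<rho> = push \<C> \<E> C a \<delta>"
proof -
  note c = triangle_closed[OF T]
  obtain D u v where D: "T Y u D v C \<rho>"
    using triangle_exists r by blast
  obtain b where b: "b \<in> homs \<C> B D" "y = v \<circ>\<^bsub>\<C>\<^esub> b"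
    using pull_zero_imp_lifts[OF D _ r(2)] c by blast
  have o: "C \<in> Obj \<C>" using c by (auto simp: homs_iff)
  obtain a where "a \<in> homs \<C> A Y" "push \<C> \<E> C a \<delta> = pull \<C> \<E> (Id \<C> C) Y \<rho>"
    using triangle_ET3_op[OF T D b(1) Id_homs[OF o]] b(2) c Comp_Id_left by metis
  then show thesis
    using that r pull_Id by metis
qed

text \<open>ET4 applied to the deflations onto \<open>B\<close> and \<open>C\<close> gives an inflation \<open>e\<close> with extension \<open>x\<^sup>*\<rho>\<close> and an
  extension \<open>\<delta>''\<close> with \<open>y\<^sup>*\<delta>'' = e\<^sub>*\<rho>\<close>. If \<open>x\<^sup>*\<rho> = 0\<close>, then \<open>e\<close> has a retraction, which recovers \<open>\<rho>\<close> from \<open>e\<^sub>*\<rho>\<close>.\<close>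

lemma pull_inflation_zero_imp_pull:
  assumes T: "T A x B y C \<delta>" and r: "\<rho> \<in> elts \<C> \<E> B Y" "pull \<C> \<E> x Y \<rho> = \<zero>\<^bsub>Val \<E> A Y\<^esub>"
  obtains \<rho>' where "\<rho>' \<in> elts \<C> \<E> C Y" "\<rho> = pull \<C> \<E> y Y \<rho>'"
proof -
  note c = triangle_closed[OF T]
  obtain K u v where K: "T Y u K v B \<rho>"
    using triangle_exists r by blast
  obtain E d e h' \<delta>'' where E: "T E h' K (y \<circ>\<^bsub>\<C>\<^esub> v) C \<delta>''" "T Y e E d A (pull \<C> \<E> x Y \<rho>)"
      "pull \<C> \<E> y E \<delta>'' = push \<C> \<E> B e \<rho>"
    using triangle_ET4_op[OF T K] by blast
  note c' = triangle_closed[OF E(1)] triangle_closed[OF E(2)]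
  have o: "Y \<in> Obj \<C>" "A \<in> Obj \<C>" using c' by (auto simp: homs_iff)
  have "push \<C> \<E> A (Id \<C> Y) (pull \<C> \<E> x Y \<rho>) = \<zero>\<^bsub>Val \<E> A Y\<^esub>"
    using r(2) push_zero Id_homs o by metis
  then obtain s where s: "s \<in> homs \<C> E Y" "Id \<C> Y = s \<circ>\<^bsub>\<C>\<^esub> e"
    using push_zero_imp_extends[OF E(2) Id_homs[OF o(1)]] by blast
  have "\<rho> = push \<C> \<E> B (s \<circ>\<^bsub>\<C>\<^esub> e) \<rho>"
    using s push_Id r by metis
  also have "\<dots> = push \<C> \<E> B s (pull \<C> \<E> y E \<delta>'')"
    using E(3) push_Comp s r c' by metis
  also have "\<dots> = pull \<C> \<E> y Y (push \<C> \<E> C s \<delta>'')"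
    using push_pull s c c' by metis
  finally show thesis
    using that push_elts s c' by metis
qed

end

section \<open>Cup products with a half exact functor\<close>

lemma (in Mod_object) Trans_closed: "f \<in> homs \<C> X Y \<Longrightarrow> v \<in> carrier (Fib F Y) \<Longrightarrow> Trans F f v \<in> carrier (Fib F X)"
  using Trans_linear[of X Y f] by (auto simp: homs_iff linear_map_def)

lemma (in Mod_object) Trans_Comp': "f \<in> homs \<C> X Y \<Longrightarrow> g \<in> homs \<C> Y Z \<Longrightarrow> v \<in> carrier (Fib F Z)
    \<Longrightarrow> Trans F (g \<circ>\<^bsub>\<C>\<^esub> f) v = Trans F f (Trans F g v)"
  by (rule Trans_Comp[of X Y Z]) (auto simp: homs_iff)

lemma (in Mod_object) Trans_zero_arr:
  assumes "v \<in> carrier (Fib F Y)" "X \<in> Obj \<C>" "Y \<in> Obj \<C>"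
  shows "Trans F \<zero>\<^bsub>Hom \<C> X Y\<^esub> v = \<zero>\<^bsub>Fib F X\<^esub>"
proof -
  interpret V: module R "Fib F X" using assms by (simp add: Fib_module)
  interpret H: abelian_group "Hom \<C> X Y" using assms by (simp add: homs_group)
  have z: "\<zero>\<^bsub>Hom \<C> X Y\<^esub> \<in> homs \<C> X Y" using assms by auto
  show ?thesis
    using Trans_add[of X Y "\<zero>\<^bsub>Hom \<C> X Y\<^esub>" "\<zero>\<^bsub>Hom \<C> X Y\<^esub>" v] Trans_closed[OF z assms(1)] assms
    by (auto intro: V.double_eq_zero)
qed

text \<open>The other inclusion is automatic, since the composite \<open>A \<rightarrow> B \<rightarrow> C\<close> is zero.\<close>

definition half_exact ::
  "('o \<Rightarrow> 'm \<Rightarrow> 'o \<Rightarrow> 'm \<Rightarrow> 'o \<Rightarrow> 'e \<Rightarrow> bool) \<Rightarrow> ('r, 'o, 'm, 'v) mod_functor \<Rightarrow> bool"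
  where "half_exact T F \<longleftrightarrow> (\<forall>A x B y C \<delta>. T A x B y C \<delta> \<longrightarrow>
    (\<forall>v\<in>carrier (Fib F B). Trans F x v = \<zero>\<^bsub>Fib F A\<^esub> \<longrightarrow> (\<exists>w\<in>carrier (Fib F C). v = Trans F y w)))"

text \<open>The automorphism of \<open>M \<oplus> P\<close> given by \<open>\<phi>\<close> makes the graph \<open>(1, \<phi>) : M \<rightarrow> M \<oplus> P\<close> the inclusion of a
  summand, hence an inflation.\<close>

lemma (in triangle_category) biproduct_shear:
  assumes bp: "biproduct \<C> M P S i i' p p'" and \<phi>: "\<phi> \<in> homs \<C> M P"
  shows "biproduct \<C> M P S (i \<oplus>\<^bsub>Hom \<C> M S\<^esub> (i' \<circ>\<^bsub>\<C>\<^esub> \<phi>)) i' p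
    (p' \<oplus>\<^bsub>Hom \<C> S P\<^esub> ((\<ominus>\<^bsub>Hom \<C> M P\<^esub> \<phi>) \<circ>\<^bsub>\<C>\<^esub> p))"
proof -
  note b = biproductD[OF bp]
  let ?n = "\<ominus>\<^bsub>Hom \<C> M P\<^esub> \<phi>"
  let ?u = "i \<oplus>\<^bsub>Hom \<C> M S\<^esub> (i' \<circ>\<^bsub>\<C>\<^esub> \<phi>)"
  let ?q = "p' \<oplus>\<^bsub>Hom \<C> S P\<^esub> (?n \<circ>\<^bsub>\<C>\<^esub> p)"
  have o: "M \<in> Obj \<C>" "P \<in> Obj \<C>" "S \<in> Obj \<C>" using b by (auto simp: homs_iff)
  interpret MP: abelian_group "Hom \<C> M P" using o by (simp add: homs_group)
  interpret PP: abelian_group "Hom \<C> P P" using o by (simp add: homs_group)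
  interpret MM: abelian_group "Hom \<C> M M" using o by (simp add: homs_group)
  interpret SS: abelian_group "Hom \<C> S S" using o by (simp add: homs_group)
  interpret SP: abelian_group "Hom \<C> S P" using o by (simp add: homs_group)
  have n: "?n \<in> homs \<C> M P" using \<phi> by (auto simp: homs_iff)
  have h: "i' \<circ>\<^bsub>\<C>\<^esub> \<phi> \<in> homs \<C> M S" "?n \<circ>\<^bsub>\<C>\<^esub> p \<in> homs \<C> S P" "?u \<in> homs \<C> M S" "?q \<in> homs \<C> S P"
    "i \<circ>\<^bsub>\<C>\<^esub> p \<in> homs \<C> S S" "i' \<circ>\<^bsub>\<C>\<^esub> p' \<in> homs \<C> S S" "\<phi> \<circ>\<^bsub>\<C>\<^esub> p \<in> homs \<C> S P"
    "i' \<circ>\<^bsub>\<C>\<^esub> (\<phi> \<circ>\<^bsub>\<C>\<^esub> p) \<in> homs \<C> S S" "i' \<circ>\<^bsub>\<C>\<^esub> (?n \<circ>\<^bsub>\<C>\<^esub> p) \<in> homs \<C> S S"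
    using b \<phi> n by blast+
  have 1: "p \<circ>\<^bsub>\<C>\<^esub> ?u = Id \<C> M"
    using Comp_distrib_right[OF b(1) h(1) b(3)] b(5,8) Comp_assoc'[OF \<phi> b(2,3), symmetric] Comp_zero_left[OF \<phi> o(1)]
      Id_homs[OF o(1)] by (simp add: homs_iff)
  have 2: "?q \<circ>\<^bsub>\<C>\<^esub> i' = Id \<C> P"
    using Comp_distrib_left[OF b(2) b(4) h(2)] b(6,8) Comp_assoc'[OF b(2) b(3) n] Comp_zero_right[OF n o(2)]
      Id_homs[OF o(2)] by (simp add: homs_iff)
  have 3: "p' \<circ>\<^bsub>\<C>\<^esub> ?u = \<phi>"
    using Comp_distrib_right[OF b(1) h(1) b(4)] b(6,7) Comp_assoc'[OF \<phi> b(2,4), symmetric] Comp_Id_left[OF \<phi>]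
      \<phi> by (simp add: homs_iff)
  have 4: "?q \<circ>\<^bsub>\<C>\<^esub> ?u = \<zero>\<^bsub>Hom \<C> M P\<^esub>"
    using Comp_distrib_left[OF h(3) b(4) h(2)] Comp_assoc'[OF h(3) b(3) n] 1 3 Comp_Id_right[OF n]
      \<phi> by (simp add: homs_iff MP.r_neg)
  have "(\<phi> \<circ>\<^bsub>\<C>\<^esub> p) \<oplus>\<^bsub>Hom \<C> S P\<^esub> (?n \<circ>\<^bsub>\<C>\<^esub> p) = \<zero>\<^bsub>Hom \<C> S P\<^esub>"
    using Comp_distrib_left[OF b(3) \<phi> n] Comp_zero_left[OF b(3) o(2)] \<phi> by (simp add: homs_iff MP.r_neg)
  then have z: "(i' \<circ>\<^bsub>\<C>\<^esub> (\<phi> \<circ>\<^bsub>\<C>\<^esub> p)) \<oplus>\<^bsub>Hom \<C> S S\<^esub> (i' \<circ>\<^bsub>\<C>\<^esub> (?n \<circ>\<^bsub>\<C>\<^esub> p)) = \<zero>\<^bsub>Hom \<C> S S\<^esub>"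
    using Comp_distrib_right[OF h(7) h(2) b(2)] Comp_zero_right[OF b(2) o(3)] by simp
  have "?u \<circ>\<^bsub>\<C>\<^esub> p = (i \<circ>\<^bsub>\<C>\<^esub> p) \<oplus>\<^bsub>Hom \<C> S S\<^esub> (i' \<circ>\<^bsub>\<C>\<^esub> (\<phi> \<circ>\<^bsub>\<C>\<^esub> p))"
    "i' \<circ>\<^bsub>\<C>\<^esub> ?q = (i' \<circ>\<^bsub>\<C>\<^esub> p') \<oplus>\<^bsub>Hom \<C> S S\<^esub> (i' \<circ>\<^bsub>\<C>\<^esub> (?n \<circ>\<^bsub>\<C>\<^esub> p))"
    using Comp_distrib_left[OF b(3) b(1) h(1)] Comp_assoc'[OF b(3) \<phi> b(2)]
      Comp_distrib_right[OF b(4) h(2) b(2)] by simp_all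
  then have 5: "(?u \<circ>\<^bsub>\<C>\<^esub> p) \<oplus>\<^bsub>Hom \<C> S S\<^esub> (i' \<circ>\<^bsub>\<C>\<^esub> ?q) = Id \<C> S"
    using b(9) z h(5,6,8,9) Id_homs[OF o(3)] SS.a_assoc SS.a_comm SS.a_lcomm SS.r_zero
    by (simp add: homs_iff)
  show ?thesis
    using b o h 1 2 4 5 unfolding biproduct_def by (simp add: homs_iff)
qed

text \<open>With an inflation \<open>m : M \<rightarrow> N\<close> of extension \<open>\<sigma>\<close>, the morphism \<open>(m, \<phi>) : M \<rightarrow> N \<oplus> P\<close> is an inflation; let
  \<open>Q\<close> be its cone. The element \<open>(0, \<tau>)\<close> of \<open>F(N \<oplus> P)\<close> restricts to \<open>\<phi>\<^sup>*\<tau> = 0\<close> on \<open>M\<close>, so it comes from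
  \<open>F(Q)\<close>. As the composite \<open>M \<rightarrow> P \<rightarrow> Q\<close> is minus a composite through \<open>m\<close>, it kills \<open>\<sigma>\<close>. To stay with
  ET4, the proof takes for \<open>N \<oplus> P\<close> the middle term \<open>L\<close> of a triangle of \<open>i\<^sub>*\<sigma>\<close>, with \<open>i : M \<rightarrow> M \<oplus> P\<close>, and
  composes its inflation \<open>g\<close> with the graph of \<open>\<phi>\<close>.\<close>

lemma (in triangle_category) half_exact_annihilate:
  assumes F: "Mod_object R \<C> F" and ex: "half_exact T F"
    and \<phi>: "\<phi> \<in> homs \<C> M P" and \<tau>: "\<tau> \<in> carrier (Fib F P)" "Trans F \<phi> \<tau> = \<zero>\<^bsub>Fib F M\<^esub>"
    and \<sigma>: "\<sigma> \<in> elts \<C> \<E> X M"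
  obtains Q h \<tau>' where "h \<in> homs \<C> P Q" "\<tau>' \<in> carrier (Fib F Q)" "Trans F h \<tau>' = \<tau>"
    "push \<C> \<E> X h (push \<C> \<E> X \<phi> \<sigma>) = \<zero>\<^bsub>Val \<E> X Q\<^esub>"
proof -
  interpret F: Mod_object R \<C> F by (rule F)
  have o: "M \<in> Obj \<C>" "P \<in> Obj \<C>" "X \<in> Obj \<C>" using \<phi> \<sigma> by (auto simp: homs_iff elts_iff)
  obtain S i i' p p' where bp: "biproduct \<C> M P S i i' p p'"
    using has_biproducts o by blast
  note b = biproductD[OF bp]
  define u where "u = i \<oplus>\<^bsub>Hom \<C> M S\<^esub> (i' \<circ>\<^bsub>\<C>\<^esub> \<phi>)"
  have u: "u \<in> homs \<C> M S" unfolding u_def using b \<phi> by blast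
  obtain q where T1: "T M u S q P \<zero>\<^bsub>Val \<E> P M\<^esub>"
    using triangle_split[OF biproduct_shear[OF bp \<phi>]] u_def by blast
  have th: "push \<C> \<E> X i \<sigma> \<in> elts \<C> \<E> X S" using b \<sigma> by blast
  obtain L g g' where T2: "T S g L g' X (push \<C> \<E> X i \<sigma>)"
    using triangle_exists[OF th] by blast
  have g: "g \<in> homs \<C> S L" using triangle_closed[OF T2] by blast
  obtain E h' \<delta>'' where T3: "T M (g \<circ>\<^bsub>\<C>\<^esub> u) L h' E \<delta>''"
    using triangle_ET4[OF T1 T2] by blast
  have h': "h' \<in> homs \<C> L E" using triangle_closed[OF T3] by blast
  have "push \<C> \<E> X p' (push \<C> \<E> X i \<sigma>) = \<zero>\<^bsub>Val \<E> X P\<^esub>"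
    using push_Comp[OF b(1,4) \<sigma>] b(7) push_zero_arr[OF o(2) \<sigma>] by simp
  \<comment> \<open>The morphism \<open>r\<close> plays the part of the projection of \<open>N \<oplus> P\<close> to \<open>P\<close>.\<close>
  then obtain r where r: "r \<in> homs \<C> L P" "p' = r \<circ>\<^bsub>\<C>\<^esub> g"
    using push_zero_imp_extends[OF T2 b(4)] by blast
  have p'u: "p' \<circ>\<^bsub>\<C>\<^esub> u = \<phi>"
  proof -
    interpret MP: abelian_group "Hom \<C> M P" using o by (simp add: homs_group)
    show ?thesis unfolding u_def
      using Comp_distrib_right[OF b(1) Comp_homs[OF \<phi> b(2)] b(4)] b Comp_assoc'[OF \<phi> b(2,4)]
        Comp_Id_left[OF \<phi>] \<phi> by (simp add: homs_iff)
  qed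
  have rt: "Trans F r \<tau> \<in> carrier (Fib F L)" using F.Trans_closed r \<tau> by blast
  have "Trans F (g \<circ>\<^bsub>\<C>\<^esub> u) (Trans F r \<tau>) = Trans F \<phi> \<tau>"
    using F.Trans_Comp'[OF u g rt] F.Trans_Comp'[OF g r(1) \<tau>(1)] r(2) F.Trans_Comp'[OF u b(4) \<tau>(1)] p'u
    by simp
  then obtain \<tau>' where \<tau>': "\<tau>' \<in> carrier (Fib F E)" "Trans F r \<tau> = Trans F h' \<tau>'"
    using ex T3 \<tau>(2) rt unfolding half_exact_def by metis
  define h where "h = (h' \<circ>\<^bsub>\<C>\<^esub> g) \<circ>\<^bsub>\<C>\<^esub> i'"
  have hg: "h' \<circ>\<^bsub>\<C>\<^esub> g \<in> homs \<C> S E" using h' g by blast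
  have h: "h \<in> homs \<C> P E" unfolding h_def using hg b by blast
  have "Trans F h \<tau>' = Trans F i' (Trans F g (Trans F r \<tau>))"
    using F.Trans_Comp'[OF b(2) hg \<tau>'(1)] F.Trans_Comp'[OF g h' \<tau>'(1)] \<tau>'(2) by (simp add: h_def)
  also have "\<dots> = \<tau>"
    using F.Trans_Comp'[OF g r(1) \<tau>(1)] r(2) F.Trans_Comp'[OF b(2,4) \<tau>(1)] b(6) F.Trans_Id[OF o(2) \<tau>(1)]
    by simp
  finally have 1: "Trans F h \<tau>' = \<tau>" .
  have oE: "E \<in> Obj \<C>" using h by (simp add: homs_iff)
  have "push \<C> \<E> X (h' \<circ>\<^bsub>\<C>\<^esub> g) (push \<C> \<E> X i \<sigma>) = \<zero>\<^bsub>Val \<E> X E\<^esub>"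
    using push_Comp[OF g h' th] push_inflation_zero[OF T2] push_zero[OF h' o(3)] by simp
  moreover have "(h' \<circ>\<^bsub>\<C>\<^esub> g) \<circ>\<^bsub>\<C>\<^esub> u = \<zero>\<^bsub>Hom \<C> M E\<^esub>"
    using triangle_comp_zero[OF T3] Comp_assoc'[OF u g h'] by simp
  then have "push \<C> \<E> X (h' \<circ>\<^bsub>\<C>\<^esub> g) (push \<C> \<E> X u \<sigma>) = \<zero>\<^bsub>Val \<E> X E\<^esub>"
    using push_Comp[OF u hg \<sigma>] push_zero_arr[OF oE \<sigma>] by simp
  moreover have "push \<C> \<E> X u \<sigma> = push \<C> \<E> X i \<sigma> \<oplus>\<^bsub>Val \<E> X S\<^esub> push \<C> \<E> X i' (push \<C> \<E> X \<phi> \<sigma>)"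
    unfolding u_def using push_add_arr[OF b(1) Comp_homs[OF \<phi> b(2)] \<sigma>] push_Comp[OF \<phi> b(2) \<sigma>] by simp
  moreover have ps: "push \<C> \<E> X \<phi> \<sigma> \<in> elts \<C> \<E> X P" using \<phi> \<sigma> by blast
  then have "push \<C> \<E> X (h' \<circ>\<^bsub>\<C>\<^esub> g) (push \<C> \<E> X i' (push \<C> \<E> X \<phi> \<sigma>)) = push \<C> \<E> X h (push \<C> \<E> X \<phi> \<sigma>)"
    using push_Comp[OF b(2) hg] h_def by simp
  ultimately have "push \<C> \<E> X h (push \<C> \<E> X \<phi> \<sigma>) = \<zero>\<^bsub>Val \<E> X E\<^esub>"
    using push_add[OF hg th push_elts[OF b(2) ps]] add_zero_elts push_elts[OF h ps] by metis
  then show thesis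
    using that h \<tau>' 1 by blast
qed

text \<open>The features of a coend \<open>F' = \<integral>\<^sup>M F(M) \<otimes> \<E>(-,M)\<close> on which exactness rests: every element is a single
  product, and products vanish only for the evident reason. Stating them for an arbitrary product \<open>cp\<close> makes
  the exactness argument available both for the coends themselves and, in the opposite category, for products
  whose first factor is of degree one.\<close>

locale cup_presentation = triangle_category R \<C> \<E> T + F: Mod_object R \<C> F + F': Mod_object R \<C> F'
  for R :: "('r, 'q) ring_scheme" (structure) and \<C> :: "('r, 'o, 'm) lin_cat"
    and \<E> :: "('r, 'o, 'm, 'e) bifunctor" and T
    and F :: "('r, 'o, 'm, 'v) mod_functor" and F' :: "('r, 'o, 'm, 'w) mod_functor" +
  fixes cp :: "'o \<Rightarrow> 'o \<Rightarrow> 'v \<Rightarrow> 'e \<Rightarrow> 'w"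
  assumes cp_closed: "\<rho> \<in> carrier (Fib F M) \<Longrightarrow> \<sigma> \<in> elts \<C> \<E> X M \<Longrightarrow> cp X M \<rho> \<sigma> \<in> carrier (Fib F' X)"
    and cp_dinatural: "f \<in> homs \<C> M N \<Longrightarrow> \<rho> \<in> carrier (Fib F N) \<Longrightarrow> \<sigma> \<in> elts \<C> \<E> X M
      \<Longrightarrow> cp X M (Trans F f \<rho>) \<sigma> = cp X N \<rho> (push \<C> \<E> X f \<sigma>)"
    and cp_natural: "c \<in> homs \<C> X' X \<Longrightarrow> \<rho> \<in> carrier (Fib F M) \<Longrightarrow> \<sigma> \<in> elts \<C> \<E> X M
      \<Longrightarrow> Trans F' c (cp X M \<rho> \<sigma>) = cp X' M \<rho> (pull \<C> \<E> c M \<sigma>)"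
    and cp_zero: "X \<in> Obj \<C> \<Longrightarrow> M \<in> Obj \<C> \<Longrightarrow> \<rho> \<in> carrier (Fib F M)
      \<Longrightarrow> cp X M \<rho> \<zero>\<^bsub>Val \<E> X M\<^esub> = \<zero>\<^bsub>Fib F' X\<^esub>"
    and cp_surj: "X \<in> Obj \<C> \<Longrightarrow> \<omega> \<in> carrier (Fib F' X)
      \<Longrightarrow> \<exists>M \<rho> \<sigma>. \<rho> \<in> carrier (Fib F M) \<and> \<sigma> \<in> elts \<C> \<E> X M \<and> \<omega> = cp X M \<rho> \<sigma>"
    and cp_null: "\<rho> \<in> carrier (Fib F M) \<Longrightarrow> \<sigma> \<in> elts \<C> \<E> X M \<Longrightarrow> cp X M \<rho> \<sigma> = \<zero>\<^bsub>Fib F' X\<^esub>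
      \<Longrightarrow> \<exists>N f \<tau>. f \<in> homs \<C> M N \<and> \<tau> \<in> carrier (Fib F N) \<and> \<rho> = Trans F f \<tau> \<and>
        push \<C> \<E> X f \<sigma> = \<zero>\<^bsub>Val \<E> X N\<^esub>"
begin

text \<open>If \<open>\<rho> \<union> \<delta> = 0\<close> with witness \<open>f\<close>, \<open>\<rho> = f\<^sup>*\<tau>\<close>, then \<open>f\<close> extends over \<open>B\<close> because it kills \<open>\<delta>\<close>. The next two lemmas
  start from \<open>\<omega> = \<rho> \<union> \<sigma>\<close> whose restriction vanishes with witness \<open>f\<close>, \<open>\<rho> = f\<^sup>*\<tau>\<close>. Rewriting \<open>\<omega>\<close> as \<open>\<tau> \<union> f\<^sub>*\<sigma>\<close>
  leaves a statement about the single extension \<open>f\<^sub>*\<sigma>\<close>, which the rows of \<open>\<E>(-,N)\<close> answer.\<close>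

lemma exact_at_first:
  assumes T: "T A x B y C \<delta>" and \<rho>: "\<rho> \<in> carrier (Fib F A)"
  shows "cp C A \<rho> \<delta> = \<zero>\<^bsub>Fib F' C\<^esub> \<longleftrightarrow> (\<exists>\<tau>\<in>carrier (Fib F B). \<rho> = Trans F x \<tau>)"
proof
  note c = triangle_closed[OF T]
  have o: "C \<in> Obj \<C>" "B \<in> Obj \<C>" using c by (auto simp: homs_iff)
  {
    assume "cp C A \<rho> \<delta> = \<zero>\<^bsub>Fib F' C\<^esub>"
    then obtain N f \<tau> where f: "f \<in> homs \<C> A N" "\<tau> \<in> carrier (Fib F N)" "\<rho> = Trans F f \<tau>"
        "push \<C> \<E> C f \<delta> = \<zero>\<^bsub>Val \<E> C N\<^esub>"
      using cp_null \<rho> c by blast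
    obtain b where "b \<in> homs \<C> B N" "f = b \<circ>\<^bsub>\<C>\<^esub> x"
      using push_zero_imp_extends[OF T f(1,4)] by blast
    then show "\<exists>\<tau>\<in>carrier (Fib F B). \<rho> = Trans F x \<tau>"
      using f F.Trans_Comp' F.Trans_closed c by metis
  next
    assume "\<exists>\<tau>\<in>carrier (Fib F B). \<rho> = Trans F x \<tau>"
    then show "cp C A \<rho> \<delta> = \<zero>\<^bsub>Fib F' C\<^esub>"
      using cp_dinatural c push_inflation_zero[OF T] cp_zero o by metis
  }
qed

lemma exact_at_second:
  assumes T: "T A x B y C \<delta>" and \<omega>: "\<omega> \<in> carrier (Fib F' C)"
  shows "Trans F' y \<omega> = \<zero>\<^bsub>Fib F' B\<^esub> \<longleftrightarrow> (\<exists>\<rho>\<in>carrier (Fib F A). \<omega> = cp C A \<rho> \<delta>)"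
proof
  note c = triangle_closed[OF T]
  have o: "C \<in> Obj \<C>" "B \<in> Obj \<C>" "A \<in> Obj \<C>" using c by (auto simp: homs_iff)
  {
    assume z: "Trans F' y \<omega> = \<zero>\<^bsub>Fib F' B\<^esub>"
    obtain M \<rho> \<sigma> where \<rho>: "\<rho> \<in> carrier (Fib F M)" "\<sigma> \<in> elts \<C> \<E> C M" "\<omega> = cp C M \<rho> \<sigma>"
      using cp_surj \<omega> o by blast
    have "cp B M \<rho> (pull \<C> \<E> y M \<sigma>) = \<zero>\<^bsub>Fib F' B\<^esub>"
      using z \<rho> cp_natural c by metis
    then obtain N f \<tau> where f: "f \<in> homs \<C> M N" "\<tau> \<in> carrier (Fib F N)" "\<rho> = Trans F f \<tau>"
        "push \<C> \<E> B f (pull \<C> \<E> y M \<sigma>) = \<zero>\<^bsub>Val \<E> B N\<^esub>"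
      using cp_null \<rho> c pull_elts by meson
    have s: "push \<C> \<E> C f \<sigma> \<in> elts \<C> \<E> C N" using f \<rho> by blast
    have "pull \<C> \<E> y N (push \<C> \<E> C f \<sigma>) = \<zero>\<^bsub>Val \<E> B N\<^esub>"
      using push_pull f \<rho> c by metis
    then obtain a where "a \<in> homs \<C> A N" "push \<C> \<E> C f \<sigma> = push \<C> \<E> C a \<delta>"
      using pull_deflation_zero_imp_push[OF T s] by blast
    then show "\<exists>\<rho>\<in>carrier (Fib F A). \<omega> = cp C A \<rho> \<delta>"
      using f \<rho> cp_dinatural c F.Trans_closed by metis
  next
    assume "\<exists>\<rho>\<in>carrier (Fib F A). \<omega> = cp C A \<rho> \<delta>"
    then show "Trans F' y \<omega> = \<zero>\<^bsub>Fib F' B\<^esub>"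
      using cp_natural c pull_deflation_zero[OF T] cp_zero o by metis
  }
qed

lemma exact_at_third:
  assumes T: "T A x B y C \<delta>" and \<omega>: "\<omega> \<in> carrier (Fib F' B)"
  shows "Trans F' x \<omega> = \<zero>\<^bsub>Fib F' A\<^esub> \<longleftrightarrow> (\<exists>\<omega>'\<in>carrier (Fib F' C). \<omega> = Trans F' y \<omega>')"
proof
  note c = triangle_closed[OF T]
  have o: "C \<in> Obj \<C>" "B \<in> Obj \<C>" "A \<in> Obj \<C>" using c by (auto simp: homs_iff)
  {
    assume z: "Trans F' x \<omega> = \<zero>\<^bsub>Fib F' A\<^esub>"
    obtain M \<rho> \<sigma> where \<rho>: "\<rho> \<in> carrier (Fib F M)" "\<sigma> \<in> elts \<C> \<E> B M" "\<omega> = cp B M \<rho> \<sigma>"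
      using cp_surj \<omega> o by blast
    have "cp A M \<rho> (pull \<C> \<E> x M \<sigma>) = \<zero>\<^bsub>Fib F' A\<^esub>"
      using z \<rho> cp_natural c by metis
    then obtain N f \<tau> where f: "f \<in> homs \<C> M N" "\<tau> \<in> carrier (Fib F N)" "\<rho> = Trans F f \<tau>"
        "push \<C> \<E> A f (pull \<C> \<E> x M \<sigma>) = \<zero>\<^bsub>Val \<E> A N\<^esub>"
      using cp_null \<rho> c pull_elts by meson
    have s: "push \<C> \<E> B f \<sigma> \<in> elts \<C> \<E> B N" using f \<rho> by blast
    have "pull \<C> \<E> x N (push \<C> \<E> B f \<sigma>) = \<zero>\<^bsub>Val \<E> A N\<^esub>"
      using push_pull f \<rho> c by metis
    then obtain \<sigma>' where s': "\<sigma>' \<in> elts \<C> \<E> C N" "push \<C> \<E> B f \<sigma> = pull \<C> \<E> y N \<sigma>'"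
      using pull_inflation_zero_imp_pull[OF T s] by blast
    then have "\<omega> = Trans F' y (cp C N \<tau> \<sigma>')"
      using \<rho> f cp_dinatural cp_natural c by metis
    then show "\<exists>\<omega>'\<in>carrier (Fib F' C). \<omega> = Trans F' y \<omega>'"
      using cp_closed f s' by blast
  next
    assume "\<exists>\<omega>'\<in>carrier (Fib F' C). \<omega> = Trans F' y \<omega>'"
    then show "Trans F' x \<omega> = \<zero>\<^bsub>Fib F' A\<^esub>"
      using F'.Trans_Comp' c triangle_comp_zero[OF T] F'.Trans_zero_arr o by metis
  }
qed

lemma half_exact_target: "half_exact T F'"
  unfolding half_exact_def using exact_at_third by blast

end

section \<open>Coends as bilinear functors\<close>

text \<open>For a bifunctor \<open>F\<close> these are the functors \<open>F(-,Y)\<close> on \<open>\<C>\<close> and \<open>F(X,-)\<close> on the opposite category.\<close>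

definition functor_to :: "('r, 'o, 'm) lin_cat \<Rightarrow> ('r, 'o, 'm, 'e) bifunctor \<Rightarrow> 'o \<Rightarrow> ('r, 'o, 'm, 'e) mod_functor"
  where "functor_to \<C> F Y = \<lparr>Fib = (\<lambda>X. Val F X Y), Trans = (\<lambda>c. pull \<C> F c Y)\<rparr>"

abbreviation functor_from :: "('r, 'o, 'm) lin_cat \<Rightarrow> ('r, 'o, 'm, 'e) bifunctor \<Rightarrow> 'o \<Rightarrow> ('r, 'o, 'm, 'e) mod_functor"
  where "functor_from \<C> F X \<equiv> functor_to (op_cat \<C>) (op_bif F) X"

lemma functor_to_simps [simp]:
  "Fib (functor_to \<C> F Y) X = Val F X Y" "Trans (functor_to \<C> F Y) c = pull \<C> F c Y"
  by (simp_all add: functor_to_def)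

lemma (in bilinear_functor) functor_to_Mod:
  assumes Y: "Y \<in> Obj \<C>"
  shows "Mod_object R \<C> (functor_to \<C> \<E> Y)"
proof (intro Mod_object.intro Mod_object_axioms.intro linear_category_axioms, goal_cases)
  case (4 X X' Z f g v)
  then show ?case
    using pull_Comp[of g X' Z f X v Y] Y by (simp add: homs_iff elts_iff)
next
  case (6 X Z r f v)
  then show ?case
    using pull_smult_arr[of f X Z r v Y] Y by (simp add: homs_iff elts_iff)
qed (use Y in \<open>auto simp: Val_module pull_Id elts_iff homs_iff intro: pull_linear pull_add_arr\<close>)

lemma (in bilinear_functor) push_Mod_morphism:
  assumes "a \<in> homs \<C> Y Y'"
  shows "Mod_morphism R \<C> (functor_to \<C> \<E> Y) (functor_to \<C> \<E> Y') (\<lambda>X. push \<C> \<E> X a)"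
proof -
  have "Y \<in> Obj \<C>" "Y' \<in> Obj \<C>" using assms by (auto simp: homs_iff)
  then show ?thesis
    using assms push_linear[OF assms] push_pull[OF _ assms] functor_to_Mod
    unfolding Mod_morphism_def by (auto simp: homs_iff elts_iff)
qed

lemma Mod_morphismD:
  assumes "Mod_morphism R \<C> (functor_to \<C> F Y) (functor_to \<C> F' Y') \<phi>" "Y \<in> Obj \<C>" "Y' \<in> Obj \<C>"
  shows "\<rho> \<in> elts \<C> F M Y \<Longrightarrow> \<phi> M \<rho> \<in> elts \<C> F' M Y'"
    and "\<rho> \<in> elts \<C> F M Y \<Longrightarrow> \<rho>' \<in> elts \<C> F M Y
      \<Longrightarrow> \<phi> M (\<rho> \<oplus>\<^bsub>Val F M Y\<^esub> \<rho>') = \<phi> M \<rho> \<oplus>\<^bsub>Val F' M Y'\<^esub> \<phi> M \<rho>'"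
    and "r \<in> carrier R \<Longrightarrow> \<rho> \<in> elts \<C> F M Y
      \<Longrightarrow> \<phi> M (r \<odot>\<^bsub>Val F M Y\<^esub> \<rho>) = r \<odot>\<^bsub>Val F' M Y'\<^esub> \<phi> M \<rho>"
    and "f \<in> homs \<C> M N \<Longrightarrow> \<rho> \<in> elts \<C> F N Y \<Longrightarrow> \<phi> M (pull \<C> F f Y \<rho>) = pull \<C> F' f Y' (\<phi> N \<rho>)"
    and "M \<in> Obj \<C> \<Longrightarrow> \<phi> M \<zero>\<^bsub>Val F M Y\<^esub> = \<zero>\<^bsub>Val F' M Y'\<^esub>"
proof -
  note m = assms[unfolded Mod_morphism_def linear_map_def]
  show "\<rho> \<in> elts \<C> F M Y \<Longrightarrow> \<phi> M \<rho> \<in> elts \<C> F' M Y'"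
    using m by (auto simp: elts_iff)
  show "\<rho> \<in> elts \<C> F M Y \<Longrightarrow> \<rho>' \<in> elts \<C> F M Y
      \<Longrightarrow> \<phi> M (\<rho> \<oplus>\<^bsub>Val F M Y\<^esub> \<rho>') = \<phi> M \<rho> \<oplus>\<^bsub>Val F' M Y'\<^esub> \<phi> M \<rho>'"
    using m by (simp add: elts_iff)
  show "r \<in> carrier R \<Longrightarrow> \<rho> \<in> elts \<C> F M Y
      \<Longrightarrow> \<phi> M (r \<odot>\<^bsub>Val F M Y\<^esub> \<rho>) = r \<odot>\<^bsub>Val F' M Y'\<^esub> \<phi> M \<rho>"
    using m by (simp add: elts_iff)
  show "f \<in> homs \<C> M N \<Longrightarrow> \<rho> \<in> elts \<C> F N Y \<Longrightarrow> \<phi> M (pull \<C> F f Y \<rho>) = pull \<C> F' f Y' (\<phi> N \<rho>)"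
    using m by (simp add: elts_iff homs_iff)
  show "M \<in> Obj \<C> \<Longrightarrow> \<phi> M \<zero>\<^bsub>Val F M Y\<^esub> = \<zero>\<^bsub>Val F' M Y'\<^esub>"
    using assms linear_map_zero[of R "Val F M Y" "Val F' M Y'" "\<phi> M"]
      Mod_object.Fib_module[of R \<C> "functor_to \<C> F Y" M] Mod_object.Fib_module[of R \<C> "functor_to \<C> F' Y'" M]
    unfolding Mod_morphism_def by simp
qed

locale coend_pair = F: bilinear_functor R \<C> F + G: bilinear_functor R \<C> G
  for R :: "('r, 'q) ring_scheme" (structure) and \<C> :: "('r, 'o, 'm) lin_cat"
    and F :: "('r, 'o, 'm, 'f) bifunctor" and G :: "('r, 'o, 'm, 'g) bifunctor"
begin

abbreviation "rel X Y \<equiv> coend_rel R \<C> F G X Y"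

abbreviation "cls X Y \<equiv> coend_class R \<C> F G X Y"

abbreviation "formal X Y \<equiv> tensors \<C> F G X Y"

lemma formal_simps:
  assumes "X \<in> Obj \<C>" "Y \<in> Obj \<C>"
  shows "[] \<in> formal X Y"
    and "(M, \<rho>, \<sigma>) # k \<in> formal X Y \<longleftrightarrow> \<rho> \<in> elts \<C> F M Y \<and> \<sigma> \<in> elts \<C> G X M \<and> k \<in> formal X Y"
    and "k @ l \<in> formal X Y \<longleftrightarrow> k \<in> formal X Y \<and> l \<in> formal X Y"
  using assms by (auto simp: tensors_def elts_iff)

lemma rel_formal:
  assumes "rel X Y k l" "X \<in> Obj \<C>" "Y \<in> Obj \<C>"
  shows "k \<in> formal X Y \<and> l \<in> formal X Y"
  using assms
proof (induction rule: coend_rel.induct)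
  case (dinatural M N f \<rho> \<sigma>)
  then show ?case
    using F.pull_elts[of f M N \<rho> Y] G.push_elts[of f M N \<sigma> X]
    by (simp add: formal_simps) (simp add: homs_iff elts_iff)
next
  case (smult M r \<rho> \<sigma>)
  then show ?case
    using F.smult_elts[of r \<rho> M Y] G.smult_elts[of r \<sigma> X M]
    by (simp add: formal_simps) (simp add: homs_iff elts_iff)
next
  case (add_left M \<rho> \<rho>' \<sigma>)
  then show ?case
    using F.add_elts[of \<rho> M Y \<rho>'] by (simp add: formal_simps) (simp add: homs_iff elts_iff)
next
  case (add_right M \<rho> \<sigma> \<sigma>')
  then show ?case
    using G.add_elts[of \<sigma> X M \<sigma>'] by (simp add: formal_simps) (simp add: homs_iff elts_iff)
next
  case (zero M \<sigma>)
  then show ?case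
    using F.zero_elts[of M Y] by (simp add: formal_simps) (simp add: homs_iff elts_iff)
qed (auto simp: formal_simps)

lemma rel_cls: "k \<in> formal X Y \<Longrightarrow> rel X Y k (cls X Y k)"
  unfolding coend_class_def using coend_rel.refl by (rule someI)

lemma cls_eq: "rel X Y k l \<Longrightarrow> X \<in> Obj \<C> \<Longrightarrow> Y \<in> Obj \<C> \<Longrightarrow> cls X Y k = cls X Y l"
  using rel_formal coend_class_eq_iff by metis

text \<open>Formal sums are lists, so commutativity has to be used explicitly to regroup a sum of sums.\<close>

lemma rel_interchange:
  assumes "X \<in> Obj \<C>" "Y \<in> Obj \<C>" "a \<in> formal X Y" "b \<in> formal X Y" "c \<in> formal X Y" "d \<in> formal X Y"
  shows "rel X Y ((a @ b) @ (c @ d)) ((a @ c) @ (b @ d))"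
  using coend_rel.append[OF coend_rel.refl[OF assms(3)]
      coend_rel.append[OF coend_rel.commute[OF assms(4,5)] coend_rel.refl[OF assms(6)]]]
  by simp

lemma rel_pointwise:
  assumes "X \<in> Obj \<C>" "Y \<in> Obj \<C>" "\<And>t. t \<in> set k \<Longrightarrow> rel X Y [f t] [g t]"
  shows "rel X Y (map f k) (map g k)"
  using assms(3)
proof (induction k)
  case Nil
  then show ?case by (simp add: coend_rel.refl formal_simps assms)
next
  case (Cons t k)
  then show ?case using coend_rel.append[of R \<C> F G X Y "[f t]" "[g t]" "map f k" "map g k"] by simp
qed

lemma rel_pointwise_add:
  assumes o: "X \<in> Obj \<C>" "Y \<in> Obj \<C>" and "\<And>t. t \<in> set k \<Longrightarrow> rel X Y [f t] [g t, h t]"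
  shows "rel X Y (map f k) (map g k @ map h k)"
  using assms(3)
proof (induction k)
  case Nil
  then show ?case by (simp add: coend_rel.refl formal_simps assms)
next
  case (Cons t k)
  have 1: "rel X Y [f t] ([g t] @ [h t])" and 2: "rel X Y (map f k) (map g k @ map h k)"
    using Cons by simp_all
  have "rel X Y ([f t] @ map f k) (([g t] @ [h t]) @ (map g k @ map h k))"
    by (rule coend_rel.append[OF 1 2])
  moreover have "rel X Y (([g t] @ [h t]) @ (map g k @ map h k)) (([g t] @ map g k) @ ([h t] @ map h k))"
    using rel_formal[OF 1 o] rel_formal[OF 2 o] by (intro rel_interchange o) (simp_all only: formal_simps[OF o])
  ultimately show ?case
    by (auto intro: coend_rel.trans)
qed

end

text \<open>Functoriality of the coend in both arguments at once. Scalar multiplication, the two actions of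
  morphisms, and later the cup product with a fixed extension are all instances, so that their
  well-definedness on classes is proved only here.\<close>

lemma coend_rel_map:
  assumes p: "coend_pair R \<C> F G" "coend_pair R \<C> F' G'"
    and o: "X \<in> Obj \<C>" "Y \<in> Obj \<C>" "X' \<in> Obj \<C>" "Y' \<in> Obj \<C>"
    and \<phi>: "Mod_morphism R \<C> (functor_to \<C> F Y) (functor_to \<C> F' Y') \<phi>"
    and \<psi>: "Mod_morphism R (op_cat \<C>) (functor_from \<C> G X) (functor_from \<C> G' X') \<psi>"
    and k: "coend_rel R \<C> F G X Y k l"
  shows "coend_rel R \<C> F' G' X' Y' (map (\<lambda>(M, \<rho>, \<sigma>). (M, \<phi> M \<rho>, \<psi> M \<sigma>)) k)
    (map (\<lambda>(M, \<rho>, \<sigma>). (M, \<phi> M \<rho>, \<psi> M \<sigma>)) l)"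
proof -
  interpret P: coend_pair R \<C> F G by fact
  interpret P': coend_pair R \<C> F' G' by fact
  note f = Mod_morphismD[OF \<phi> o(2,4)]
  note g = Mod_morphismD[OF \<psi>, simplified, OF o(1,3)]
  have fc: "\<phi> M \<rho> \<in> carrier (Val F' M Y')" if "M \<in> Obj \<C>" "\<rho> \<in> carrier (Val F M Y)" for M \<rho>
    using f(1)[of \<rho> M] that o by (simp add: elts_iff)
  have gc: "\<psi> M \<rho> \<in> carrier (Val G' X' M)" if "M \<in> Obj \<C>" "\<rho> \<in> carrier (Val G X M)" for M \<rho>
    using g(1)[of \<rho> M] that o by (simp add: elts_iff)
  have t: "map (\<lambda>(M, \<rho>, \<sigma>). (M, \<phi> M \<rho>, \<psi> M \<sigma>)) k \<in> tensors \<C> F' G' X' Y'"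
    if "k \<in> tensors \<C> F G X Y" for k
    using that fc gc unfolding tensors_def by fastforce
  show ?thesis
    using k
  proof (induction rule: coend_rel.induct)
    case (refl k)
    then show ?case by (intro coend_rel.refl t)
  next
    case (sym k l)
    then show ?case by (blast intro: coend_rel.sym)
  next
    case (trans k l m)
    then show ?case by (blast intro: coend_rel.trans)
  next
    case (append k k' l l')
    then show ?case by (simp add: coend_rel.append)
  next
    case (commute k l)
    then show ?case using coend_rel.commute[OF t t] by auto
  next
    case (zero M \<sigma>)
    then show ?case using coend_rel.zero[OF _ gc] by (simp add: f(5))
  next
    case (add_left M \<rho> \<rho>' \<sigma>)
    then show ?case using coend_rel.add_left[OF _ fc fc gc] f(2)[of \<rho> M \<rho>'] by (simp add: elts_iff o)
  next
    case (add_right M \<rho> \<sigma> \<sigma>')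
    then show ?case using coend_rel.add_right[OF _ fc gc gc] g(2)[of \<sigma> M \<sigma>'] by (simp add: elts_iff o)
  next
    case (smult M r \<rho> \<sigma>)
    then show ?case
      using coend_rel.smult[OF _ _ fc gc] f(3)[of r \<rho> M] g(3)[of r \<sigma> M] by (simp add: elts_iff o)
  next
    case (dinatural M N h \<rho> \<sigma>)
    then show ?case
      using coend_rel.dinatural[OF _ _ _ fc gc] f(4)[of h M N \<rho>] g(4)[of h M N \<sigma>]
      by (simp add: elts_iff homs_iff o)
  qed
qed

context bilinear_functor
begin

lemma scalar_Mod_morphism:
  assumes "r \<in> carrier R" "Y \<in> Obj \<C>"
  shows "Mod_morphism R \<C> (functor_to \<C> \<E> Y) (functor_to \<C> \<E> Y) (\<lambda>X v. r \<odot>\<^bsub>Val \<E> X Y\<^esub> v)"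
  unfolding Mod_morphism_def linear_map_def
proof (intro conjI functor_to_Mod assms ballI, goal_cases)
  case (1 X)
  then interpret module R "Val \<E> X Y" using assms by (simp add: Val_module)
  show ?case using assms by simp
next
  case (2 X u v)
  then interpret module R "Val \<E> X Y" using assms by (simp add: Val_module)
  show ?case using assms 2 by (simp add: smult_r_distr)
next
  case (3 X s v)
  then interpret module R "Val \<E> X Y" using assms by (simp add: Val_module)
  show ?case using assms 3 by (simp add: smult_assoc1[symmetric] m_comm)
next
  case (4 X Z f v)
  then show ?case using pull_smult[of f X Z v Y r] assms by (simp add: homs_iff elts_iff)
qed

lemma identity_Mod_morphism:
  assumes "Y \<in> Obj \<C>"
  shows "Mod_morphism R \<C> (functor_to \<C> \<E> Y) (functor_to \<C> \<E> Y) (\<lambda>X v. v)"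
  unfolding Mod_morphism_def linear_map_def by (auto intro: functor_to_Mod assms)

lemma pull_Mod_morphism:
  assumes "c \<in> homs \<C> X' X"
  shows "Mod_morphism R (op_cat \<C>) (functor_from \<C> \<E> X) (functor_from \<C> \<E> X') (\<lambda>Y. pull \<C> \<E> c Y)"
  using bilinear_functor.push_Mod_morphism[OF bilinear_functor_op, of c X X'] assms by simp

end

context coend_pair
begin

abbreviation "K \<equiv> coend R \<C> F G"

lemma coend_pair_self: "coend_pair R \<C> F G"
  by (rule coend_pair_axioms)

lemma identity_from: "X \<in> Obj \<C> \<Longrightarrow>
    Mod_morphism R (op_cat \<C>) (functor_from \<C> G X) (functor_from \<C> G X) (\<lambda>M v. v)"
  using bilinear_functor.identity_Mod_morphism[OF G.bilinear_functor_op] by simp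

definition scale :: "'o \<Rightarrow> 'r \<Rightarrow> ('o \<times> 'f \<times> 'g) list \<Rightarrow> ('o \<times> 'f \<times> 'g) list"
  where "scale Y r k = map (\<lambda>(M, \<rho>, \<sigma>). (M, r \<odot>\<^bsub>Val F M Y\<^esub> \<rho>, \<sigma>)) k"

definition act :: "'o \<Rightarrow> 'o \<Rightarrow> 'm \<Rightarrow> 'm \<Rightarrow> ('o \<times> 'f \<times> 'g) list \<Rightarrow> ('o \<times> 'f \<times> 'g) list"
  where "act X Y c a k = map (\<lambda>(M, \<rho>, \<sigma>). (M, push \<C> F M a \<rho>, pull \<C> G c M \<sigma>)) k"

lemma rel_scale:
  assumes "rel X Y k l" "r \<in> carrier R" "X \<in> Obj \<C>" "Y \<in> Obj \<C>"
  shows "rel X Y (scale Y r k) (scale Y r l)"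
  unfolding scale_def
  using coend_rel_map[OF coend_pair_self coend_pair_self assms(3,4) assms(3,4)
      F.scalar_Mod_morphism identity_from assms(1)] assms by simp

lemma rel_act:
  assumes "rel X Y k l" "c \<in> homs \<C> X' X" "a \<in> homs \<C> Y Y'"
  shows "rel X' Y' (act X Y c a k) (act X Y c a l)"
  unfolding act_def using assms
  by (intro coend_rel_map[OF coend_pair_self coend_pair_self _ _ _ _
      F.push_Mod_morphism G.pull_Mod_morphism]) (auto simp: homs_iff)

lemma scale_formal: "k \<in> formal X Y \<Longrightarrow> r \<in> carrier R \<Longrightarrow> X \<in> Obj \<C> \<Longrightarrow> Y \<in> Obj \<C> \<Longrightarrow> scale Y r k \<in> formal X Y"
  using rel_scale[OF coend_rel.refl] rel_formal by blast

lemma act_formal: "k \<in> formal X Y \<Longrightarrow> c \<in> homs \<C> X' X \<Longrightarrow> a \<in> homs \<C> Y Y' \<Longrightarrow> act X Y c a k \<in> formal X' Y'"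
  using rel_act[OF coend_rel.refl] rel_formal by (metis homs_iff)

lemma coend_carrier: "carrier (Val K X Y) = cls X Y ` formal X Y"
  by (simp add: coend_def)

lemma coend_zero: "\<zero>\<^bsub>Val K X Y\<^esub> = cls X Y []"
  by (simp add: coend_def)

lemma coend_add:
  assumes "k \<in> formal X Y" "l \<in> formal X Y" "X \<in> Obj \<C>" "Y \<in> Obj \<C>"
  shows "cls X Y k \<oplus>\<^bsub>Val K X Y\<^esub> cls X Y l = cls X Y (k @ l)"
  using cls_eq[OF coend_rel.sym[OF coend_rel.append[OF rel_cls[OF assms(1)] rel_cls[OF assms(2)]]] assms(3,4)]
  by (simp add: coend_def)

lemma coend_smult:
  assumes "k \<in> formal X Y" "r \<in> carrier R" "X \<in> Obj \<C>" "Y \<in> Obj \<C>"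
  shows "r \<odot>\<^bsub>Val K X Y\<^esub> cls X Y k = cls X Y (scale Y r k)"
  using cls_eq[OF coend_rel.sym[OF rel_scale[OF rel_cls[OF assms(1)] assms(2-4)]] assms(3,4)]
  by (simp add: coend_def scale_def)

lemma coend_Act:
  assumes "k \<in> formal X Y" "c \<in> homs \<C> X' X" "a \<in> homs \<C> Y Y'"
  shows "Act K c a (cls X Y k) = cls X' Y' (act X Y c a k)"
proof -
  have "Dom \<C> c = X'" "Cod \<C> a = Y'" "X' \<in> Obj \<C>" "Y' \<in> Obj \<C>"
    using assms F.Dom_Cod[of X' X c] F.Dom_Cod[of Y Y' a] by (auto simp: homs_iff)
  then show ?thesis
    using cls_eq[OF coend_rel.sym[OF rel_act[OF rel_cls[OF assms(1)] assms(2,3)]]]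
    by (simp add: coend_def act_def)
qed

lemma rel_cancel:
  assumes "\<rho> \<in> elts \<C> F M Y" "\<sigma> \<in> elts \<C> G X M"
  shows "rel X Y [(M, (\<ominus> \<one>) \<odot>\<^bsub>Val F M Y\<^esub> \<rho>, \<sigma>), (M, \<rho>, \<sigma>)] []"
proof -
  have o: "M \<in> Obj \<C>" "X \<in> Obj \<C>" "Y \<in> Obj \<C>" using assms by (auto simp: elts_iff)
  interpret V: module R "Val F M Y" using o by (simp add: F.Val_module)
  have \<rho>: "\<rho> \<in> carrier (Val F M Y)" "\<sigma> \<in> carrier (Val G X M)" using assms by (auto simp: elts_iff)
  have "(\<ominus> \<one>) \<odot>\<^bsub>Val F M Y\<^esub> \<rho> \<oplus>\<^bsub>Val F M Y\<^esub> \<rho> = \<zero>\<^bsub>Val F M Y\<^esub>"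
    using \<rho> by (simp add: V.smult_l_minus V.M.l_neg)
  then show ?thesis
    using coend_rel.add_left[OF o(1) _ \<rho>(1,2), of "(\<ominus> \<one>) \<odot>\<^bsub>Val F M Y\<^esub> \<rho>" R] \<rho>
      coend_rel.zero[OF o(1) \<rho>(2), of R F Y]
    by (auto intro: coend_rel.sym coend_rel.trans)
qed

text \<open>Negatives in the coend come from multiplication by \<open>-1\<close>.\<close>

lemma rel_scale_neg:
  assumes "k \<in> formal X Y" and o: "X \<in> Obj \<C>" "Y \<in> Obj \<C>"
  shows "rel X Y (scale Y (\<ominus> \<one>) k @ k) []"
  using assms(1)
proof (induction k)
  case Nil
  then show ?case by (simp add: scale_def coend_rel.refl)
next
  case (Cons t k)
  obtain M \<rho> \<sigma> where t: "t = (M, \<rho>, \<sigma>)" by (cases t)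
  have e: "\<rho> \<in> elts \<C> F M Y" "\<sigma> \<in> elts \<C> G X M" "k \<in> formal X Y"
    using Cons.prems t by (simp_all add: formal_simps o)
  let ?t = "(M, (\<ominus> \<one>) \<odot>\<^bsub>Val F M Y\<^esub> \<rho>, \<sigma>)"
  have "rel X Y (([?t] @ scale Y (\<ominus> \<one>) k) @ ([t] @ k)) (([?t] @ [t]) @ (scale Y (\<ominus> \<one>) k @ k))"
    using e Cons.prems t scale_formal[OF e(3) _ o] F.smult_elts
    by (intro rel_interchange o) (auto simp: formal_simps o)
  moreover have "rel X Y (([?t] @ [t]) @ (scale Y (\<ominus> \<one>) k @ k)) ([] @ [])"
    using rel_cancel[OF e(1,2)] Cons.IH[OF e(3)] t by (intro coend_rel.append) auto
  ultimately show ?case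
    using t by (auto simp: scale_def intro: coend_rel.trans)
qed

lemma coend_module:
  assumes o: "X \<in> Obj \<C>" "Y \<in> Obj \<C>"
  shows "module R (Val K X Y)"
proof (rule moduleI)
  note s = coend_carrier coend_zero coend_add[OF _ _ o] coend_smult[OF _ _ o] formal_simps[OF o]
    scale_formal[OF _ _ o]
  note e = cls_eq[OF _ o]
  show "abelian_group (Val K X Y)"
  proof (rule abelian_groupI, goal_cases)
    case (4 x y)
    then show ?case using e[OF coend_rel.commute] by (auto simp: s)
  next
    case (6 x)
    then obtain k where k: "k \<in> formal X Y" "x = cls X Y k" by (auto simp: s)
    have n: "scale Y (\<ominus> \<one>) k \<in> formal X Y" using k by (simp add: s)
    show ?case
      using e[OF rel_scale_neg[OF k(1) o]] k n by (auto simp: s)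
  qed (auto simp: s)
next
  note s = coend_carrier coend_zero coend_add[OF _ _ o] coend_smult[OF _ _ o] formal_simps[OF o]
    scale_formal[OF _ _ o]
  note e = cls_eq[OF _ o]
  fix a b x y
  assume a: "a \<in> carrier R" and x: "x \<in> carrier (Val K X Y)"
  from x obtain k where k: "k \<in> formal X Y" "x = cls X Y k" by (auto simp: s)
  have k': "M \<in> Obj \<C> \<and> \<rho> \<in> carrier (Val F M Y) \<and> \<sigma> \<in> carrier (Val G X M)" if "(M, \<rho>, \<sigma>) \<in> set k" for M \<rho> \<sigma>
    using k(1) that by (auto simp: tensors_def)
  show "a \<odot>\<^bsub>Val K X Y\<^esub> x \<in> carrier (Val K X Y)"
    using a k by (auto simp: s)
  assume b: "b \<in> carrier R"
  show "(a \<otimes> b) \<odot>\<^bsub>Val K X Y\<^esub> x = a \<odot>\<^bsub>Val K X Y\<^esub> (b \<odot>\<^bsub>Val K X Y\<^esub> x)"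
  proof -
    have "scale Y (a \<otimes> b) k = scale Y a (scale Y b k)"
      unfolding scale_def using a b
      by (auto simp: module.smult_assoc1[OF F.Val_module[OF _ o(2)]] dest!: k')
    then show ?thesis using k a b by (simp add: s)
  qed
  show "(a \<oplus> b) \<odot>\<^bsub>Val K X Y\<^esub> x = a \<odot>\<^bsub>Val K X Y\<^esub> x \<oplus>\<^bsub>Val K X Y\<^esub> b \<odot>\<^bsub>Val K X Y\<^esub> x"
  proof -
    have "rel X Y (scale Y (a \<oplus> b) k) (scale Y a k @ scale Y b k)"
      unfolding scale_def
    proof (rule rel_pointwise_add[OF o])
      fix t assume "t \<in> set k"
      then obtain M \<rho> \<sigma> where t: "t = (M, \<rho>, \<sigma>)" "M \<in> Obj \<C>" "\<rho> \<in> carrier (Val F M Y)" "\<sigma> \<in> carrier (Val G X M)"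
        using k' by (metis prod.collapse)
      interpret V: module R "Val F M Y" using o t by (simp add: F.Val_module)
      show "rel X Y [case t of (M, \<rho>, \<sigma>) \<Rightarrow> (M, (a \<oplus> b) \<odot>\<^bsub>Val F M Y\<^esub> \<rho>, \<sigma>)]
          [case t of (M, \<rho>, \<sigma>) \<Rightarrow> (M, a \<odot>\<^bsub>Val F M Y\<^esub> \<rho>, \<sigma>), case t of (M, \<rho>, \<sigma>) \<Rightarrow> (M, b \<odot>\<^bsub>Val F M Y\<^esub> \<rho>, \<sigma>)]"
        using t a b by (auto simp: V.smult_l_distr intro: coend_rel.add_left)
    qed
    then show ?thesis using e k a b by (simp add: s)
  qed
next
  note s = coend_carrier coend_zero coend_add[OF _ _ o] coend_smult[OF _ _ o] formal_simps[OF o]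
    scale_formal[OF _ _ o]
  fix x
  assume "x \<in> carrier (Val K X Y)"
  then obtain k where k: "k \<in> formal X Y" "x = cls X Y k" by (auto simp: s)
  have k': "M \<in> Obj \<C> \<and> \<rho> \<in> carrier (Val F M Y)" if "(M, \<rho>, \<sigma>) \<in> set k" for M \<rho> \<sigma>
    using k(1) that by (auto simp: tensors_def)
  have "scale Y \<one> k = k"
    unfolding scale_def
    by (rule map_idI) (auto simp: module.smult_one[OF F.Val_module[OF _ o(2)]] dest!: k')
  then show "\<one> \<odot>\<^bsub>Val K X Y\<^esub> x = x"
    using k by (simp add: s)
next
  note s = coend_carrier coend_zero coend_add[OF _ _ o] coend_smult[OF _ _ o] formal_simps[OF o]
    scale_formal[OF _ _ o]
  fix a x y
  assume "a \<in> carrier R" "x \<in> carrier (Val K X Y)" "y \<in> carrier (Val K X Y)"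
  then show "a \<odot>\<^bsub>Val K X Y\<^esub> (x \<oplus>\<^bsub>Val K X Y\<^esub> y) = a \<odot>\<^bsub>Val K X Y\<^esub> x \<oplus>\<^bsub>Val K X Y\<^esub> a \<odot>\<^bsub>Val K X Y\<^esub> y"
    by (auto simp: s) (simp add: scale_def)
qed (rule F.is_cring)

text \<open>All axioms are checked on formal sums. Some hold on the nose, since they concern one factor entry by
  entry; additivity in either variable and scalars acting on the second factor hold up to the defining
  relations.\<close>

lemma coend_bilinear: "bilinear_functor R \<C> K"
proof (intro bilinear_functor.intro bilinear_functor_axioms.intro F.linear_category_axioms, goal_cases)
  case (1 X Y)
  then show ?case by (rule coend_module)
next
  case (2 X X' Y Y' c a)
  have c: "c \<in> homs \<C> X' X" "a \<in> homs \<C> Y Y'" using 2 by (auto simp: homs_iff)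
  note act = coend_Act[OF _ c] act_formal[OF _ c]
  show ?case
    unfolding linear_map_def
  proof (intro conjI ballI)
    show "Act K c a \<in> carrier (Val K X Y) \<rightarrow> carrier (Val K X' Y')"
      by (auto simp: coend_carrier act)
    fix u v assume "u \<in> carrier (Val K X Y)" "v \<in> carrier (Val K X Y)"
    then obtain k l where "k \<in> formal X Y" "l \<in> formal X Y" "u = cls X Y k" "v = cls X Y l"
      by (auto simp: coend_carrier)
    then show "Act K c a (u \<oplus>\<^bsub>Val K X Y\<^esub> v) = Act K c a u \<oplus>\<^bsub>Val K X' Y'\<^esub> Act K c a v"
      using 2 by (simp add: act coend_add formal_simps) (simp add: act_def)
  next
    fix r v assume "r \<in> carrier R" "v \<in> carrier (Val K X Y)"
    then obtain k where k: "k \<in> formal X Y" "v = cls X Y k" and r: "r \<in> carrier R"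
      by (auto simp: coend_carrier)
    have k': "\<rho> \<in> elts \<C> F M Y" if "(M, \<rho>, \<sigma>) \<in> set k" for M \<rho> \<sigma>
      using k(1) 2 that by (auto simp: tensors_def elts_iff)
    have "act X Y c a (scale Y r k) = scale Y' r (act X Y c a k)"
      unfolding act_def scale_def by (auto simp: F.push_smult[OF c(2) _ r] dest!: k')
    then show "Act K c a (r \<odot>\<^bsub>Val K X Y\<^esub> v) = r \<odot>\<^bsub>Val K X' Y'\<^esub> Act K c a v"
      using 2 k r by (simp add: act coend_smult scale_formal)
  qed
next
  case (3 X Y \<delta>)
  then obtain k where k: "k \<in> formal X Y" "\<delta> = cls X Y k"
    by (auto simp: coend_carrier)
  have k': "M \<in> Obj \<C> \<and> \<rho> \<in> elts \<C> F M Y \<and> \<sigma> \<in> elts \<C> G X M" if "(M, \<rho>, \<sigma>) \<in> set k" for M \<rho> \<sigma>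
    using k(1) that 3 by (auto simp: tensors_def elts_iff)
  have "act X Y (Id \<C> X) (Id \<C> Y) k = k"
    unfolding act_def by (rule map_idI) (auto simp: F.push_Id G.pull_Id dest!: k')
  then show ?case
    using k 3 coend_Act[OF k(1) F.Id_homs[OF 3(1)] F.Id_homs[OF 3(2)]] by simp
next
  case (4 X X' X'' Y Y' Y'' c c' a a' \<delta>)
  have c: "c \<in> homs \<C> X' X" "a \<in> homs \<C> Y Y'" "c' \<in> homs \<C> X'' X'" "a' \<in> homs \<C> Y' Y''"
    using 4 by (auto simp: homs_iff)
  obtain k where k: "k \<in> formal X Y" "\<delta> = cls X Y k"
    using 4 by (auto simp: coend_carrier)
  have k': "M \<in> Obj \<C> \<and> \<rho> \<in> elts \<C> F M Y \<and> \<sigma> \<in> elts \<C> G X M" if "(M, \<rho>, \<sigma>) \<in> set k" for M \<rho> \<sigma>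
    using k(1) that 4 by (auto simp: tensors_def elts_iff)
  have "act X Y (c \<circ>\<^bsub>\<C>\<^esub> c') (a' \<circ>\<^bsub>\<C>\<^esub> a) k = act X' Y' c' a' (act X Y c a k)"
    unfolding act_def by (auto simp: F.push_Comp[OF c(2,4)] G.pull_Comp[OF c(1,3)] dest!: k')
  then show ?case
    using k coend_Act[OF k(1) c(1,2)] coend_Act[OF act_formal[OF k(1) c(1,2)] c(3,4)]
      coend_Act[OF k(1) F.Comp_homs[OF c(3,1)] F.Comp_homs[OF c(2,4)]] by simp
next
  case (5 X X' Y Y' c d a \<delta>)
  have c: "c \<in> homs \<C> X' X" "d \<in> homs \<C> X' X" "a \<in> homs \<C> Y Y'"
    using 5 by (auto simp: homs_iff)
  obtain k where k: "k \<in> formal X Y" "\<delta> = cls X Y k"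
    using 5 by (auto simp: coend_carrier)
  have "rel X' Y' (act X Y (c \<oplus>\<^bsub>Hom \<C> X' X\<^esub> d) a k) (act X Y c a k @ act X Y d a k)"
    unfolding act_def
  proof (rule rel_pointwise_add[OF 5(2,4)])
    fix t assume "t \<in> set k"
    then obtain M \<rho> \<sigma> where t: "t = (M, \<rho>, \<sigma>)" "\<rho> \<in> elts \<C> F M Y" "\<sigma> \<in> elts \<C> G X M"
      using k 5 by (cases t) (auto simp: tensors_def elts_iff)
    show "rel X' Y' [case t of (M, \<rho>, \<sigma>) \<Rightarrow> (M, push \<C> F M a \<rho>, pull \<C> G (c \<oplus>\<^bsub>Hom \<C> X' X\<^esub> d) M \<sigma>)]
       [case t of (M, \<rho>, \<sigma>) \<Rightarrow> (M, push \<C> F M a \<rho>, pull \<C> G c M \<sigma>),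
        case t of (M, \<rho>, \<sigma>) \<Rightarrow> (M, push \<C> F M a \<rho>, pull \<C> G d M \<sigma>)]"
      using t c F.push_elts[OF c(3) t(2)] G.pull_elts[OF c(1) t(3)] G.pull_elts[OF c(2) t(3)]
      by (auto simp: G.pull_add_arr elts_iff intro: coend_rel.add_right)
  qed
  then show ?case
    using k coend_Act[OF k(1) c(1,3)] coend_Act[OF k(1) c(2,3)]
      coend_Act[OF k(1) F.add_homs[OF c(1,2)] c(3)] cls_eq[OF _ 5(2,4)]
      coend_add[OF act_formal[OF k(1) c(1,3)] act_formal[OF k(1) c(2,3)] 5(2,4)] by simp
next
  case (6 X X' Y Y' c a b \<delta>)
  have c: "c \<in> homs \<C> X' X" "a \<in> homs \<C> Y Y'" "b \<in> homs \<C> Y Y'"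
    using 6 by (auto simp: homs_iff)
  obtain k where k: "k \<in> formal X Y" "\<delta> = cls X Y k"
    using 6 by (auto simp: coend_carrier)
  have "rel X' Y' (act X Y c (a \<oplus>\<^bsub>Hom \<C> Y Y'\<^esub> b) k) (act X Y c a k @ act X Y c b k)"
    unfolding act_def
  proof (rule rel_pointwise_add[OF 6(2,4)])
    fix t assume "t \<in> set k"
    then obtain M \<rho> \<sigma> where t: "t = (M, \<rho>, \<sigma>)" "\<rho> \<in> elts \<C> F M Y" "\<sigma> \<in> elts \<C> G X M"
      using k 6 by (cases t) (auto simp: tensors_def elts_iff)
    show "rel X' Y' [case t of (M, \<rho>, \<sigma>) \<Rightarrow> (M, push \<C> F M (a \<oplus>\<^bsub>Hom \<C> Y Y'\<^esub> b) \<rho>, pull \<C> G c M \<sigma>)]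
       [case t of (M, \<rho>, \<sigma>) \<Rightarrow> (M, push \<C> F M a \<rho>, pull \<C> G c M \<sigma>),
        case t of (M, \<rho>, \<sigma>) \<Rightarrow> (M, push \<C> F M b \<rho>, pull \<C> G c M \<sigma>)]"
      using t c F.push_elts[OF c(2) t(2)] F.push_elts[OF c(3) t(2)] G.pull_elts[OF c(1) t(3)]
      by (auto simp: F.push_add_arr elts_iff intro: coend_rel.add_left)
  qed
  then show ?case
    using k coend_Act[OF k(1) c(1,2)] coend_Act[OF k(1) c(1,3)]
      coend_Act[OF k(1) c(1) F.add_homs[OF c(2,3)]] cls_eq[OF _ 6(2,4)]
      coend_add[OF act_formal[OF k(1) c(1,2)] act_formal[OF k(1) c(1,3)] 6(2,4)] by simp
next
  case (7 X X' Y Y' r c a \<delta>)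
  have c: "c \<in> homs \<C> X' X" "a \<in> homs \<C> Y Y'"
    using 7 by (auto simp: homs_iff)
  obtain k where k: "k \<in> formal X Y" "\<delta> = cls X Y k"
    using 7 by (auto simp: coend_carrier)
  have "rel X' Y' (map (\<lambda>(M, \<rho>, \<sigma>). (M, r \<odot>\<^bsub>Val F M Y'\<^esub> push \<C> F M a \<rho>, pull \<C> G c M \<sigma>)) k)
      (act X Y (r \<odot>\<^bsub>Hom \<C> X' X\<^esub> c) a k)"
    unfolding act_def
  proof (rule rel_pointwise[OF 7(2,4)])
    fix t assume "t \<in> set k"
    then obtain M \<rho> \<sigma> where t: "t = (M, \<rho>, \<sigma>)" "\<rho> \<in> elts \<C> F M Y" "\<sigma> \<in> elts \<C> G X M"
      using k 7 by (cases t) (auto simp: tensors_def elts_iff)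
    show "rel X' Y' [case t of (M, \<rho>, \<sigma>) \<Rightarrow> (M, r \<odot>\<^bsub>Val F M Y'\<^esub> push \<C> F M a \<rho>, pull \<C> G c M \<sigma>)]
       [case t of (M, \<rho>, \<sigma>) \<Rightarrow> (M, push \<C> F M a \<rho>, pull \<C> G (r \<odot>\<^bsub>Hom \<C> X' X\<^esub> c) M \<sigma>)]"
      using t c 7 F.push_elts[OF c(2) t(2)] G.pull_elts[OF c(1) t(3)]
      by (auto simp: G.pull_smult_arr elts_iff intro: coend_rel.smult)
  qed
  moreover have "map (\<lambda>(M, \<rho>, \<sigma>). (M, r \<odot>\<^bsub>Val F M Y'\<^esub> push \<C> F M a \<rho>, pull \<C> G c M \<sigma>)) k
      = scale Y' r (act X Y c a k)"
    by (auto simp: scale_def act_def)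
  ultimately show ?case
    using k 7 coend_Act[OF k(1) c] coend_Act[OF k(1) F.smult_homs[OF _ c(1)] c(2)] cls_eq[OF _ 7(2,4)]
      coend_smult[OF act_formal[OF k(1) c] _ 7(2,4)] by simp
next
  case (8 X X' Y Y' r c a \<delta>)
  have c: "c \<in> homs \<C> X' X" "a \<in> homs \<C> Y Y'"
    using 8 by (auto simp: homs_iff)
  obtain k where k: "k \<in> formal X Y" "\<delta> = cls X Y k"
    using 8 by (auto simp: coend_carrier)
  have k': "M \<in> Obj \<C> \<and> \<rho> \<in> elts \<C> F M Y \<and> \<sigma> \<in> elts \<C> G X M" if "(M, \<rho>, \<sigma>) \<in> set k" for M \<rho> \<sigma>
    using k(1) that 8 by (auto simp: tensors_def elts_iff)
  have "act X Y c (r \<odot>\<^bsub>Hom \<C> Y Y'\<^esub> a) k = scale Y' r (act X Y c a k)"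
    unfolding act_def scale_def by (auto simp: F.push_smult_arr[OF c(2) 8(5)] dest!: k')
  then show ?case
    using k 8 coend_Act[OF k(1) c] coend_Act[OF k(1) c(1) F.smult_homs[OF _ c(2)]]
      coend_smult[OF act_formal[OF k(1) c] _ 8(2,4)] by simp
qed

end

section \<open>Vanishing of tensors in a coend\<close>

text \<open>A morphism from each \<open>M\<^sub>i\<close> to a common object \<open>P\<close>, along which a fixed \<open>\<tau> \<in> F(P)\<close> restricts to \<open>\<rho>\<^sub>i\<close>, rewrites
  a formal sum of \<open>\<rho>\<^sub>i \<otimes> \<sigma>\<^sub>i\<close> as \<open>\<tau> \<otimes> \<omega>\<close> with \<open>\<omega>\<close> the sum of the pushed forward \<open>\<sigma>\<^sub>i\<close>. The set of all such \<open>\<omega>\<close> is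
  recorded here. A formal sum visibly represents zero if \<open>\<omega> = 0\<close> occurs for some \<open>P\<close> and \<open>\<tau>\<close>.\<close>

fun push_sums :: "('r, 'o, 'm) lin_cat \<Rightarrow> ('r, 'o, 'm, 'f) bifunctor \<Rightarrow> ('r, 'o, 'm, 'e) bifunctor \<Rightarrow>
    'o \<Rightarrow> 'o \<Rightarrow> 'o \<Rightarrow> 'f \<Rightarrow> ('o \<times> 'f \<times> 'e) list \<Rightarrow> 'e set"
  where
    "push_sums \<C> F \<E> X Y P \<tau> [] = {\<zero>\<^bsub>Val \<E> X P\<^esub>}"
  | "push_sums \<C> F \<E> X Y P \<tau> ((M, \<rho>, \<sigma>) # k) =
      {push \<C> \<E> X f \<sigma> \<oplus>\<^bsub>Val \<E> X P\<^esub> \<omega> | f \<omega>.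
        f \<in> homs \<C> M P \<and> pull \<C> F f Y \<tau> = \<rho> \<and> \<omega> \<in> push_sums \<C> F \<E> X Y P \<tau> k}"

locale coend_triangle = triangle_category R \<C> \<E> T + F: bilinear_functor R \<C> F
  for R :: "('r, 'q) ring_scheme" (structure) and \<C> :: "('r, 'o, 'm) lin_cat"
    and \<E> :: "('r, 'o, 'm, 'e) bifunctor" and T and F :: "('r, 'o, 'm, 'f) bifunctor"

sublocale coend_triangle \<subseteq> K: coend_pair R \<C> F \<E>
  by unfold_locales

context coend_triangle
begin

lemma rel_dinatural:
  assumes "f \<in> homs \<C> M N" "\<rho> \<in> elts \<C> F N Y" "\<sigma> \<in> elts \<C> \<E> X M"
  shows "K.rel X Y [(M, pull \<C> F f Y \<rho>, \<sigma>)] [(N, \<rho>, push \<C> \<E> X f \<sigma>)]"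
  using assms by (intro coend_rel.dinatural) (auto simp: homs_iff elts_iff)

text \<open>The element \<open>p\<^sup>*\<rho> + p'\<^sup>*\<rho>'\<close> of \<open>F(M \<oplus> N)\<close> is the pair \<open>(\<rho>, \<rho>')\<close>.\<close>

lemma biproduct_components:
  assumes bp: "biproduct \<C> M N P i i' p p'"
    and \<rho>: "\<rho> \<in> elts \<C> F M Y" "\<rho>' \<in> elts \<C> F N Y"
  shows "pull \<C> F i Y (pull \<C> F p Y \<rho> \<oplus>\<^bsub>Val F P Y\<^esub> pull \<C> F p' Y \<rho>') = \<rho>"
    and "pull \<C> F i' Y (pull \<C> F p Y \<rho> \<oplus>\<^bsub>Val F P Y\<^esub> pull \<C> F p' Y \<rho>') = \<rho>'"
proof -
  note b = biproductD[OF bp]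
  have o: "M \<in> Obj \<C>" "N \<in> Obj \<C>" using b by (auto simp: homs_iff)
  have e: "pull \<C> F p Y \<rho> \<in> elts \<C> F P Y" "pull \<C> F p' Y \<rho>' \<in> elts \<C> F P Y"
    using b \<rho> by blast+
  show "pull \<C> F i Y (pull \<C> F p Y \<rho> \<oplus>\<^bsub>Val F P Y\<^esub> pull \<C> F p' Y \<rho>') = \<rho>"
    using F.pull_add[OF b(1) e] F.pull_Comp[OF b(3,1) \<rho>(1)] F.pull_Comp[OF b(4,1) \<rho>(2)] b(5,7)
      F.pull_Id[OF \<rho>(1)] F.pull_zero_arr[OF o(1) \<rho>(2)] F.add_zero_elts(1)[OF \<rho>(1)] by simp
  show "pull \<C> F i' Y (pull \<C> F p Y \<rho> \<oplus>\<^bsub>Val F P Y\<^esub> pull \<C> F p' Y \<rho>') = \<rho>'"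
    using F.pull_add[OF b(2) e] F.pull_Comp[OF b(3,2) \<rho>(1)] F.pull_Comp[OF b(4,2) \<rho>(2)] b(6,8)
      F.pull_Id[OF \<rho>(2)] F.pull_zero_arr[OF o(2) \<rho>(1)] F.add_zero_elts(2)[OF \<rho>(2)] by simp
qed

lemma rel_biproduct:
  assumes bp: "biproduct \<C> M N P i i' p p'"
    and \<tau>: "\<tau> \<in> elts \<C> F P Y" and \<sigma>: "\<sigma> \<in> elts \<C> \<E> X M" "\<sigma>' \<in> elts \<C> \<E> X N"
  shows "K.rel X Y [(P, \<tau>, push \<C> \<E> X i \<sigma> \<oplus>\<^bsub>Val \<E> X P\<^esub> push \<C> \<E> X i' \<sigma>')]
    [(M, pull \<C> F i Y \<tau>, \<sigma>), (N, pull \<C> F i' Y \<tau>, \<sigma>')]"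
proof -
  note b = biproductD[OF bp]
  have "push \<C> \<E> X i \<sigma> \<in> elts \<C> \<E> X P" "push \<C> \<E> X i' \<sigma>' \<in> elts \<C> \<E> X P"
    using b \<sigma> by blast+
  then have "K.rel X Y [(P, \<tau>, push \<C> \<E> X i \<sigma> \<oplus>\<^bsub>Val \<E> X P\<^esub> push \<C> \<E> X i' \<sigma>')]
      [(P, \<tau>, push \<C> \<E> X i \<sigma>), (P, \<tau>, push \<C> \<E> X i' \<sigma>')]"
    using \<tau> by (intro coend_rel.add_right) (auto simp: elts_iff)
  moreover have "K.rel X Y [(P, \<tau>, push \<C> \<E> X i \<sigma>), (P, \<tau>, push \<C> \<E> X i' \<sigma>')]
      [(M, pull \<C> F i Y \<tau>, \<sigma>), (N, pull \<C> F i' Y \<tau>, \<sigma>')]"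
    using coend_rel.append[OF coend_rel.sym[OF rel_dinatural[OF b(1) \<tau> \<sigma>(1)]]
        coend_rel.sym[OF rel_dinatural[OF b(2) \<tau> \<sigma>(2)]]] by simp
  ultimately show ?thesis by (rule coend_rel.trans)
qed

text \<open>A sum \<open>\<rho> \<otimes> \<sigma> + \<rho>' \<otimes> \<sigma>'\<close> over \<open>M\<close> and \<open>N\<close> is the single tensor \<open>(\<rho>, \<rho>') \<otimes> (\<sigma>, \<sigma>')\<close> over \<open>M \<oplus> N\<close>.\<close>

lemma formal_reduces_to_single:
  assumes "k \<in> K.formal X Y" and o: "X \<in> Obj \<C>" "Y \<in> Obj \<C>"
  shows "\<exists>M \<rho> \<sigma>. \<rho> \<in> elts \<C> F M Y \<and> \<sigma> \<in> elts \<C> \<E> X M \<and> K.rel X Y k [(M, \<rho>, \<sigma>)]"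
  using assms(1)
proof (induction k)
  case Nil
  have "K.rel X Y [] [(X, \<zero>\<^bsub>Val F X Y\<^esub>, \<zero>\<^bsub>Val \<E> X X\<^esub>)]"
    using o zero_elts[of X X] by (intro coend_rel.sym[OF coend_rel.zero]) (auto simp: elts_iff)
  moreover have "\<zero>\<^bsub>Val F X Y\<^esub> \<in> elts \<C> F X Y" "\<zero>\<^bsub>Val \<E> X X\<^esub> \<in> elts \<C> \<E> X X"
    using o by blast+
  ultimately show ?case by blast
next
  case (Cons t k)
  obtain M \<rho> \<sigma> where t: "t = (M, \<rho>, \<sigma>)" by (cases t)
  have e: "\<rho> \<in> elts \<C> F M Y" "\<sigma> \<in> elts \<C> \<E> X M" "k \<in> K.formal X Y"
    using Cons.prems t by (simp_all add: K.formal_simps o)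
  obtain N \<rho>' \<sigma>' where k: "\<rho>' \<in> elts \<C> F N Y" "\<sigma>' \<in> elts \<C> \<E> X N" "K.rel X Y k [(N, \<rho>', \<sigma>')]"
    using Cons.IH[OF e(3)] by blast
  have "M \<in> Obj \<C>" "N \<in> Obj \<C>" using e k by (auto simp: elts_iff)
  then obtain P i i' p p' where bp: "biproduct \<C> M N P i i' p p'"
    using has_biproducts by blast
  note b = biproductD[OF bp]
  let ?\<tau> = "pull \<C> F p Y \<rho> \<oplus>\<^bsub>Val F P Y\<^esub> pull \<C> F p' Y \<rho>'"
  have \<tau>: "?\<tau> \<in> elts \<C> F P Y" using b e k by blast
  have "K.rel X Y ([t] @ k) ([t] @ [(N, \<rho>', \<sigma>')])"
    using e t o by (intro coend_rel.append k(3) coend_rel.refl) (simp add: K.formal_simps)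
  moreover have "K.rel X Y ([t] @ [(N, \<rho>', \<sigma>')])
      [(P, ?\<tau>, push \<C> \<E> X i \<sigma> \<oplus>\<^bsub>Val \<E> X P\<^esub> push \<C> \<E> X i' \<sigma>')]"
    using coend_rel.sym[OF rel_biproduct[OF bp \<tau> e(2) k(2)]] biproduct_components[OF bp e(1) k(1)] t
    by simp
  ultimately have "K.rel X Y (t # k) [(P, ?\<tau>, push \<C> \<E> X i \<sigma> \<oplus>\<^bsub>Val \<E> X P\<^esub> push \<C> \<E> X i' \<sigma>')]"
    by (auto intro: coend_rel.trans)
  moreover have "push \<C> \<E> X i \<sigma> \<oplus>\<^bsub>Val \<E> X P\<^esub> push \<C> \<E> X i' \<sigma>' \<in> elts \<C> \<E> X P"
    using b e k by blast
  ultimately show ?case using \<tau> by blast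
qed

abbreviation "sums X Y P \<tau> k \<equiv> push_sums \<C> F \<E> X Y P \<tau> k"

lemma sums_elts:
  "\<lbrakk>\<omega> \<in> sums X Y P \<tau> k; k \<in> K.formal X Y; X \<in> Obj \<C>; Y \<in> Obj \<C>; P \<in> Obj \<C>\<rbrakk> \<Longrightarrow> \<omega> \<in> elts \<C> \<E> X P"
proof (induction k arbitrary: \<omega>)
  case (Cons t k)
  then show ?case by (cases t) (auto simp: K.formal_simps)
qed auto

lemma sums_single:
  assumes "\<sigma> \<in> elts \<C> \<E> X M"
  shows "\<omega> \<in> sums X Y P \<tau> [(M, \<rho>, \<sigma>)] \<longleftrightarrow>
    (\<exists>f\<in>homs \<C> M P. pull \<C> F f Y \<tau> = \<rho> \<and> \<omega> = push \<C> \<E> X f \<sigma>)"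
  using add_zero_elts(1)[OF push_elts[OF _ assms]] by auto metis

lemma sums_append:
  assumes "X \<in> Obj \<C>" "Y \<in> Obj \<C>" "P \<in> Obj \<C>" "l \<in> K.formal X Y" "k \<in> K.formal X Y"
  shows "\<omega> \<in> sums X Y P \<tau> (k @ l) \<longleftrightarrow>
    (\<exists>a\<in>sums X Y P \<tau> k. \<exists>b\<in>sums X Y P \<tau> l. \<omega> = a \<oplus>\<^bsub>Val \<E> X P\<^esub> b)"
  using assms(5)
proof (induction k arbitrary: \<omega>)
  case Nil
  then show ?case using sums_elts[OF _ assms(4,1,2,3)] add_zero_elts(2) by auto
next
  case (Cons t k)
  obtain M \<rho> \<sigma> where t: "t = (M, \<rho>, \<sigma>)" by (cases t)
  interpret V: abelian_group "Val \<E> X P" using assms by (simp add: elts_group)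
  have e: "\<sigma> \<in> elts \<C> \<E> X M" "k \<in> K.formal X Y"
    using Cons.prems t by (simp_all add: K.formal_simps assms)
  have assoc: "(push \<C> \<E> X f \<sigma> \<oplus>\<^bsub>Val \<E> X P\<^esub> a) \<oplus>\<^bsub>Val \<E> X P\<^esub> b = push \<C> \<E> X f \<sigma> \<oplus>\<^bsub>Val \<E> X P\<^esub> (a \<oplus>\<^bsub>Val \<E> X P\<^esub> b)"
    if "f \<in> homs \<C> M P" "a \<in> sums X Y P \<tau> k" "b \<in> sums X Y P \<tau> l" for f a b
    using push_elts[OF that(1) e(1)] sums_elts[OF that(2) e(2) assms(1-3)] sums_elts[OF that(3) assms(4,1-3)]
    by (simp add: elts_iff V.a_assoc)
  have "\<omega> \<in> sums X Y P \<tau> (t # k @ l) \<longleftrightarrow> (\<exists>f\<in>homs \<C> M P. pull \<C> F f Y \<tau> = \<rho> \<and>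
      (\<exists>a\<in>sums X Y P \<tau> k. \<exists>b\<in>sums X Y P \<tau> l.
        \<omega> = push \<C> \<E> X f \<sigma> \<oplus>\<^bsub>Val \<E> X P\<^esub> (a \<oplus>\<^bsub>Val \<E> X P\<^esub> b)))"
    unfolding t by (auto simp: Cons.IH[OF e(2)])
  also have "\<dots> \<longleftrightarrow> (\<exists>a\<in>sums X Y P \<tau> (t # k). \<exists>b\<in>sums X Y P \<tau> l. \<omega> = a \<oplus>\<^bsub>Val \<E> X P\<^esub> b)"
  proof
    assume "\<exists>f\<in>homs \<C> M P. pull \<C> F f Y \<tau> = \<rho> \<and> (\<exists>a\<in>sums X Y P \<tau> k. \<exists>b\<in>sums X Y P \<tau> l.
        \<omega> = push \<C> \<E> X f \<sigma> \<oplus>\<^bsub>Val \<E> X P\<^esub> (a \<oplus>\<^bsub>Val \<E> X P\<^esub> b))"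
    then obtain f a b where f: "f \<in> homs \<C> M P" "pull \<C> F f Y \<tau> = \<rho>" "a \<in> sums X Y P \<tau> k" "b \<in> sums X Y P \<tau> l"
        "\<omega> = push \<C> \<E> X f \<sigma> \<oplus>\<^bsub>Val \<E> X P\<^esub> (a \<oplus>\<^bsub>Val \<E> X P\<^esub> b)"
      by blast
    then have "push \<C> \<E> X f \<sigma> \<oplus>\<^bsub>Val \<E> X P\<^esub> a \<in> sums X Y P \<tau> (t # k)"
      unfolding t push_sums.simps by blast
    then show "\<exists>a\<in>sums X Y P \<tau> (t # k). \<exists>b\<in>sums X Y P \<tau> l. \<omega> = a \<oplus>\<^bsub>Val \<E> X P\<^esub> b"
      using f assoc[OF f(1,3,4)] by metis
  next
    assume "\<exists>a\<in>sums X Y P \<tau> (t # k). \<exists>b\<in>sums X Y P \<tau> l. \<omega> = a \<oplus>\<^bsub>Val \<E> X P\<^esub> b"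
    then show "\<exists>f\<in>homs \<C> M P. pull \<C> F f Y \<tau> = \<rho> \<and> (\<exists>a\<in>sums X Y P \<tau> k. \<exists>b\<in>sums X Y P \<tau> l.
        \<omega> = push \<C> \<E> X f \<sigma> \<oplus>\<^bsub>Val \<E> X P\<^esub> (a \<oplus>\<^bsub>Val \<E> X P\<^esub> b))"
      unfolding t push_sums.simps using assoc by blast
  qed
  finally show ?case by simp
qed

lemma sums_push:
  assumes "h \<in> homs \<C> P P'" "\<tau>' \<in> elts \<C> F P' Y" "pull \<C> F h Y \<tau>' = \<tau>" "X \<in> Obj \<C>" "k \<in> K.formal X Y"
    and "\<omega> \<in> sums X Y P \<tau> k"
  shows "push \<C> \<E> X h \<omega> \<in> sums X Y P' \<tau>' k"
  using assms(5,6)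
proof (induction k arbitrary: \<omega>)
  case Nil
  then show ?case using push_zero assms by auto
next
  case (Cons t k)
  obtain M \<rho> \<sigma> where t: "t = (M, \<rho>, \<sigma>)" by (cases t)
  have o: "Y \<in> Obj \<C>" "P \<in> Obj \<C>" using assms by (auto simp: elts_iff homs_iff)
  have e: "\<sigma> \<in> elts \<C> \<E> X M" "k \<in> K.formal X Y"
    using Cons.prems t by (simp_all add: K.formal_simps assms o)
  obtain f \<omega>' where f: "f \<in> homs \<C> M P" "pull \<C> F f Y \<tau> = \<rho>" "\<omega>' \<in> sums X Y P \<tau> k"
      "\<omega> = push \<C> \<E> X f \<sigma> \<oplus>\<^bsub>Val \<E> X P\<^esub> \<omega>'"
    using Cons.prems t by auto
  have "push \<C> \<E> X h \<omega> = push \<C> \<E> X (h \<circ>\<^bsub>\<C>\<^esub> f) \<sigma> \<oplus>\<^bsub>Val \<E> X P'\<^esub> push \<C> \<E> X h \<omega>'"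
    using push_add[OF assms(1) push_elts[OF f(1) e(1)] sums_elts[OF f(3) e(2) assms(4) o]] f(4)
      push_Comp[OF f(1) assms(1) e(1)] by simp
  moreover have "pull \<C> F (h \<circ>\<^bsub>\<C>\<^esub> f) Y \<tau>' = \<rho>"
    using F.pull_Comp[OF assms(1) f(1) assms(2)] assms(3) f(2) by simp
  moreover have "h \<circ>\<^bsub>\<C>\<^esub> f \<in> homs \<C> M P'" using assms(1) f(1) by blast
  ultimately show ?case using Cons.IH[OF e(2) f(3)] t by auto
qed

text \<open>Every rewriting of \<open>k\<close> as some \<open>\<tau> \<otimes> \<omega>\<close> becomes, after enlarging \<open>P\<close>, a rewriting of \<open>l\<close>. Enlarging is what makes
  the relation transitive and compatible with sums, while still allowing the dinaturality relation, whose
  witnesses cannot be kept on the same object.\<close>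

definition refines :: "'o \<Rightarrow> 'o \<Rightarrow> ('o \<times> 'f \<times> 'e) list \<Rightarrow> ('o \<times> 'f \<times> 'e) list \<Rightarrow> bool"
  where "refines X Y k l \<longleftrightarrow> (\<forall>P \<tau>. \<forall>\<omega>\<in>sums X Y P \<tau> k. \<tau> \<in> elts \<C> F P Y \<longrightarrow>
    (\<exists>P' \<tau>' h. h \<in> homs \<C> P P' \<and> \<tau>' \<in> elts \<C> F P' Y \<and> pull \<C> F h Y \<tau>' = \<tau> \<and>
      push \<C> \<E> X h \<omega> \<in> sums X Y P' \<tau>' l))"

lemma refinesI_Id:
  assumes "\<And>P \<tau> \<omega>. \<tau> \<in> elts \<C> F P Y \<Longrightarrow> \<omega> \<in> sums X Y P \<tau> k \<Longrightarrow> \<omega> \<in> sums X Y P \<tau> l"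
    and "X \<in> Obj \<C>" "Y \<in> Obj \<C>" "k \<in> K.formal X Y"
  shows "refines X Y k l"
  unfolding refines_def
proof (intro allI ballI impI)
  fix P \<tau> \<omega> assume a: "\<omega> \<in> sums X Y P \<tau> k" "\<tau> \<in> elts \<C> F P Y"
  then have P: "P \<in> Obj \<C>" by (simp add: elts_iff)
  have "push \<C> \<E> X (Id \<C> P) \<omega> \<in> sums X Y P \<tau> l"
    using assms(1)[OF a(2,1)] push_Id[OF sums_elts[OF a(1) assms(4,2,3) P]] by simp
  then show "\<exists>P' \<tau>' h. h \<in> homs \<C> P P' \<and> \<tau>' \<in> elts \<C> F P' Y \<and> pull \<C> F h Y \<tau>' = \<tau> \<and>
      push \<C> \<E> X h \<omega> \<in> sums X Y P' \<tau>' l"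
    using Id_homs[OF P] a(2) F.pull_Id[OF a(2)] by blast
qed

lemma refines_trans:
  assumes "refines X Y k l" "refines X Y l m" "X \<in> Obj \<C>" "Y \<in> Obj \<C>" "k \<in> K.formal X Y"
  shows "refines X Y k m"
  unfolding refines_def
proof (intro allI ballI impI)
  fix P \<tau> \<omega> assume a: "\<omega> \<in> sums X Y P \<tau> k" "\<tau> \<in> elts \<C> F P Y"
  then have P: "P \<in> Obj \<C>" by (simp add: elts_iff)
  obtain P' \<tau>' h where h: "h \<in> homs \<C> P P'" "\<tau>' \<in> elts \<C> F P' Y" "pull \<C> F h Y \<tau>' = \<tau>"
      "push \<C> \<E> X h \<omega> \<in> sums X Y P' \<tau>' l"
    using assms(1) a unfolding refines_def by blast
  obtain P'' \<tau>'' h' where h': "h' \<in> homs \<C> P' P''" "\<tau>'' \<in> elts \<C> F P'' Y" "pull \<C> F h' Y \<tau>'' = \<tau>'"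
      "push \<C> \<E> X h' (push \<C> \<E> X h \<omega>) \<in> sums X Y P'' \<tau>'' m"
    using assms(2) h unfolding refines_def by blast
  have "pull \<C> F (h' \<circ>\<^bsub>\<C>\<^esub> h) Y \<tau>'' = \<tau>" "push \<C> \<E> X (h' \<circ>\<^bsub>\<C>\<^esub> h) \<omega> \<in> sums X Y P'' \<tau>'' m"
    using F.pull_Comp[OF h'(1) h(1) h'(2)] h(3) h'(3,4)
      push_Comp[OF h(1) h'(1) sums_elts[OF a(1) assms(5,3,4) P]] by simp_all
  then show "\<exists>P' \<tau>' h. h \<in> homs \<C> P P' \<and> \<tau>' \<in> elts \<C> F P' Y \<and> pull \<C> F h Y \<tau>' = \<tau> \<and>
      push \<C> \<E> X h \<omega> \<in> sums X Y P' \<tau>' m"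
    using Comp_homs[OF h(1) h'(1)] h'(2) by blast
qed

lemma refines_append:
  assumes r: "refines X Y k k'" "refines X Y l l'" and o: "X \<in> Obj \<C>" "Y \<in> Obj \<C>"
    and f: "k \<in> K.formal X Y" "l \<in> K.formal X Y" "k' \<in> K.formal X Y" "l' \<in> K.formal X Y"
  shows "refines X Y (k @ l) (k' @ l')"
  unfolding refines_def
proof (intro allI ballI impI)
  fix P \<tau> \<omega> assume a: "\<omega> \<in> sums X Y P \<tau> (k @ l)" "\<tau> \<in> elts \<C> F P Y"
  then have P: "P \<in> Obj \<C>" by (simp add: elts_iff)
  obtain \<alpha> \<beta> where ab: "\<alpha> \<in> sums X Y P \<tau> k" "\<beta> \<in> sums X Y P \<tau> l" "\<omega> = \<alpha> \<oplus>\<^bsub>Val \<E> X P\<^esub> \<beta>"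
    using a sums_append[OF o P f(2,1)] by blast
  have e: "\<alpha> \<in> elts \<C> \<E> X P" "\<beta> \<in> elts \<C> \<E> X P"
    using sums_elts[OF ab(1) f(1) o P] sums_elts[OF ab(2) f(2) o P] .
  obtain P' \<tau>' h where h: "h \<in> homs \<C> P P'" "\<tau>' \<in> elts \<C> F P' Y" "pull \<C> F h Y \<tau>' = \<tau>"
      "push \<C> \<E> X h \<alpha> \<in> sums X Y P' \<tau>' k'"
    using r(1) a ab unfolding refines_def by blast
  have "push \<C> \<E> X h \<beta> \<in> sums X Y P' \<tau>' l"
    by (rule sums_push[OF h(1-3) o(1) f(2) ab(2)])
  then obtain P'' \<tau>'' h' where h': "h' \<in> homs \<C> P' P''" "\<tau>'' \<in> elts \<C> F P'' Y" "pull \<C> F h' Y \<tau>'' = \<tau>'"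
      "push \<C> \<E> X h' (push \<C> \<E> X h \<beta>) \<in> sums X Y P'' \<tau>'' l'"
    using r(2) h unfolding refines_def by blast
  have P'': "P'' \<in> Obj \<C>" using h' by (simp add: elts_iff)
  have \<alpha>': "push \<C> \<E> X h' (push \<C> \<E> X h \<alpha>) \<in> sums X Y P'' \<tau>'' k'"
    by (rule sums_push[OF h'(1-3) o(1) f(3) h(4)])
  let ?h = "h' \<circ>\<^bsub>\<C>\<^esub> h"
  have hh: "?h \<in> homs \<C> P P''" using h(1) h'(1) by blast
  have "push \<C> \<E> X ?h \<omega> = push \<C> \<E> X h' (push \<C> \<E> X h \<alpha>) \<oplus>\<^bsub>Val \<E> X P''\<^esub> push \<C> \<E> X h' (push \<C> \<E> X h \<beta>)"
    using push_add[OF hh e] push_Comp[OF h(1) h'(1) e(1)] push_Comp[OF h(1) h'(1) e(2)] ab(3) by simp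
  then have "push \<C> \<E> X ?h \<omega> \<in> sums X Y P'' \<tau>'' (k' @ l')"
    using sums_append[OF o P'' f(4,3)] \<alpha>' h'(4) by blast
  moreover have "pull \<C> F ?h Y \<tau>'' = \<tau>"
    using F.pull_Comp[OF h'(1) h(1) h'(2)] h(3) h'(3) by simp
  ultimately show "\<exists>P' \<tau>' h. h \<in> homs \<C> P P' \<and> \<tau>' \<in> elts \<C> F P' Y \<and> pull \<C> F h Y \<tau>' = \<tau> \<and>
      push \<C> \<E> X h \<omega> \<in> sums X Y P' \<tau>' (k' @ l')"
    using hh h'(2) by blast
qed

lemma refines_commute:
  assumes o: "X \<in> Obj \<C>" "Y \<in> Obj \<C>" and f: "k \<in> K.formal X Y" "l \<in> K.formal X Y"
  shows "refines X Y (k @ l) (l @ k)"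
proof (rule refinesI_Id[OF _ o])
  fix P \<tau> \<omega> assume a: "\<tau> \<in> elts \<C> F P Y" "\<omega> \<in> sums X Y P \<tau> (k @ l)"
  then have P: "P \<in> Obj \<C>" by (simp add: elts_iff)
  interpret V: abelian_group "Val \<E> X P" using o P by (simp add: elts_group)
  obtain \<alpha> \<beta> where ab: "\<alpha> \<in> sums X Y P \<tau> k" "\<beta> \<in> sums X Y P \<tau> l" "\<omega> = \<alpha> \<oplus>\<^bsub>Val \<E> X P\<^esub> \<beta>"
    using a sums_append[OF o P f(2,1)] by blast
  then have "\<omega> = \<beta> \<oplus>\<^bsub>Val \<E> X P\<^esub> \<alpha>"
    using sums_elts[OF ab(1) f(1) o P] sums_elts[OF ab(2) f(2) o P] by (simp add: elts_iff V.a_comm)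
  then show "\<omega> \<in> sums X Y P \<tau> (l @ k)"
    using sums_append[OF o P f] ab by blast
qed (use f o in \<open>simp add: K.formal_simps\<close>)

abbreviation "equirefines X Y k l \<equiv> refines X Y k l \<and> refines X Y l k"

text \<open>A morphism \<open>g : M \<rightarrow> P\<close> with \<open>g\<^sup>*\<tau> = f\<^sup>*\<rho>\<close> need not factor through \<open>f : M \<rightarrow> N\<close>. But \<open>(\<tau>, \<rho>) \<in> F(P \<oplus> N)\<close> dies along
  \<open>(g, -f)\<close>, so half exactness provides \<open>P \<oplus> N \<rightarrow> Q\<close> over which it extends and whose two components agree on
  \<open>g\<^sub>*\<sigma>\<close> and \<open>f\<^sub>*\<sigma>\<close>.\<close>

lemma refines_dinatural:
  assumes ex: "half_exact T (functor_to \<C> F Y)"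
    and f: "f \<in> homs \<C> M N" and \<rho>: "\<rho> \<in> elts \<C> F N Y" and \<sigma>: "\<sigma> \<in> elts \<C> \<E> X M"
  shows "equirefines X Y [(M, pull \<C> F f Y \<rho>, \<sigma>)] [(N, \<rho>, push \<C> \<E> X f \<sigma>)]"
proof
  have o: "X \<in> Obj \<C>" "Y \<in> Obj \<C>" "M \<in> Obj \<C>" "N \<in> Obj \<C>" using \<rho> \<sigma> by (auto simp: elts_iff)
  have fr: "pull \<C> F f Y \<rho> \<in> elts \<C> F M Y" "push \<C> \<E> X f \<sigma> \<in> elts \<C> \<E> X N"
    using f \<rho> \<sigma> by blast+
  show "refines X Y [(N, \<rho>, push \<C> \<E> X f \<sigma>)] [(M, pull \<C> F f Y \<rho>, \<sigma>)]"
  proof (rule refinesI_Id[OF _ o(1,2)])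
    fix P \<tau> \<omega> assume a: "\<tau> \<in> elts \<C> F P Y" "\<omega> \<in> sums X Y P \<tau> [(N, \<rho>, push \<C> \<E> X f \<sigma>)]"
    then obtain g where g: "g \<in> homs \<C> N P" "pull \<C> F g Y \<tau> = \<rho>" "\<omega> = push \<C> \<E> X g (push \<C> \<E> X f \<sigma>)"
      unfolding sums_single[OF fr(2)] by blast
    then have "g \<circ>\<^bsub>\<C>\<^esub> f \<in> homs \<C> M P" "pull \<C> F (g \<circ>\<^bsub>\<C>\<^esub> f) Y \<tau> = pull \<C> F f Y \<rho>" "\<omega> = push \<C> \<E> X (g \<circ>\<^bsub>\<C>\<^esub> f) \<sigma>"
      using f F.pull_Comp[OF g(1) f a(1)] push_Comp[OF f g(1) \<sigma>] by auto
    then show "\<omega> \<in> sums X Y P \<tau> [(M, pull \<C> F f Y \<rho>, \<sigma>)]"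
      unfolding sums_single[OF \<sigma>] by blast
  qed (use fr \<rho> o in \<open>simp add: K.formal_simps\<close>)
  show "refines X Y [(M, pull \<C> F f Y \<rho>, \<sigma>)] [(N, \<rho>, push \<C> \<E> X f \<sigma>)]"
    unfolding refines_def
  proof (intro allI ballI impI)
    fix P \<tau> \<omega> assume a: "\<omega> \<in> sums X Y P \<tau> [(M, pull \<C> F f Y \<rho>, \<sigma>)]" and \<tau>: "\<tau> \<in> elts \<C> F P Y"
    then obtain g where g: "g \<in> homs \<C> M P" "pull \<C> F g Y \<tau> = pull \<C> F f Y \<rho>" "\<omega> = push \<C> \<E> X g \<sigma>"
      unfolding sums_single[OF \<sigma>] by blast
    have P: "P \<in> Obj \<C>" using \<tau> by (simp add: elts_iff)
    obtain S i i' p p' where bp: "biproduct \<C> P N S i i' p p'"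
      using has_biproducts P o by blast
    note b = biproductD[OF bp]
    interpret MS: abelian_group "Hom \<C> M S" using o b by (simp add: homs_group homs_iff)
    \<comment> \<open>the map with components \<open>g\<close> and \<open>- f\<close>\<close>
    define nf where "nf = \<ominus>\<^bsub>Hom \<C> M S\<^esub> (i' \<circ>\<^bsub>\<C>\<^esub> f)"
    define \<phi> where "\<phi> = (i \<circ>\<^bsub>\<C>\<^esub> g) \<oplus>\<^bsub>Hom \<C> M S\<^esub> nf"
    define \<tau>0 where "\<tau>0 = pull \<C> F p Y \<tau> \<oplus>\<^bsub>Val F S Y\<^esub> pull \<C> F p' Y \<rho>"
    have ig: "i \<circ>\<^bsub>\<C>\<^esub> g \<in> homs \<C> M S" and if': "i' \<circ>\<^bsub>\<C>\<^esub> f \<in> homs \<C> M S" using b g f by blast+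
    have nf: "nf \<in> homs \<C> M S" using if' by (simp add: nf_def homs_iff)
    have \<phi>: "\<phi> \<in> homs \<C> M S" unfolding \<phi>_def using ig nf by blast
    have \<tau>0: "\<tau>0 \<in> elts \<C> F S Y" unfolding \<tau>0_def using b \<tau> \<rho> by blast
    have sum0: "(i' \<circ>\<^bsub>\<C>\<^esub> f) \<oplus>\<^bsub>Hom \<C> M S\<^esub> nf = \<zero>\<^bsub>Hom \<C> M S\<^esub>"
      using if' by (simp add: nf_def homs_iff MS.r_neg)
    have oS: "S \<in> Obj \<C>" using b by (simp add: homs_iff)
    have c: "pull \<C> F i Y \<tau>0 = \<tau>" "pull \<C> F i' Y \<tau>0 = \<rho>"
      unfolding \<tau>0_def using biproduct_components[OF bp \<tau> \<rho>] .
    have nfF: "pull \<C> F (i' \<circ>\<^bsub>\<C>\<^esub> f) Y \<tau>0 \<oplus>\<^bsub>Val F M Y\<^esub> pull \<C> F nf Y \<tau>0 = \<zero>\<^bsub>Val F M Y\<^esub>"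
      using F.pull_add_arr[OF if' nf \<tau>0] F.pull_zero_arr[OF o(3) \<tau>0] sum0 by simp
    have "pull \<C> F \<phi> Y \<tau>0 = \<zero>\<^bsub>Val F M Y\<^esub>"
      using nfF F.pull_add_arr[OF ig nf \<tau>0] F.pull_Comp[OF b(1) g(1) \<tau>0] F.pull_Comp[OF b(2) f \<tau>0] c g(2)
      by (simp add: \<phi>_def)
    then have "\<tau>0 \<in> carrier (Fib (functor_to \<C> F Y) S)"
      "Trans (functor_to \<C> F Y) \<phi> \<tau>0 = \<zero>\<^bsub>Fib (functor_to \<C> F Y) M\<^esub>"
      using \<tau>0 by (simp_all add: elts_iff)
    then obtain Q h \<tau>' where hQ: "h \<in> homs \<C> S Q" "\<tau>' \<in> carrier (Fib (functor_to \<C> F Y) Q)"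
        "Trans (functor_to \<C> F Y) h \<tau>' = \<tau>0" "push \<C> \<E> X h (push \<C> \<E> X \<phi> \<sigma>) = \<zero>\<^bsub>Val \<E> X Q\<^esub>"
      using half_exact_annihilate[OF F.functor_to_Mod[OF o(2)] ex \<phi> _ _ \<sigma>] by metis
    then have h: "h \<in> homs \<C> S Q" "\<tau>' \<in> elts \<C> F Q Y" "pull \<C> F h Y \<tau>' = \<tau>0"
        "push \<C> \<E> X h (push \<C> \<E> X \<phi> \<sigma>) = \<zero>\<^bsub>Val \<E> X Q\<^esub>"
      using o(2) by (simp_all add: elts_iff homs_iff)
    have oQ: "Q \<in> Obj \<C>" using h by (simp add: elts_iff)
    have comp: "push \<C> \<E> X h (push \<C> \<E> X (i \<circ>\<^bsub>\<C>\<^esub> g) \<sigma>) \<oplus>\<^bsub>Val \<E> X Q\<^esub> push \<C> \<E> X h (push \<C> \<E> X nf \<sigma>) = \<zero>\<^bsub>Val \<E> X Q\<^esub>"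
      using h(4) push_add_arr[OF ig nf \<sigma>] push_add[OF h(1) push_elts[OF ig \<sigma>] push_elts[OF nf \<sigma>]]
      by (simp add: \<phi>_def)
    have "push \<C> \<E> X h (push \<C> \<E> X (i' \<circ>\<^bsub>\<C>\<^esub> f) \<sigma>) \<oplus>\<^bsub>Val \<E> X Q\<^esub> push \<C> \<E> X h (push \<C> \<E> X nf \<sigma>) = \<zero>\<^bsub>Val \<E> X Q\<^esub>"
      using push_add_arr[OF if' nf \<sigma>] push_add[OF h(1) push_elts[OF if' \<sigma>] push_elts[OF nf \<sigma>]]
        push_zero_arr[OF oS \<sigma>] sum0 push_zero[OF h(1) o(1)] by simp
    then have eq: "push \<C> \<E> X h (push \<C> \<E> X (i \<circ>\<^bsub>\<C>\<^esub> g) \<sigma>) = push \<C> \<E> X h (push \<C> \<E> X (i' \<circ>\<^bsub>\<C>\<^esub> f) \<sigma>)"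
      using comp neg_unique push_elts[OF h(1) push_elts[OF ig \<sigma>]] push_elts[OF h(1) push_elts[OF nf \<sigma>]]
        push_elts[OF h(1) push_elts[OF if' \<sigma>]] by metis
    have hi: "h \<circ>\<^bsub>\<C>\<^esub> i \<in> homs \<C> P Q" "h \<circ>\<^bsub>\<C>\<^esub> i' \<in> homs \<C> N Q" using h b by blast+
    have "pull \<C> F (h \<circ>\<^bsub>\<C>\<^esub> i) Y \<tau>' = \<tau>" "pull \<C> F (h \<circ>\<^bsub>\<C>\<^esub> i') Y \<tau>' = \<rho>"
      using F.pull_Comp[OF h(1) b(1) h(2)] F.pull_Comp[OF h(1) b(2) h(2)] h(3) c by simp_all
    moreover have "push \<C> \<E> X (h \<circ>\<^bsub>\<C>\<^esub> i) \<omega> = push \<C> \<E> X (h \<circ>\<^bsub>\<C>\<^esub> i') (push \<C> \<E> X f \<sigma>)"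
      using push_Comp[OF b(1) h(1) push_elts[OF g(1) \<sigma>]] push_Comp[OF b(2) h(1) push_elts[OF f \<sigma>]]
        push_Comp[OF g(1) b(1) \<sigma>] push_Comp[OF f b(2) \<sigma>] g(3) eq by simp
    ultimately show "\<exists>P' \<tau>' h. h \<in> homs \<C> P P' \<and> \<tau>' \<in> elts \<C> F P' Y \<and> pull \<C> F h Y \<tau>' = \<tau> \<and>
        push \<C> \<E> X h \<omega> \<in> sums X Y P' \<tau>' [(N, \<rho>, push \<C> \<E> X f \<sigma>)]"
      unfolding sums_single[OF fr(2)] using hi h(2) by blast
  qed
qed

lemma refines_biproduct:
  assumes bp: "biproduct \<C> M N P i i' p p'"
    and \<tau>0: "\<tau>0 \<in> elts \<C> F P Y" and \<sigma>: "\<sigma> \<in> elts \<C> \<E> X M" "\<sigma>' \<in> elts \<C> \<E> X N"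
  shows "equirefines X Y [(P, \<tau>0, push \<C> \<E> X i \<sigma> \<oplus>\<^bsub>Val \<E> X P\<^esub> push \<C> \<E> X i' \<sigma>')]
    [(M, pull \<C> F i Y \<tau>0, \<sigma>), (N, pull \<C> F i' Y \<tau>0, \<sigma>')]"
proof
  note b = biproductD[OF bp]
  have o: "X \<in> Obj \<C>" "Y \<in> Obj \<C>" "P \<in> Obj \<C>" using \<tau>0 \<sigma> by (auto simp: elts_iff)
  have \<theta>: "push \<C> \<E> X i \<sigma> \<oplus>\<^bsub>Val \<E> X P\<^esub> push \<C> \<E> X i' \<sigma>' \<in> elts \<C> \<E> X P"
    and pe: "push \<C> \<E> X i \<sigma> \<in> elts \<C> \<E> X P" "push \<C> \<E> X i' \<sigma>' \<in> elts \<C> \<E> X P"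
    using b \<sigma> by blast+
  have fe: "pull \<C> F i Y \<tau>0 \<in> elts \<C> F M Y" "pull \<C> F i' Y \<tau>0 \<in> elts \<C> F N Y"
    using b \<tau>0 by blast+
  have two: "\<omega> \<in> sums X Y L \<tau> [(M, \<rho>, \<sigma>), (N, \<rho>', \<sigma>')] \<longleftrightarrow>
      (\<exists>g\<in>homs \<C> M L. \<exists>g'\<in>homs \<C> N L. pull \<C> F g Y \<tau> = \<rho> \<and> pull \<C> F g' Y \<tau> = \<rho>' \<and>
        \<omega> = push \<C> \<E> X g \<sigma> \<oplus>\<^bsub>Val \<E> X L\<^esub> push \<C> \<E> X g' \<sigma>')" for \<omega> L \<tau> \<rho> \<rho>'
  proof -
    have "\<omega> \<in> sums X Y L \<tau> [(M, \<rho>, \<sigma>), (N, \<rho>', \<sigma>')] \<longleftrightarrow> (\<exists>g \<omega>'. g \<in> homs \<C> M L \<and> pull \<C> F g Y \<tau> = \<rho> \<and>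
        \<omega>' \<in> sums X Y L \<tau> [(N, \<rho>', \<sigma>')] \<and> \<omega> = push \<C> \<E> X g \<sigma> \<oplus>\<^bsub>Val \<E> X L\<^esub> \<omega>')"
      by auto
    then show ?thesis
      unfolding sums_single[OF \<sigma>(2)] by blast
  qed
  show "refines X Y [(P, \<tau>0, push \<C> \<E> X i \<sigma> \<oplus>\<^bsub>Val \<E> X P\<^esub> push \<C> \<E> X i' \<sigma>')]
    [(M, pull \<C> F i Y \<tau>0, \<sigma>), (N, pull \<C> F i' Y \<tau>0, \<sigma>')]"
  proof (rule refinesI_Id[OF _ o(1,2)])
    fix L \<tau> \<omega> assume a: "\<tau> \<in> elts \<C> F L Y"
      "\<omega> \<in> sums X Y L \<tau> [(P, \<tau>0, push \<C> \<E> X i \<sigma> \<oplus>\<^bsub>Val \<E> X P\<^esub> push \<C> \<E> X i' \<sigma>')]"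
    then obtain g where g: "g \<in> homs \<C> P L" "pull \<C> F g Y \<tau> = \<tau>0"
        "\<omega> = push \<C> \<E> X g (push \<C> \<E> X i \<sigma> \<oplus>\<^bsub>Val \<E> X P\<^esub> push \<C> \<E> X i' \<sigma>')"
      unfolding sums_single[OF \<theta>] by blast
    have "g \<circ>\<^bsub>\<C>\<^esub> i \<in> homs \<C> M L" "g \<circ>\<^bsub>\<C>\<^esub> i' \<in> homs \<C> N L" using g b by blast+
    moreover have "pull \<C> F (g \<circ>\<^bsub>\<C>\<^esub> i) Y \<tau> = pull \<C> F i Y \<tau>0" "pull \<C> F (g \<circ>\<^bsub>\<C>\<^esub> i') Y \<tau> = pull \<C> F i' Y \<tau>0"
      using F.pull_Comp[OF g(1) b(1) a(1)] F.pull_Comp[OF g(1) b(2) a(1)] g(2) by simp_all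
    moreover have "\<omega> = push \<C> \<E> X (g \<circ>\<^bsub>\<C>\<^esub> i) \<sigma> \<oplus>\<^bsub>Val \<E> X L\<^esub> push \<C> \<E> X (g \<circ>\<^bsub>\<C>\<^esub> i') \<sigma>'"
      using push_Comp[OF b(1) g(1) \<sigma>(1)] push_Comp[OF b(2) g(1) \<sigma>(2)] push_add[OF g(1) pe] g(3) by simp
    ultimately show "\<omega> \<in> sums X Y L \<tau> [(M, pull \<C> F i Y \<tau>0, \<sigma>), (N, pull \<C> F i' Y \<tau>0, \<sigma>')]"
      unfolding two by blast
  qed (use \<tau>0 \<theta> o in \<open>simp add: K.formal_simps\<close>)
  show "refines X Y [(M, pull \<C> F i Y \<tau>0, \<sigma>), (N, pull \<C> F i' Y \<tau>0, \<sigma>')]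
    [(P, \<tau>0, push \<C> \<E> X i \<sigma> \<oplus>\<^bsub>Val \<E> X P\<^esub> push \<C> \<E> X i' \<sigma>')]"
  proof (rule refinesI_Id[OF _ o(1,2)])
    fix L \<tau> \<omega> assume \<tau>: "\<tau> \<in> elts \<C> F L Y"
      and "\<omega> \<in> sums X Y L \<tau> [(M, pull \<C> F i Y \<tau>0, \<sigma>), (N, pull \<C> F i' Y \<tau>0, \<sigma>')]"
    then obtain g g' where g: "g \<in> homs \<C> M L" "g' \<in> homs \<C> N L" "pull \<C> F g Y \<tau> = pull \<C> F i Y \<tau>0"
        "pull \<C> F g' Y \<tau> = pull \<C> F i' Y \<tau>0" "\<omega> = push \<C> \<E> X g \<sigma> \<oplus>\<^bsub>Val \<E> X L\<^esub> push \<C> \<E> X g' \<sigma>'"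
      unfolding two by blast
    let ?g = "(g \<circ>\<^bsub>\<C>\<^esub> p) \<oplus>\<^bsub>Hom \<C> P L\<^esub> (g' \<circ>\<^bsub>\<C>\<^esub> p')"
    have gp: "g \<circ>\<^bsub>\<C>\<^esub> p \<in> homs \<C> P L" "g' \<circ>\<^bsub>\<C>\<^esub> p' \<in> homs \<C> P L" and gg: "?g \<in> homs \<C> P L" using g b by blast+
    have ip: "i \<circ>\<^bsub>\<C>\<^esub> p \<in> homs \<C> P P" "i' \<circ>\<^bsub>\<C>\<^esub> p' \<in> homs \<C> P P" using b by blast+
    have "pull \<C> F ?g Y \<tau> = pull \<C> F p Y (pull \<C> F i Y \<tau>0) \<oplus>\<^bsub>Val F P Y\<^esub> pull \<C> F p' Y (pull \<C> F i' Y \<tau>0)"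
      using F.pull_add_arr[OF gp \<tau>] F.pull_Comp[OF g(1) b(3) \<tau>] F.pull_Comp[OF g(2) b(4) \<tau>] g(3,4) by simp
    also have "\<dots> = \<tau>0"
      using F.pull_add_arr[OF ip \<tau>0] F.pull_Comp[OF b(1,3) \<tau>0] F.pull_Comp[OF b(2,4) \<tau>0] b(9) F.pull_Id[OF \<tau>0]
      by simp
    finally have 1: "pull \<C> F ?g Y \<tau> = \<tau>0" .
    have oL: "L \<in> Obj \<C>" "M \<in> Obj \<C>" "N \<in> Obj \<C>" using g by (auto simp: homs_iff)
    interpret HM: abelian_group "Hom \<C> M L" using oL by (simp add: homs_group)
    interpret HN: abelian_group "Hom \<C> N L" using oL by (simp add: homs_group)
    have "?g \<circ>\<^bsub>\<C>\<^esub> i = g" "?g \<circ>\<^bsub>\<C>\<^esub> i' = g'"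
      using Comp_distrib_left[OF b(1) gp] Comp_distrib_left[OF b(2) gp] Comp_assoc'[OF b(1,3) g(1)]
        Comp_assoc'[OF b(1,4) g(2)] Comp_assoc'[OF b(2,3) g(1)] Comp_assoc'[OF b(2,4) g(2)] b(5-8)
        Comp_Id_right[OF g(1)] Comp_Id_right[OF g(2)] Comp_zero_right[OF g(1) oL(3)]
        Comp_zero_right[OF g(2) oL(2)] g(1,2) by (simp_all add: homs_iff)
    then have "push \<C> \<E> X ?g (push \<C> \<E> X i \<sigma> \<oplus>\<^bsub>Val \<E> X P\<^esub> push \<C> \<E> X i' \<sigma>') = \<omega>"
      using push_add[OF gg pe] push_Comp[OF b(1) gg \<sigma>(1)] push_Comp[OF b(2) gg \<sigma>(2)] g(5) by simp
    then show "\<omega> \<in> sums X Y L \<tau> [(P, \<tau>0, push \<C> \<E> X i \<sigma> \<oplus>\<^bsub>Val \<E> X P\<^esub> push \<C> \<E> X i' \<sigma>')]"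
      unfolding sums_single[OF \<theta>] using gg 1 by blast
  qed (use fe \<sigma> o in \<open>simp add: K.formal_simps\<close>)
qed

text \<open>The remaining relations reduce to dinaturality: for the zero morphism, for the diagonal \<open>M \<rightarrow> M \<oplus> M\<close> and the
  codiagonal \<open>M \<oplus> M \<rightarrow> M\<close> in the two additivity relations, and for multiplication by \<open>r\<close> on \<open>M\<close>.\<close>

lemma rel_imp_equirefines:
  assumes ex: "half_exact T (functor_to \<C> F Y)" and o: "X \<in> Obj \<C>" "Y \<in> Obj \<C>"
    and "K.rel X Y k l"
  shows "equirefines X Y k l"
  using assms(4)
proof (induction rule: coend_rel.induct)
  case (refl k)
  then show ?case using refinesI_Id[OF _ o] by blast
next
  case (sym k l)
  then show ?case by blast
next
  case (trans k l m)
  then show ?case using refines_trans[OF _ _ o] K.rel_formal[OF _ o] by blast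
next
  case (append k k' l l')
  then show ?case using refines_append[OF _ _ o] K.rel_formal[OF _ o] by blast
next
  case (commute k l)
  then show ?case using refines_commute[OF o] by blast
next
  case (zero M \<sigma>)
  have \<sigma>: "\<sigma> \<in> elts \<C> \<E> X M" and z: "\<zero>\<^bsub>Val F M Y\<^esub> \<in> elts \<C> F M Y" "\<zero>\<^bsub>Val \<E> X M\<^esub> \<in> elts \<C> \<E> X M"
    and zh: "\<zero>\<^bsub>Hom \<C> M M\<^esub> \<in> homs \<C> M M"
    using zero o by (auto simp: elts_iff dest: F.zero_elts zero_elts)
  have 1: "equirefines X Y [(M, \<zero>\<^bsub>Val F M Y\<^esub>, \<sigma>)] [(M, \<zero>\<^bsub>Val F M Y\<^esub>, \<zero>\<^bsub>Val \<E> X M\<^esub>)]"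
    using refines_dinatural[OF ex zh z(1) \<sigma>] F.pull_zero_arr[OF zero(1) z(1)] push_zero_arr[OF zero(1) \<sigma>]
    by simp
  have 2: "\<omega> \<in> sums X Y P \<tau> [(M, \<zero>\<^bsub>Val F M Y\<^esub>, \<zero>\<^bsub>Val \<E> X M\<^esub>)] \<longleftrightarrow> \<omega> \<in> sums X Y P \<tau> []"
    if "\<tau> \<in> elts \<C> F P Y" for P \<tau> \<omega>
  proof -
    have P: "P \<in> Obj \<C>" using that by (simp add: elts_iff)
    have "\<zero>\<^bsub>Hom \<C> M P\<^esub> \<in> homs \<C> M P" "pull \<C> F \<zero>\<^bsub>Hom \<C> M P\<^esub> Y \<tau> = \<zero>\<^bsub>Val F M Y\<^esub>"
      using zero_homs[OF zero(1) P] F.pull_zero_arr[OF zero(1) that] .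
    then show ?thesis
      unfolding sums_single[OF z(2)] using push_zero o(1) by auto
  qed
  have "equirefines X Y [(M, \<zero>\<^bsub>Val F M Y\<^esub>, \<zero>\<^bsub>Val \<E> X M\<^esub>)] []"
    using z by (intro conjI refinesI_Id[OF _ o]) (auto simp: 2 K.formal_simps o simp del: push_sums.simps)
  then show ?case
    using 1 refines_trans[OF _ _ o] K.formal_simps[OF o] \<sigma> z by meson
next
  case (add_left M \<rho> \<rho>' \<sigma>)
  have e: "\<rho> \<in> elts \<C> F M Y" "\<rho>' \<in> elts \<C> F M Y" "\<sigma> \<in> elts \<C> \<E> X M"
    using add_left o by (auto simp: elts_iff)
  obtain P i i' p p' where bp: "biproduct \<C> M M P i i' p p'"
    using has_biproducts add_left(1) by blast
  note b = biproductD[OF bp]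
  let ?\<tau> = "pull \<C> F p Y \<rho> \<oplus>\<^bsub>Val F P Y\<^esub> pull \<C> F p' Y \<rho>'"
  let ?f = "i \<oplus>\<^bsub>Hom \<C> M P\<^esub> i'"
  have \<tau>: "?\<tau> \<in> elts \<C> F P Y" and f: "?f \<in> homs \<C> M P" using b e by blast+
  note c = biproduct_components[OF bp e(1,2)]
  have "equirefines X Y [(M, \<rho> \<oplus>\<^bsub>Val F M Y\<^esub> \<rho>', \<sigma>)] [(P, ?\<tau>, push \<C> \<E> X i \<sigma> \<oplus>\<^bsub>Val \<E> X P\<^esub> push \<C> \<E> X i' \<sigma>)]"
    using refines_dinatural[OF ex f \<tau> e(3)] F.pull_add_arr[OF b(1,2) \<tau>] c push_add_arr[OF b(1,2) e(3)]
    by simp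
  moreover have "equirefines X Y [(P, ?\<tau>, push \<C> \<E> X i \<sigma> \<oplus>\<^bsub>Val \<E> X P\<^esub> push \<C> \<E> X i' \<sigma>)] [(M, \<rho>, \<sigma>), (M, \<rho>', \<sigma>)]"
    using refines_biproduct[OF bp \<tau> e(3,3)] c by simp
  moreover have "[(M, \<rho> \<oplus>\<^bsub>Val F M Y\<^esub> \<rho>', \<sigma>)] \<in> K.formal X Y" "[(M, \<rho>, \<sigma>), (M, \<rho>', \<sigma>)] \<in> K.formal X Y"
    using e F.add_elts[OF e(1,2)] by (simp_all add: K.formal_simps o)
  ultimately show ?case using refines_trans[OF _ _ o] by blast
next
  case (add_right M \<rho> \<sigma> \<sigma>')
  have e: "\<rho> \<in> elts \<C> F M Y" "\<sigma> \<in> elts \<C> \<E> X M" "\<sigma>' \<in> elts \<C> \<E> X M"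
    using add_right o by (auto simp: elts_iff)
  obtain P i i' p p' where bp: "biproduct \<C> M M P i i' p p'"
    using has_biproducts add_right(1) by blast
  note b = biproductD[OF bp]
  interpret MM: abelian_group "Hom \<C> M M" using add_right(1) by (simp add: homs_group)
  let ?f = "p \<oplus>\<^bsub>Hom \<C> P M\<^esub> p'"
  let ?\<theta> = "push \<C> \<E> X i \<sigma> \<oplus>\<^bsub>Val \<E> X P\<^esub> push \<C> \<E> X i' \<sigma>'"
  have f: "?f \<in> homs \<C> P M" and \<theta>: "?\<theta> \<in> elts \<C> \<E> X P"
    and pe: "push \<C> \<E> X i \<sigma> \<in> elts \<C> \<E> X P" "push \<C> \<E> X i' \<sigma>' \<in> elts \<C> \<E> X P" using b e by blast+
  have fi: "?f \<circ>\<^bsub>\<C>\<^esub> i = Id \<C> M" "?f \<circ>\<^bsub>\<C>\<^esub> i' = Id \<C> M"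
    using Comp_distrib_left[OF b(1,3,4)] Comp_distrib_left[OF b(2,3,4)] b(5-8) Id_arr[OF add_right(1)]
    by simp_all
  have \<tau>: "pull \<C> F ?f Y \<rho> \<in> elts \<C> F P Y" using f e by blast
  have "pull \<C> F i Y (pull \<C> F ?f Y \<rho>) = \<rho>" "pull \<C> F i' Y (pull \<C> F ?f Y \<rho>) = \<rho>"
    using F.pull_Comp[OF f b(1) e(1)] F.pull_Comp[OF f b(2) e(1)] fi F.pull_Id[OF e(1)] by simp_all
  then have 1: "equirefines X Y [(P, pull \<C> F ?f Y \<rho>, ?\<theta>)] [(M, \<rho>, \<sigma>), (M, \<rho>, \<sigma>')]"
    using refines_biproduct[OF bp \<tau> e(2,3)] by simp
  have "push \<C> \<E> X ?f ?\<theta> = \<sigma> \<oplus>\<^bsub>Val \<E> X M\<^esub> \<sigma>'"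
    using push_add[OF f pe] push_Comp[OF b(1) f e(2)] push_Comp[OF b(2) f e(3)] fi push_Id[OF e(2)] push_Id[OF e(3)]
    by simp
  then have 2: "equirefines X Y [(P, pull \<C> F ?f Y \<rho>, ?\<theta>)] [(M, \<rho>, \<sigma> \<oplus>\<^bsub>Val \<E> X M\<^esub> \<sigma>')]"
    using refines_dinatural[OF ex f e(1) \<theta>] by simp
  have "[(M, \<rho>, \<sigma> \<oplus>\<^bsub>Val \<E> X M\<^esub> \<sigma>')] \<in> K.formal X Y" "[(M, \<rho>, \<sigma>), (M, \<rho>, \<sigma>')] \<in> K.formal X Y"
    using e add_elts[OF e(2,3)] by (simp_all add: K.formal_simps o)
  then show ?case using 1 2 refines_trans[OF _ _ o] by blast
next
  case (smult M r \<rho> \<sigma>)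
  have e: "\<rho> \<in> elts \<C> F M Y" "\<sigma> \<in> elts \<C> \<E> X M"
    using smult o by (auto simp: elts_iff)
  have I: "Id \<C> M \<in> homs \<C> M M" using smult by blast
  have f: "r \<odot>\<^bsub>Hom \<C> M M\<^esub> Id \<C> M \<in> homs \<C> M M" using smult I by blast
  show ?case
    using refines_dinatural[OF ex f e] F.pull_smult_arr[OF I smult(2) e(1)] push_smult_arr[OF I smult(2) e(2)]
      F.pull_Id[OF e(1)] push_Id[OF e(2)] by simp
next
  case (dinatural M N f \<rho> \<sigma>)
  then show ?case using refines_dinatural[OF ex, of f M N \<rho> \<sigma> X] o by (simp add: homs_iff elts_iff)
qed

text \<open>The empty sum is rewritten as \<open>0 \<otimes> 0\<close>; refining this to \<open>\<rho> \<otimes> \<sigma>\<close> yields the witness.\<close>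

theorem tensor_vanishes:
  assumes ex: "half_exact T (functor_to \<C> F Y)"
    and e: "\<rho> \<in> elts \<C> F M Y" "\<sigma> \<in> elts \<C> \<E> X M" and r: "K.rel X Y [(M, \<rho>, \<sigma>)] []"
  obtains N f \<tau> where "f \<in> homs \<C> M N" "\<tau> \<in> elts \<C> F N Y" "\<rho> = pull \<C> F f Y \<tau>"
    "push \<C> \<E> X f \<sigma> = \<zero>\<^bsub>Val \<E> X N\<^esub>"
proof -
  have o: "X \<in> Obj \<C>" "Y \<in> Obj \<C>" using e by (auto simp: elts_iff)
  have "refines X Y [] [(M, \<rho>, \<sigma>)]"
    using rel_imp_equirefines[OF ex o r] by blast
  moreover have "\<zero>\<^bsub>Val \<E> X X\<^esub> \<in> sums X Y X \<zero>\<^bsub>Val F X Y\<^esub> []" "\<zero>\<^bsub>Val F X Y\<^esub> \<in> elts \<C> F X Y"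
    using o by auto
  ultimately obtain P \<tau> h where h: "h \<in> homs \<C> X P" "\<tau> \<in> elts \<C> F P Y"
      "push \<C> \<E> X h \<zero>\<^bsub>Val \<E> X X\<^esub> \<in> sums X Y P \<tau> [(M, \<rho>, \<sigma>)]"
    unfolding refines_def by blast
  then show thesis
    using that push_zero[OF h(1) o(1)] unfolding sums_single[OF e(2)] by metis
qed

end

section \<open>Bilinearity of the positive extensions\<close>

lemma transport_simps [simp]:
  "carrier (Val (transport emb prj F) X Y) = emb ` carrier (Val F X Y)"
  "\<zero>\<^bsub>Val (transport emb prj F) X Y\<^esub> = emb \<zero>\<^bsub>Val F X Y\<^esub>"
  "u \<oplus>\<^bsub>Val (transport emb prj F) X Y\<^esub> v = emb (prj u \<oplus>\<^bsub>Val F X Y\<^esub> prj v)"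
  "r \<odot>\<^bsub>Val (transport emb prj F) X Y\<^esub> u = emb (r \<odot>\<^bsub>Val F X Y\<^esub> prj u)"
  "Act (transport emb prj F) c a u = emb (Act F c a (prj u))"
  "pull \<C> (transport emb prj F) c Y u = emb (pull \<C> F c Y (prj u))"
  "push \<C> (transport emb prj F) X a u = emb (push \<C> F X a (prj u))"
  by (simp_all add: transport_def pull_def push_def)

lemma transport_elts [simp]: "elts \<C> (transport emb prj F) X Y = emb ` elts \<C> F X Y"
  by (auto simp: elts_iff)

lemma (in bilinear_functor) transport_module:
  assumes inv: "\<And>u. prj (emb u) = u" and o: "X \<in> Obj \<C>" "Y \<in> Obj \<C>"
  shows "module R (Val (transport emb prj \<E>) X Y)"
proof -
  interpret V: module R "Val \<E> X Y" using o by (simp add: Val_module)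
  show ?thesis
  proof (rule moduleI)
    show "abelian_group (Val (transport emb prj \<E>) X Y)"
    proof (rule abelian_groupI, goal_cases)
      case (6 x)
      then obtain u where "u \<in> carrier (Val \<E> X Y)" "x = emb u" by auto
      then show ?case
        by (intro bexI[of _ "emb (\<ominus>\<^bsub>Val \<E> X Y\<^esub> u)"]) (simp_all add: inv V.M.l_neg)
    qed (auto simp: inv V.a_assoc V.a_comm V.a_lcomm)
  qed (auto simp: inv V.smult_l_distr V.smult_r_distr V.smult_assoc1 is_cring)
qed

lemma (in bilinear_functor) transport_bilinear:
  assumes inv: "\<And>u. prj (emb u) = u"
  shows "bilinear_functor R \<C> (transport emb prj \<E>)"
proof (intro bilinear_functor.intro bilinear_functor_axioms.intro linear_category_axioms, goal_cases)
  case (2 C C' A A' c a)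
  then show ?case using Act_linear[OF 2] by (auto simp: linear_map_def inv)
next
  case (4 C C' C'' A A' A'' c c' a a' \<delta>)
  then obtain u where "u \<in> carrier (Val \<E> C A)" "\<delta> = emb u" by auto
  then show ?case using Act_Comp[of C C' C'' A A' A'' c c' a a' u] 4 by (simp add: inv)
next
  case (5 C C' A A' c d a \<delta>)
  then obtain u where "u \<in> carrier (Val \<E> C A)" "\<delta> = emb u" by auto
  then show ?case using Act_add_left[of C C' A A' c d a u] 5 by (simp add: inv)
next
  case (6 C C' A A' c a b \<delta>)
  then obtain u where "u \<in> carrier (Val \<E> C A)" "\<delta> = emb u" by auto
  then show ?case using Act_add_right[of C C' A A' c a b u] 6 by (simp add: inv)
next
  case (7 C C' A A' r c a \<delta>)
  then obtain u where "u \<in> carrier (Val \<E> C A)" "\<delta> = emb u" by auto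
  then show ?case using Act_smult_left[of C C' A A' r c a u] 7 by (simp add: inv)
next
  case (8 C C' A A' r c a \<delta>)
  then obtain u where "u \<in> carrier (Val \<E> C A)" "\<delta> = emb u" by auto
  then show ?case using Act_smult_right[of C C' A A' r c a u] 8 by (simp add: inv)
next
  case (3 C A \<delta>)
  then show ?case by (auto simp: inv Act_Id)
next
  case (1 C A)
  then show ?case by (intro transport_module inv)
qed

lemma (in linear_category) hom_bilinear: "bilinear_functor R \<C> (hom_bifunctor \<C>)"
proof (intro bilinear_functor.intro bilinear_functor_axioms.intro linear_category_axioms, goal_cases)
  case (1 X Y)
  then show ?case by (simp add: hom_bifunctor_def Hom_module)
next
  case (2 X X' Y Y' c a)
  then have h: "c \<in> homs \<C> X' X" "a \<in> homs \<C> Y Y'" by (simp_all add: homs_iff)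
  have e: "f \<in> homs \<C> X Y" "a \<circ>\<^bsub>\<C>\<^esub> f \<in> homs \<C> X Y'" if "f \<in> carrier (Hom \<C> X Y)" for f
    using that 2 h(2) Comp_homs[of f X Y a Y'] by (simp_all add: homs_iff)
  have "a \<circ>\<^bsub>\<C>\<^esub> f \<circ>\<^bsub>\<C>\<^esub> c \<in> carrier (Hom \<C> X' Y')" if "f \<in> carrier (Hom \<C> X Y)" for f
    using Comp_homs[OF h(1) e(2)[OF that]] by (simp add: homs_iff)
  moreover have "a \<circ>\<^bsub>\<C>\<^esub> (f \<oplus>\<^bsub>Hom \<C> X Y\<^esub> g) \<circ>\<^bsub>\<C>\<^esub> c = (a \<circ>\<^bsub>\<C>\<^esub> f \<circ>\<^bsub>\<C>\<^esub> c) \<oplus>\<^bsub>Hom \<C> X' Y'\<^esub> (a \<circ>\<^bsub>\<C>\<^esub> g \<circ>\<^bsub>\<C>\<^esub> c)"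
    if "f \<in> carrier (Hom \<C> X Y)" "g \<in> carrier (Hom \<C> X Y)" for f g
    using Comp_distrib_right[OF e(1)[OF that(1)] e(1)[OF that(2)] h(2)]
      Comp_distrib_left[OF h(1) e(2)[OF that(1)] e(2)[OF that(2)]] by simp
  moreover have "a \<circ>\<^bsub>\<C>\<^esub> (r \<odot>\<^bsub>Hom \<C> X Y\<^esub> f) \<circ>\<^bsub>\<C>\<^esub> c = r \<odot>\<^bsub>Hom \<C> X' Y'\<^esub> (a \<circ>\<^bsub>\<C>\<^esub> f \<circ>\<^bsub>\<C>\<^esub> c)"
    if "r \<in> carrier R" "f \<in> carrier (Hom \<C> X Y)" for r f
    using Comp_smult_right[of X Y Y' r f a] Comp_smult_left[of X' X Y' r c "a \<circ>\<^bsub>\<C>\<^esub> f"] e(2)[OF that(2)] that 2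
    by (simp add: homs_iff)
  ultimately show ?case
    by (simp add: hom_bifunctor_def linear_map_def)
next
  case (3 X Y f)
  then show ?case using Comp_Id[of X Y f] by (simp add: hom_bifunctor_def)
next
  case (4 X X' X'' Y Y' Y'' c c' a a' f)
  then have h: "c \<in> homs \<C> X' X" "c' \<in> homs \<C> X'' X'" "a \<in> homs \<C> Y Y'" "a' \<in> homs \<C> Y' Y''" "f \<in> homs \<C> X Y"
    by (simp_all add: homs_iff hom_bifunctor_def)
  have af: "a \<circ>\<^bsub>\<C>\<^esub> f \<in> homs \<C> X Y'" and afc: "a \<circ>\<^bsub>\<C>\<^esub> f \<circ>\<^bsub>\<C>\<^esub> c \<in> homs \<C> X' Y'"
    using h by blast+
  have "a' \<circ>\<^bsub>\<C>\<^esub> a \<circ>\<^bsub>\<C>\<^esub> f \<circ>\<^bsub>\<C>\<^esub> (c \<circ>\<^bsub>\<C>\<^esub> c') = a' \<circ>\<^bsub>\<C>\<^esub> (a \<circ>\<^bsub>\<C>\<^esub> f) \<circ>\<^bsub>\<C>\<^esub> (c \<circ>\<^bsub>\<C>\<^esub> c')"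
    using Comp_assoc'[OF h(5,3,4)] by simp
  also have "\<dots> = a' \<circ>\<^bsub>\<C>\<^esub> (a \<circ>\<^bsub>\<C>\<^esub> f) \<circ>\<^bsub>\<C>\<^esub> c \<circ>\<^bsub>\<C>\<^esub> c'"
    using Comp_assoc'[OF h(2,1) Comp_homs[OF af h(4)]] by simp
  also have "\<dots> = a' \<circ>\<^bsub>\<C>\<^esub> (a \<circ>\<^bsub>\<C>\<^esub> f \<circ>\<^bsub>\<C>\<^esub> c) \<circ>\<^bsub>\<C>\<^esub> c'"
    using Comp_assoc'[OF h(1) af h(4)] by simp
  finally have "a' \<circ>\<^bsub>\<C>\<^esub> a \<circ>\<^bsub>\<C>\<^esub> f \<circ>\<^bsub>\<C>\<^esub> (c \<circ>\<^bsub>\<C>\<^esub> c') = a' \<circ>\<^bsub>\<C>\<^esub> (a \<circ>\<^bsub>\<C>\<^esub> f \<circ>\<^bsub>\<C>\<^esub> c) \<circ>\<^bsub>\<C>\<^esub> c'" .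
  then show ?case by (simp add: hom_bifunctor_def)
next
  case (5 X X' Y Y' c d a f)
  then show ?case
    using Comp_arr[of X Y Y' f a] by (simp add: hom_bifunctor_def Comp_add_right[of X' X Y'])
next
  case (6 X X' Y Y' c a b f)
  then show ?case
    using Comp_arr[of X Y Y' f a] Comp_arr[of X Y Y' f b]
    by (simp add: hom_bifunctor_def Comp_add_left[of X Y Y'] Comp_add_left[of X' X Y'])
next
  case (7 X X' Y Y' r c a f)
  then show ?case
    using Comp_arr[of X Y Y' f a] by (simp add: hom_bifunctor_def Comp_smult_right[of X' X Y'])
next
  case (8 X X' Y Y' r c a f)
  then show ?case
    using Comp_arr[of X Y Y' f a]
    by (simp add: hom_bifunctor_def Comp_smult_left[of X Y Y'] Comp_smult_left[of X' X Y'])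
qed

lemma (in bilinear_functor) pos_ext_bilinear: "bilinear_functor R \<C> (pos_ext R \<C> \<E> n)"
proof (induction n rule: less_induct)
  case (less n)
  consider "n = 0" | "n = Suc 0" | m where "n = Suc (Suc m)"
    by (metis not0_implies_Suc)
  then show ?case
  proof cases
    case 1
    then show ?thesis
      using bilinear_functor.transport_bilinear[OF hom_bilinear, of un_Mor Mor] by simp
  next
    case 2
    then show ?thesis using transport_bilinear[of un_Ext Ext] by simp
  next
    case (3 m)
    have "coend_pair R \<C> (pos_ext R \<C> \<E> (Suc m)) \<E>"
      using less[of "Suc m"] 3 bilinear_functor_axioms by (simp add: coend_pair_def)
    then show ?thesis
      using bilinear_functor.transport_bilinear[OF coend_pair.coend_bilinear, of R \<C> _ \<E> un_Ten Ten] 3 by simp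
  qed
qed

lemma Mod_morphism_transport:
  assumes "Mod_morphism R \<C> (functor_to \<C> F Y) (functor_to \<C> F' Y') \<phi>"
    and "bilinear_functor R \<C> F" "bilinear_functor R \<C> F'" "Y \<in> Obj \<C>" "Y' \<in> Obj \<C>"
    and "\<And>u. prj (emb u) = u" "\<And>u. prj' (emb' u) = u"
  shows "Mod_morphism R \<C> (functor_to \<C> (transport emb prj F) Y) (functor_to \<C> (transport emb' prj' F') Y')
    (\<lambda>X u. emb' (\<phi> X (prj u)))"
  using assms bilinear_functor.functor_to_Mod[OF bilinear_functor.transport_bilinear, of R \<C> F prj emb Y]
    bilinear_functor.functor_to_Mod[OF bilinear_functor.transport_bilinear, of R \<C> F' prj' emb' Y']
  by (auto simp: Mod_morphism_def linear_map_def Pi_iff intro!: imageI)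

lemma op_bif_transport: "op_bif (transport emb prj F) = transport emb prj (op_bif F)"
  by (simp add: op_bif_def transport_def)

section \<open>Single tensors and induced maps of coends\<close>

context coend_pair
begin

lemma single_formal:
  assumes "\<rho> \<in> elts \<C> F M Y" "\<sigma> \<in> elts \<C> G X M"
  shows "[(M, \<rho>, \<sigma>)] \<in> formal X Y"
proof -
  have "X \<in> Obj \<C>" "Y \<in> Obj \<C>" using assms by (auto simp: elts_iff)
  then show ?thesis using assms by (simp add: formal_simps)
qed

lemma single_elts:
  assumes "\<rho> \<in> elts \<C> F M Y" "\<sigma> \<in> elts \<C> G X M"
  shows "cls X Y [(M, \<rho>, \<sigma>)] \<in> elts \<C> K X Y"
  using single_formal[OF assms] assms by (auto simp: elts_iff coend_carrier)

lemma pull_single: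
  assumes "\<rho> \<in> elts \<C> F M Y" "\<sigma> \<in> elts \<C> G X M" "c \<in> homs \<C> X' X"
  shows "pull \<C> K c Y (cls X Y [(M, \<rho>, \<sigma>)]) = cls X' Y [(M, \<rho>, pull \<C> G c M \<sigma>)]"
proof -
  have "Id \<C> Y \<in> homs \<C> Y Y" using assms by (auto simp: elts_iff)
  then show ?thesis
    using coend_Act[OF single_formal[OF assms(1,2)] assms(3)] F.push_Id[OF assms(1)] by (simp add: pull_def act_def)
qed

lemma push_single:
  assumes "\<rho> \<in> elts \<C> F M Y" "\<sigma> \<in> elts \<C> G X M" "a \<in> homs \<C> Y Y'"
  shows "push \<C> K X a (cls X Y [(M, \<rho>, \<sigma>)]) = cls X Y' [(M, push \<C> F M a \<rho>, \<sigma>)]"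
proof -
  have "Id \<C> X \<in> homs \<C> X X" using assms by (auto simp: elts_iff)
  then show ?thesis
    using coend_Act[OF single_formal[OF assms(1,2)] _ assms(3)] G.pull_Id[OF assms(2)] by (simp add: push_def act_def)
qed

lemma single_dinatural:
  assumes "f \<in> homs \<C> M N" "\<rho> \<in> elts \<C> F N Y" "\<sigma> \<in> elts \<C> G X M"
  shows "cls X Y [(M, pull \<C> F f Y \<rho>, \<sigma>)] = cls X Y [(N, \<rho>, push \<C> G X f \<sigma>)]"
  using assms by (intro cls_eq coend_rel.dinatural) (auto simp: homs_iff elts_iff)

lemma single_zero_right:
  assumes "\<rho> \<in> elts \<C> F M Y" "X \<in> Obj \<C>"
  shows "cls X Y [(M, \<rho>, \<zero>\<^bsub>Val G X M\<^esub>)] = \<zero>\<^bsub>Val K X Y\<^esub>"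
proof -
  have o: "M \<in> Obj \<C>" "Y \<in> Obj \<C>" and z: "\<zero>\<^bsub>Val G X M\<^esub> \<in> elts \<C> G X M"
    using assms G.zero_elts[of X M] by (auto simp: elts_iff)
  have zh: "\<zero>\<^bsub>Hom \<C> M M\<^esub> \<in> homs \<C> M M" using o by blast
  have "cls X Y [(M, \<rho>, \<zero>\<^bsub>Val G X M\<^esub>)] = cls X Y [(M, \<zero>\<^bsub>Val F M Y\<^esub>, \<zero>\<^bsub>Val G X M\<^esub>)]"
    using single_dinatural[OF zh assms(1) z] G.push_zero_arr[OF o(1) z] F.pull_zero_arr[OF o(1) assms(1)] by simp
  also have "\<dots> = cls X Y []"
    using z o assms by (intro cls_eq coend_rel.zero) (auto simp: elts_iff)
  finally show ?thesis by (simp add: coend_zero)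
qed

lemma single_right_Mod_morphism:
  assumes \<rho>: "\<rho> \<in> elts \<C> F M Y"
  shows "Mod_morphism R \<C> (functor_to \<C> G M) (functor_to \<C> K Y) (\<lambda>X \<sigma>. cls X Y [(M, \<rho>, \<sigma>)])"
proof -
  have o: "M \<in> Obj \<C>" "Y \<in> Obj \<C>" using \<rho> by (auto simp: elts_iff)
  have c: "\<sigma> \<in> elts \<C> G X M" if "\<sigma> \<in> carrier (Val G X M)" "X \<in> Obj \<C>" for \<sigma> X
    using that o by (simp add: elts_iff)
  have r: "\<rho> \<in> carrier (Val F M Y)" using \<rho> by (simp add: elts_iff)
  have add: "cls X Y [(M, \<rho>, u \<oplus>\<^bsub>Val G X M\<^esub> v)] = cls X Y [(M, \<rho>, u)] \<oplus>\<^bsub>Val K X Y\<^esub> cls X Y [(M, \<rho>, v)]"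
    if "X \<in> Obj \<C>" "u \<in> carrier (Val G X M)" "v \<in> carrier (Val G X M)" for X u v
    using cls_eq[OF coend_rel.add_right[OF o(1) r that(2,3)] that(1) o(2)]
      coend_add[OF single_formal[OF \<rho> c] single_formal[OF \<rho> c]] that o by simp
  have smult: "cls X Y [(M, \<rho>, s \<odot>\<^bsub>Val G X M\<^esub> v)] = s \<odot>\<^bsub>Val K X Y\<^esub> cls X Y [(M, \<rho>, v)]"
    if "X \<in> Obj \<C>" "s \<in> carrier R" "v \<in> carrier (Val G X M)" for X s v
    using cls_eq[OF coend_rel.smult[OF o(1) that(2) r that(3)] that(1) o(2)]
      coend_smult[OF single_formal[OF \<rho> c] that(2)] that o by (simp add: scale_def)
  show ?thesis
    using G.functor_to_Mod[OF o(1)] bilinear_functor.functor_to_Mod[OF coend_bilinear o(2)]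
      single_elts[OF \<rho> c] pull_single[OF \<rho> c]
    unfolding Mod_morphism_def linear_map_def by (auto simp: add smult elts_iff homs_iff)
qed

lemma single_left_Mod_morphism:
  assumes \<sigma>: "\<sigma> \<in> elts \<C> G X M"
  shows "Mod_morphism R (op_cat \<C>) (functor_from \<C> F M) (functor_from \<C> K X) (\<lambda>Y \<rho>. cls X Y [(M, \<rho>, \<sigma>)])"
proof -
  have o: "M \<in> Obj \<C>" "X \<in> Obj \<C>" using \<sigma> by (auto simp: elts_iff)
  have c: "\<rho> \<in> elts \<C> F M Y" if "\<rho> \<in> carrier (Val F M Y)" "Y \<in> Obj \<C>" for \<rho> Y
    using that o by (simp add: elts_iff)
  have s: "\<sigma> \<in> carrier (Val G X M)" using \<sigma> by (simp add: elts_iff)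
  have add: "cls X Y [(M, u \<oplus>\<^bsub>Val F M Y\<^esub> v, \<sigma>)] = cls X Y [(M, u, \<sigma>)] \<oplus>\<^bsub>Val K X Y\<^esub> cls X Y [(M, v, \<sigma>)]"
    if "Y \<in> Obj \<C>" "u \<in> carrier (Val F M Y)" "v \<in> carrier (Val F M Y)" for Y u v
    using cls_eq[OF coend_rel.add_left[OF o(1) that(2,3) s] o(2) that(1)]
      coend_add[OF single_formal[OF c \<sigma>] single_formal[OF c \<sigma>]] that o by simp
  have smult: "cls X Y [(M, r \<odot>\<^bsub>Val F M Y\<^esub> v, \<sigma>)] = r \<odot>\<^bsub>Val K X Y\<^esub> cls X Y [(M, v, \<sigma>)]"
    if "Y \<in> Obj \<C>" "r \<in> carrier R" "v \<in> carrier (Val F M Y)" for Y r v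
    using coend_smult[OF single_formal[OF c \<sigma>] that(2)] that o by (simp add: scale_def)
  show ?thesis
    using bilinear_functor.functor_to_Mod[OF F.bilinear_functor_op, of M]
      bilinear_functor.functor_to_Mod[OF bilinear_functor.bilinear_functor_op[OF coend_bilinear], of X]
      single_elts[OF c \<sigma>] push_single[OF c \<sigma>] o
    unfolding Mod_morphism_def linear_map_def by (auto simp: add smult elts_iff homs_iff)
qed

end

text \<open>The map of coends induced by a natural transformation of the first argument.\<close>

definition coend_map :: "('r, 'q) ring_scheme \<Rightarrow> ('r, 'o, 'm) lin_cat \<Rightarrow> ('r, 'o, 'm, 'f) bifunctor \<Rightarrow>
    ('r, 'o, 'm, 'g) bifunctor \<Rightarrow> 'o \<Rightarrow> ('o \<Rightarrow> 'h \<Rightarrow> 'f) \<Rightarrow> 'o \<Rightarrow> ('o \<times> 'h \<times> 'g) list \<Rightarrow> ('o \<times> 'f \<times> 'g) list"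
  where "coend_map R \<C> F' G Y' \<phi> X u = coend_class R \<C> F' G X Y' (map (\<lambda>(N, \<mu>, \<kappa>). (N, \<phi> N \<mu>, \<kappa>)) u)"

lemma coend_map_class:
  assumes p: "coend_pair R \<C> F G" "coend_pair R \<C> F' G"
    and o: "X \<in> Obj \<C>" "Y \<in> Obj \<C>" "Y' \<in> Obj \<C>"
    and \<phi>: "Mod_morphism R \<C> (functor_to \<C> F Y) (functor_to \<C> F' Y') \<phi>"
    and k: "k \<in> tensors \<C> F G X Y"
  shows "coend_map R \<C> F' G Y' \<phi> X (coend_class R \<C> F G X Y k) =
      coend_class R \<C> F' G X Y' (map (\<lambda>(N, \<mu>, \<kappa>). (N, \<phi> N \<mu>, \<kappa>)) k)"
    and "map (\<lambda>(N, \<mu>, \<kappa>). (N, \<phi> N \<mu>, \<kappa>)) k \<in> tensors \<C> F' G X Y'"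
proof -
  interpret P: coend_pair R \<C> F G by fact
  interpret P': coend_pair R \<C> F' G by fact
  have r: "P'.rel X Y' (map (\<lambda>(N, \<mu>, \<kappa>). (N, \<phi> N \<mu>, \<kappa>)) k)
      (map (\<lambda>(N, \<mu>, \<kappa>). (N, \<phi> N \<mu>, \<kappa>)) (P.cls X Y k))"
    using coend_rel_map[OF p o(1,2,1,3) \<phi> P.identity_from[OF o(1)] P.rel_cls[OF k]] by simp
  show "map (\<lambda>(N, \<mu>, \<kappa>). (N, \<phi> N \<mu>, \<kappa>)) k \<in> tensors \<C> F' G X Y'"
    using P'.rel_formal[OF r o(1,3)] by blast
  show "coend_map R \<C> F' G Y' \<phi> X (coend_class R \<C> F G X Y k) =
      coend_class R \<C> F' G X Y' (map (\<lambda>(N, \<mu>, \<kappa>). (N, \<phi> N \<mu>, \<kappa>)) k)"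
    unfolding coend_map_def using P'.cls_eq[OF r o(1,3)] by simp
qed

lemma coend_map_Mod_morphism:
  assumes p: "coend_pair R \<C> F G" "coend_pair R \<C> F' G" and o: "Y \<in> Obj \<C>" "Y' \<in> Obj \<C>"
    and \<phi>: "Mod_morphism R \<C> (functor_to \<C> F Y) (functor_to \<C> F' Y') \<phi>"
  shows "Mod_morphism R \<C> (functor_to \<C> (coend R \<C> F G) Y) (functor_to \<C> (coend R \<C> F' G) Y')
    (coend_map R \<C> F' G Y' \<phi>)"
proof -
  interpret P: coend_pair R \<C> F G by fact
  interpret P': coend_pair R \<C> F' G by fact
  let ?m = "map (\<lambda>(N, \<mu>, \<kappa>). (N, \<phi> N \<mu>, \<kappa>))"
  note cm = coend_map_class[OF p _ o \<phi>]
  note f = Mod_morphismD[OF \<phi> o]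
  show ?thesis
    unfolding Mod_morphism_def linear_map_def
  proof (intro conjI ballI bilinear_functor.functor_to_Mod P.coend_bilinear P'.coend_bilinear o, goal_cases)
    case (1 X)
    then show ?case by (auto simp: P.coend_carrier P'.coend_carrier cm)
  next
    case (2 X u v)
    then obtain k l where k: "k \<in> P.formal X Y" "l \<in> P.formal X Y" "u = P.cls X Y k" "v = P.cls X Y l"
      by (auto simp: P.coend_carrier)
    have "k @ l \<in> P.formal X Y" using k 2 o by (simp add: P.formal_simps)
    then show ?case
      using k P.coend_add[OF k(1,2)] P'.coend_add[OF cm(2)[OF 2(1) k(1)] cm(2)[OF 2(1) k(2)]] 2 o cm(1)[OF 2(1)]
      by simp
  next
    case (3 X r u)
    then obtain k where k: "k \<in> P.formal X Y" "u = P.cls X Y k"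
      by (auto simp: P.coend_carrier)
    have k': "\<mu> \<in> elts \<C> F N Y" if "(N, \<mu>, \<kappa>) \<in> set k" for N \<mu> \<kappa>
      using k(1) that o by (auto simp: tensors_def elts_iff)
    have "?m (P.scale Y r k) = P'.scale Y' r (?m k)"
      unfolding P.scale_def P'.scale_def by (auto simp: f(3)[OF 3(2)] dest!: k')
    then show ?case
      using k P.coend_smult[OF k(1) 3(2)] P'.coend_smult[OF cm(2)[OF 3(1) k(1)] 3(2)] 3 o cm(1)[OF 3(1)]
        P.scale_formal[OF k(1) 3(2)] by simp
  next
    case (4 X X' c u)
    then obtain k where k: "k \<in> P.formal X' Y" "u = P.cls X' Y k"
      by (auto simp: P.coend_carrier)
    have c: "c \<in> homs \<C> X X'" using 4 by (simp add: homs_iff)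
    have k': "\<mu> \<in> elts \<C> F N Y" if "(N, \<mu>, \<kappa>) \<in> set k" for N \<mu> \<kappa>
      using k(1) that o by (auto simp: tensors_def elts_iff)
    have I: "Id \<C> Y \<in> homs \<C> Y Y" "Id \<C> Y' \<in> homs \<C> Y' Y'" using o by blast+
    have "?m (P.act X' Y c (Id \<C> Y) k) = P'.act X' Y' c (Id \<C> Y') (?m k)"
      unfolding P.act_def P'.act_def
      by (auto simp: P.F.push_Id P'.F.push_Id f(1) dest!: k')
    then show ?case
      using k P.coend_Act[OF k(1) c I(1)] P'.coend_Act[OF cm(2)[OF 4(2) k(1)] c I(2)] 4 o cm(1)
        P.act_formal[OF k(1) c I(1)] by (simp add: pull_def)
  qed
qed

section \<open>Cup products with a factor of degree one\<close>

context bilinear_functor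
begin

abbreviation "pext n \<equiv> pos_ext R \<C> \<E> n"

abbreviation "cupr n X M Y \<rho> \<kappa> \<equiv> cup R \<C> \<E> X M Y n (Suc 0) \<rho> (Ext \<kappa>)"

abbreviation "cupl n X M Y \<rho> \<sigma> \<equiv> cup R \<C> \<E> X M Y (Suc 0) n (Ext \<rho>) \<sigma>"

lemma pext_pair: "coend_pair R \<C> (pext n) \<E>"
  using pos_ext_bilinear bilinear_functor_axioms by (simp add: coend_pair_def)

lemma pext_0:
  "elts \<C> (pext 0) X Y = Mor ` homs \<C> X Y"
  "X \<in> Obj \<C> \<Longrightarrow> Y \<in> Obj \<C> \<Longrightarrow> carrier (Val (pext 0) X Y) = Mor ` homs \<C> X Y"
  "\<zero>\<^bsub>Val (pext 0) X Y\<^esub> = Mor \<zero>\<^bsub>Hom \<C> X Y\<^esub>"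
  "c \<in> homs \<C> X' X \<Longrightarrow> g \<in> homs \<C> X Y \<Longrightarrow> pull \<C> (pext 0) c Y (Mor g) = Mor (g \<circ>\<^bsub>\<C>\<^esub> c)"
  "a \<in> homs \<C> Y Y' \<Longrightarrow> g \<in> homs \<C> X Y \<Longrightarrow> push \<C> (pext 0) X a (Mor g) = Mor (a \<circ>\<^bsub>\<C>\<^esub> g)"
proof -
  show "elts \<C> (pext 0) X Y = Mor ` homs \<C> X Y"
    by (auto simp: elts_iff homs_iff hom_bifunctor_def)
  show "X \<in> Obj \<C> \<Longrightarrow> Y \<in> Obj \<C> \<Longrightarrow> carrier (Val (pext 0) X Y) = Mor ` homs \<C> X Y"
    by (auto simp: homs_iff hom_bifunctor_def)
  show "\<zero>\<^bsub>Val (pext 0) X Y\<^esub> = Mor \<zero>\<^bsub>Hom \<C> X Y\<^esub>"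
    by (simp add: hom_bifunctor_def)
  show "c \<in> homs \<C> X' X \<Longrightarrow> g \<in> homs \<C> X Y \<Longrightarrow> pull \<C> (pext 0) c Y (Mor g) = Mor (g \<circ>\<^bsub>\<C>\<^esub> c)"
    by (simp add: hom_bifunctor_def pull_def Comp_Id_left)
  show "a \<in> homs \<C> Y Y' \<Longrightarrow> g \<in> homs \<C> X Y \<Longrightarrow> push \<C> (pext 0) X a (Mor g) = Mor (a \<circ>\<^bsub>\<C>\<^esub> g)"
    using Comp_Id_right[OF Comp_homs, of g X Y a Y'] by (simp add: hom_bifunctor_def push_def)
qed

text \<open>The product with a fixed \<open>\<rho>\<close> of degree one is a pullback in degree zero and a single tensor in degree one;
  in higher degrees it is the map of coends induced by the product one degree lower.\<close>

lemma cupl_Mod_morphism: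
  "\<rho> \<in> elts \<C> \<E> M Y \<Longrightarrow> Mod_morphism R \<C> (functor_to \<C> (pext n) M) (functor_to \<C> (pext (Suc n)) Y)
    (\<lambda>X. cupl n X M Y \<rho>)"
proof (induction n rule: less_induct)
  case (less n)
  have o: "M \<in> Obj \<C>" "Y \<in> Obj \<C>" using less.prems by (auto simp: elts_iff)
  consider "n = 0" | "n = Suc 0" | m where "n = Suc (Suc m)"
    by (metis not0_implies_Suc)
  then show ?case
  proof cases
    case 1
    have "Mod_morphism R \<C> (functor_to \<C> (hom_bifunctor \<C>) M) (functor_to \<C> \<E> Y) (\<lambda>X f. pull \<C> \<E> f Y \<rho>)"
      unfolding Mod_morphism_def linear_map_def
    proof (intro conjI ballI bilinear_functor.functor_to_Mod[OF hom_bilinear] functor_to_Mod o, goal_cases)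
      case (1 X)
      then show ?case using pull_elts[OF _ less.prems, of _ X] o by (auto simp: hom_bifunctor_def homs_iff elts_iff)
    next
      case (2 X u v)
      then show ?case using pull_add_arr[OF _ _ less.prems, of u X v] o by (simp add: hom_bifunctor_def homs_iff)
    next
      case (3 X r u)
      then show ?case using pull_smult_arr[OF _ _ less.prems, of u X r] o by (simp add: hom_bifunctor_def homs_iff)
    next
      case (4 X Z c u)
      then have h: "c \<in> homs \<C> X Z" "u \<in> homs \<C> Z M" using o by (simp_all add: hom_bifunctor_def homs_iff)
      have "pull \<C> (hom_bifunctor \<C>) c M u = u \<circ>\<^bsub>\<C>\<^esub> c"
        using Comp_Id_left[OF h(2)] by (simp add: pull_def hom_bifunctor_def)
      then show ?case using pull_Comp[OF h(2,1) less.prems] by simp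
    qed
    then show ?thesis
      using Mod_morphism_transport[OF _ hom_bilinear bilinear_functor_axioms o, of _ un_Mor Mor un_Ext Ext] 1 by simp
  next
    case 2
    interpret P: coend_pair R \<C> "pext (Suc 0)" \<E> by (rule pext_pair)
    have "Ext \<rho> \<in> elts \<C> (pext (Suc 0)) M Y" using less.prems by simp
    from P.single_right_Mod_morphism[OF this] show ?thesis
      using Mod_morphism_transport[OF _ bilinear_functor_axioms P.coend_bilinear o, of _ un_Ext Ext un_Ten Ten] 2
      by simp
  next
    case (3 m)
    have "Mod_morphism R \<C> (functor_to \<C> (pext (Suc m)) M) (functor_to \<C> (pext (Suc (Suc m))) Y) (\<lambda>X. cupl (Suc m) X M Y \<rho>)"
      using less.IH[of "Suc m"] less.prems 3 by simp
    from coend_map_Mod_morphism[OF pext_pair pext_pair o this]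
    have "Mod_morphism R \<C> (functor_to \<C> (pext (Suc (Suc m))) M) (functor_to \<C> (pext (Suc (Suc (Suc m)))) Y)
        (\<lambda>X u. Ten (coend_map R \<C> (pext (Suc (Suc m))) \<E> Y (\<lambda>X. cupl (Suc m) X M Y \<rho>) X (un_Ten u)))"
      using Mod_morphism_transport[OF _ coend_pair.coend_bilinear[OF pext_pair] coend_pair.coend_bilinear[OF pext_pair] o,
          of "Suc m" "Suc (Suc m)" _ un_Ten Ten un_Ten Ten] by simp
    then show ?thesis
      using 3 by (simp add: coend_map_def)
  qed
qed

text \<open>In degree zero this is the dinaturality relation \<open>\<rho> \<otimes> \<mu>\<^sub>*\<kappa> = \<mu>\<^sup>*\<rho> \<otimes> \<kappa>\<close>; in positive degrees it is the recursion
  for the product. As every element of positive degree has the form \<open>\<mu> \<union> \<kappa>\<close>, it serves to prove the properties of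
  \<open>\<rho> \<union> -\<close> by induction on the degree.\<close>

lemma cup_assoc:
  assumes "\<rho> \<in> elts \<C> \<E> M Y" "\<mu> \<in> elts \<C> (pext n) N M" "\<kappa> \<in> elts \<C> \<E> X N"
  shows "cupl (Suc n) X M Y \<rho> (cupr n X N M \<mu> \<kappa>) = cupr (Suc n) X N Y (cupl n N M Y \<rho> \<mu>) \<kappa>"
proof (cases n)
  case 0
  interpret P: coend_pair R \<C> "pext (Suc 0)" \<E> by (rule pext_pair)
  obtain f where f: "f \<in> homs \<C> N M" "\<mu> = Mor f" using assms(2) by (auto simp: 0 pext_0(1) simp del: pos_ext.simps)
  have "Ext \<rho> \<in> elts \<C> (pext (Suc 0)) M Y" using assms by simp
  from P.single_dinatural[OF f(1) this assms(3)] show ?thesis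
    by (simp add: 0 f)
next
  case (Suc m)
  have o: "X \<in> Obj \<C>" "M \<in> Obj \<C>" "Y \<in> Obj \<C>" using assms by (auto simp: elts_iff)
  have "[(N, \<mu>, \<kappa>)] \<in> tensors \<C> (pext (Suc m)) \<E> X M"
    using coend_pair.single_formal[OF pext_pair] assms Suc by simp
  from coend_map_class(1)[OF pext_pair pext_pair o cupl_Mod_morphism[OF assms(1)] this] show ?thesis
    by (simp add: Suc coend_map_def)
qed

lemma cupr_push:
  assumes "\<rho> \<in> elts \<C> (pext n) M Y" "\<kappa> \<in> elts \<C> \<E> X M" "a \<in> homs \<C> Y Y'"
  shows "push \<C> (pext (Suc n)) X a (cupr n X M Y \<rho> \<kappa>) = cupr n X M Y' (push \<C> (pext n) M a \<rho>) \<kappa>"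
proof (cases n)
  case 0
  obtain f where f: "f \<in> homs \<C> M Y" "\<rho> = Mor f" using assms(1) by (auto simp: 0 pext_0(1) simp del: pos_ext.simps)
  have p: "push \<C> (pext 0) M a (Mor f) = Mor (a \<circ>\<^bsub>\<C>\<^esub> f)"
    by (rule pext_0(5)[OF assms(3) f(1)])
  show ?thesis
    using push_Comp[OF f(1) assms(3,2)] by (simp add: 0 f p del: pos_ext.simps(1)) 
next
  case (Suc m)
  then show ?thesis
    using coend_pair.push_single[OF pext_pair, of \<rho> "Suc m" M Y \<kappa> X a Y'] assms by simp
qed

lemma cupr_Mod_morphism:
  assumes \<kappa>: "\<kappa> \<in> elts \<C> \<E> X M"
  shows "Mod_morphism R (op_cat \<C>) (functor_from \<C> (pext n) M) (functor_from \<C> (pext (Suc n)) X)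
    (\<lambda>Y \<rho>. cupr n X M Y \<rho> \<kappa>)"
proof (cases n)
  case 0
  have o: "M \<in> Obj \<C>" "X \<in> Obj \<C>" using \<kappa> by (auto simp: elts_iff)
  interpret op: bilinear_functor R "op_cat \<C>" "op_bif \<E>" by (rule bilinear_functor_op)
  have hb: "bilinear_functor R (op_cat \<C>) (op_bif (hom_bifunctor \<C>))"
    by (rule bilinear_functor.bilinear_functor_op[OF hom_bilinear])
  have "Mod_morphism R (op_cat \<C>) (functor_from \<C> (hom_bifunctor \<C>) M) (functor_from \<C> \<E> X) (\<lambda>Y f. push \<C> \<E> X f \<kappa>)"
    unfolding Mod_morphism_def linear_map_def
  proof (intro conjI ballI bilinear_functor.functor_to_Mod[OF hb] op.functor_to_Mod, goal_cases)
    case (3 Y)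
    then show ?case using push_elts[OF _ \<kappa>, of _ Y] o by (auto simp: hom_bifunctor_def homs_iff elts_iff)
  next
    case (4 Y u v)
    then show ?case using push_add_arr[OF _ _ \<kappa>, of u Y v] o by (simp add: hom_bifunctor_def homs_iff)
  next
    case (5 Y r u)
    then show ?case using push_smult_arr[OF _ _ \<kappa>, of u Y r] o by (simp add: hom_bifunctor_def homs_iff)
  next
    case (6 Y Z c u)
    then have h: "c \<in> homs \<C> Z Y" "u \<in> homs \<C> M Z" using o by (simp_all add: hom_bifunctor_def homs_iff)
    have "push \<C> (hom_bifunctor \<C>) M c u = c \<circ>\<^bsub>\<C>\<^esub> u"
      using Comp_Id_right[OF Comp_homs[OF h(2,1)]] by (simp add: push_def hom_bifunctor_def)
    then show ?case using push_Comp[OF h(2,1) \<kappa>] by simp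
  qed (use o in simp_all)
  then show ?thesis
    using Mod_morphism_transport[OF _ hb op.bilinear_functor_axioms, of M X _ un_Mor Mor un_Ext Ext] 0 o
    by (simp add: op_bif_transport)
next
  case (Suc m)
  interpret P: coend_pair R \<C> "pext (Suc m)" \<E> by (rule pext_pair)
  have o: "M \<in> Obj \<C>" "X \<in> Obj \<C>" using \<kappa> by (auto simp: elts_iff)
  have I: "Mod_morphism R (op_cat \<C>) (functor_from \<C> (coend R \<C> (pext (Suc m)) \<E>) X) 
      (functor_to (op_cat \<C>) (transport Ten un_Ten (op_bif (coend R \<C> (pext (Suc m)) \<E>))) X) (\<lambda>Y u. Ten u)"
    using bilinear_functor.functor_to_Mod[OF bilinear_functor.bilinear_functor_op[OF P.coend_bilinear], of X]
      bilinear_functor.functor_to_Mod[OF bilinear_functor.transport_bilinear[OF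
          bilinear_functor.bilinear_functor_op[OF P.coend_bilinear], of un_Ten Ten], of X] o
    by (auto simp: Mod_morphism_def linear_map_def)
  have "Mod_morphism R (op_cat \<C>) (functor_from \<C> (pext (Suc m)) M)
      (functor_to (op_cat \<C>) (transport Ten un_Ten (op_bif (coend R \<C> (pext (Suc m)) \<E>))) X)
      (\<lambda>Y \<rho>. Ten (P.cls X Y [(M, \<rho>, \<kappa>)]))"
    using P.single_left_Mod_morphism[OF \<kappa>] I
    by (fastforce simp: Mod_morphism_def linear_map_def Pi_iff)
  then show ?thesis
    by (simp add: Suc op_bif_transport)
qed

end

section \<open>Vanishing of cup products\<close>

context triangle_category
begin

text \<open>For \<open>n = 0\<close> a morphism \<open>f\<close> is itself the witness: \<open>f = f\<^sup>*1\<close>. For \<open>n > 0\<close> the induction hypothesis is used only to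
  know that \<open>\<E>\<^sup>n(-,Y)\<close> is half exact.\<close>

lemma cupr_presentation:
  assumes Y: "Y \<in> Obj \<C>"
  shows "cup_presentation R \<C> \<E> T (functor_to \<C> (pext n) Y) (functor_to \<C> (pext (Suc n)) Y)
    (\<lambda>X M \<rho> \<kappa>. cupr n X M Y \<rho> \<kappa>)"
proof (induction n)
  case 0
  have M: "Mod_object R \<C> (functor_to \<C> (pext m) Y)" for m
    by (rule bilinear_functor.functor_to_Mod[OF pos_ext_bilinear Y])
  have mor: "\<exists>f\<in>homs \<C> N Y. \<rho> = Mor f" if "N \<in> Obj \<C>" "\<rho> \<in> carrier (Val (pext 0) N Y)" for N \<rho>
    using that Y pext_0(2) by blast
  show ?case
  proof (intro cup_presentation.intro triangle_category_axioms M cup_presentation_axioms.intro, goal_cases)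
    case (1 \<rho> N \<sigma> X)
    then obtain f where f: "f \<in> homs \<C> N Y" "\<rho> = Mor f"
      using mor[of N \<rho>] by (auto simp: elts_iff simp del: pos_ext.simps)
    then show ?case using push_elts[OF f(1) 1(2)] by (simp add: elts_iff)
  next
    case (2 g M N \<rho> \<sigma> X)
    then obtain f where f: "f \<in> homs \<C> N Y" "\<rho> = Mor f"
      using mor[of N \<rho>] by (auto simp: homs_iff simp del: pos_ext.simps)
    have "pull \<C> (pext 0) g Y \<rho> = Mor (f \<circ>\<^bsub>\<C>\<^esub> g)"
      using pext_0(4)[OF 2(1) f(1)] f(2) by simp
    then show ?case using push_Comp[OF 2(1) f(1) 2(3)] f(2) by (simp del: pos_ext.simps(1))
  next
    case (3 c X' X \<rho> M \<sigma>)
    then obtain f where f: "f \<in> homs \<C> M Y" "\<rho> = Mor f"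
      using mor[of M \<rho>] by (auto simp: elts_iff simp del: pos_ext.simps)
    then show ?case using push_pull[OF 3(1) f(1) 3(3)] by simp
  next
    case (4 X M \<rho>)
    then obtain f where f: "f \<in> homs \<C> M Y" "\<rho> = Mor f"
      using mor[of M \<rho>] by (auto simp del: pos_ext.simps)
    then show ?case using push_zero[OF f(1) 4(1)] by simp
  next
    case (5 X \<omega>)
    then obtain \<delta> where d: "\<delta> \<in> elts \<C> \<E> X Y" "\<omega> = Ext \<delta>" using Y by (auto simp: elts_iff)
    have "Mor (Id \<C> Y) \<in> carrier (Val (pext 0) Y Y)" using pext_0(2)[OF Y Y] Id_homs[OF Y] by blast
    moreover have "\<omega> = cupr 0 X Y Y (Mor (Id \<C> Y)) \<delta>" using d push_Id by simp
    ultimately show ?case using d(1) unfolding functor_to_simps by blast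
  next
    case (6 \<rho> M \<sigma> X)
    then obtain f where f: "f \<in> homs \<C> M Y" "\<rho> = Mor f"
      using mor[of M \<rho>] by (auto simp: elts_iff simp del: pos_ext.simps)
    have "Mor (Id \<C> Y) \<in> carrier (Val (pext 0) Y Y)" using pext_0(2)[OF Y Y] Id_homs[OF Y] by blast
    moreover have "\<rho> = pull \<C> (pext 0) f Y (Mor (Id \<C> Y))"
      using pext_0(4)[OF f(1) Id_homs[OF Y]] Comp_Id_left[OF f(1)] f(2) by simp
    moreover have "push \<C> \<E> X f \<sigma> = \<zero>\<^bsub>Val \<E> X Y\<^esub>" using 6(3) f(2) by simp
    ultimately show ?case using f(1) unfolding functor_to_simps by blast
  qed
next
  case (Suc n)
  interpret P: cup_presentation R \<C> \<E> T "functor_to \<C> (pext n) Y" "functor_to \<C> (pext (Suc n)) Y"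
    "\<lambda>X M \<rho> \<kappa>. cupr n X M Y \<rho> \<kappa>" by (rule Suc)
  interpret D: coend_triangle R \<C> \<E> T "pext (Suc n)"
    by (intro coend_triangle.intro triangle_category_axioms pos_ext_bilinear)
  have M: "Mod_object R \<C> (functor_to \<C> (pext m) Y)" for m
    by (rule bilinear_functor.functor_to_Mod[OF pos_ext_bilinear Y])
  have el: "\<rho> \<in> elts \<C> (pext (Suc n)) N Y" if "\<rho> \<in> carrier (Fib (functor_to \<C> (pext (Suc n)) Y) N)" "N \<in> Obj \<C>" for \<rho> N
    using that Y by (simp add: elts_iff)
  show ?case
  proof (intro cup_presentation.intro triangle_category_axioms M cup_presentation_axioms.intro, goal_cases)
    case (1 \<rho> N \<sigma> X)
    then show ?case using D.K.single_elts[OF el, of \<rho> N \<sigma> X] by (simp add: elts_iff)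
  next
    case (2 g M N \<rho> \<sigma> X)
    then show ?case using D.K.single_dinatural[OF 2(1) el 2(3)] by (simp add: homs_iff)
  next
    case (3 c X' X \<rho> M \<sigma>)
    then show ?case using D.K.pull_single[OF el 3(3,1), of \<rho>] by (simp add: elts_iff)
  next
    case (4 X M \<rho>)
    then show ?case using D.K.single_zero_right[OF el 4(1), of \<rho> M] by simp
  next
    case (5 X \<omega>)
    then obtain k where k: "k \<in> D.K.formal X Y" "\<omega> = Ten (D.K.cls X Y k)"
      by (auto simp: D.K.coend_carrier)
    obtain M \<rho> \<sigma> where s: "\<rho> \<in> elts \<C> (pext (Suc n)) M Y" "\<sigma> \<in> elts \<C> \<E> X M" "D.K.rel X Y k [(M, \<rho>, \<sigma>)]"
      using D.formal_reduces_to_single[OF k(1) 5(1) Y] by blast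
    then have "\<omega> = cupr (Suc n) X M Y \<rho> \<sigma>" using D.K.cls_eq[OF s(3) 5(1) Y] k by simp
    then show ?case using s by (auto simp: elts_iff simp del: cup.simps)
  next
    case (6 \<rho> M \<sigma> X)
    have o: "X \<in> Obj \<C>" "M \<in> Obj \<C>" using 6 by (auto simp: elts_iff)
    have "D.K.cls X Y [(M, \<rho>, \<sigma>)] = D.K.cls X Y []" using 6(3) by (simp add: D.K.coend_zero)
    then have "D.K.rel X Y [(M, \<rho>, \<sigma>)] []"
      using coend_class_eq_iff[OF D.K.single_formal[OF el[OF 6(1) o(2)] 6(2)] D.K.formal_simps(1)[OF o(1) Y], of R]
      by simp
    from D.tensor_vanishes[OF P.half_exact_target el[OF 6(1) o(2)] 6(2) this] show ?case
      by (simp only: functor_to_simps elts_iff) blast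
  qed
qed

lemma cupr_cases:
  assumes "\<omega> \<in> elts \<C> (pext (Suc n)) X Y"
  obtains M \<mu> \<kappa> where "\<mu> \<in> elts \<C> (pext n) M Y" "\<kappa> \<in> elts \<C> \<E> X M" "\<omega> = cupr n X M Y \<mu> \<kappa>"
proof -
  have o: "X \<in> Obj \<C>" "Y \<in> Obj \<C>" "\<omega> \<in> carrier (Val (pext (Suc n)) X Y)" using assms by (auto simp: elts_iff)
  interpret P: cup_presentation R \<C> \<E> T "functor_to \<C> (pext n) Y" "functor_to \<C> (pext (Suc n)) Y"
    "\<lambda>X M \<rho> \<kappa>. cupr n X M Y \<rho> \<kappa>" by (rule cupr_presentation[OF o(2)])
  show thesis
    using P.cp_surj[OF o(1), of \<omega>] o that by (auto simp: elts_iff simp del: cup.simps pos_ext.simps)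
qed

lemma cupr_elts:
  assumes "\<mu> \<in> elts \<C> (pext n) M Y" "\<kappa> \<in> elts \<C> \<E> X M"
  shows "cupr n X M Y \<mu> \<kappa> \<in> elts \<C> (pext (Suc n)) X Y"
proof -
  have o: "X \<in> Obj \<C>" "Y \<in> Obj \<C>" "\<mu> \<in> carrier (Val (pext n) M Y)" using assms by (auto simp: elts_iff)
  interpret P: cup_presentation R \<C> \<E> T "functor_to \<C> (pext n) Y" "functor_to \<C> (pext (Suc n)) Y"
    "\<lambda>X M \<rho> \<kappa>. cupr n X M Y \<rho> \<kappa>" by (rule cupr_presentation[OF o(2)])
  show ?thesis using P.cp_closed[of \<mu> M \<kappa> X] o assms by (simp add: elts_iff)
qed

lemma cupl_elts:
  assumes "\<rho> \<in> elts \<C> \<E> M Y" "\<sigma> \<in> elts \<C> (pext n) X M"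
  shows "cupl n X M Y \<rho> \<sigma> \<in> elts \<C> (pext (Suc n)) X Y"
  using Mod_morphismD(1)[OF cupl_Mod_morphism[OF assms(1)] _ _ assms(2)] assms(1) by (simp add: elts_iff)

lemma cupl_pull:
  assumes "\<rho> \<in> elts \<C> \<E> M Y" "\<sigma> \<in> elts \<C> (pext n) X M" "c \<in> homs \<C> X' X"
  shows "cupl n X' M Y \<rho> (pull \<C> (pext n) c M \<sigma>) = pull \<C> (pext (Suc n)) c Y (cupl n X M Y \<rho> \<sigma>)"
  using Mod_morphismD(4)[OF cupl_Mod_morphism[OF assms(1)] _ _ assms(3,2)] assms(1) by (simp add: elts_iff)

lemma cupl_push:
  "\<rho> \<in> elts \<C> \<E> M Y \<Longrightarrow> \<sigma> \<in> elts \<C> (pext n) X M \<Longrightarrow> a \<in> homs \<C> Y Y'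
    \<Longrightarrow> push \<C> (pext (Suc n)) X a (cupl n X M Y \<rho> \<sigma>) = cupl n X M Y' (push \<C> \<E> M a \<rho>) \<sigma>"
proof (induction n arbitrary: X \<sigma>)
  case 0
  then obtain f where f: "f \<in> homs \<C> X M" "\<sigma> = Mor f" by (auto simp: pext_0(1) simp del: pos_ext.simps)
  then show ?case using push_pull[OF f(1) 0(3,1)] by simp
next
  case (Suc n)
  obtain N \<mu> \<kappa> where \<sigma>: "\<mu> \<in> elts \<C> (pext n) N M" "\<kappa> \<in> elts \<C> \<E> X N" "\<sigma> = cupr n X N M \<mu> \<kappa>"
    using cupr_cases[OF Suc.prems(2)] .
  have a: "push \<C> \<E> M a \<rho> \<in> elts \<C> \<E> M Y'" using Suc.prems by blast
  show ?case
    unfolding \<sigma>(3) cup_assoc[OF Suc.prems(1) \<sigma>(1,2)] cup_assoc[OF a \<sigma>(1,2)]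
      cupr_push[OF cupl_elts[OF Suc.prems(1) \<sigma>(1)] \<sigma>(2) Suc.prems(3)]
      Suc.IH[OF Suc.prems(1) \<sigma>(1) Suc.prems(3)] ..
qed

lemma cupl_dinatural:
  "f \<in> homs \<C> M N \<Longrightarrow> \<rho> \<in> elts \<C> \<E> N Y \<Longrightarrow> \<sigma> \<in> elts \<C> (pext n) X M
    \<Longrightarrow> cupl n X M Y (pull \<C> \<E> f Y \<rho>) \<sigma> = cupl n X N Y \<rho> (push \<C> (pext n) X f \<sigma>)"
proof (induction n arbitrary: X \<sigma>)
  case 0
  then obtain g where g: "g \<in> homs \<C> X M" "\<sigma> = Mor g" by (auto simp: pext_0(1) simp del: pos_ext.simps)
  have "push \<C> (pext 0) X f \<sigma> = Mor (f \<circ>\<^bsub>\<C>\<^esub> g)" using pext_0(5)[OF 0(1) g(1)] g(2) by simp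
  then show ?case using pull_Comp[OF 0(1) g(1) 0(2)] g(2) by (simp del: pos_ext.simps(1))
next
  case (Suc n)
  obtain L \<mu> \<kappa> where \<sigma>: "\<mu> \<in> elts \<C> (pext n) L M" "\<kappa> \<in> elts \<C> \<E> X L" "\<sigma> = cupr n X L M \<mu> \<kappa>"
    using cupr_cases[OF Suc.prems(3)] .
  interpret X: bilinear_functor R \<C> "pext n" by (rule pos_ext_bilinear)
  have a: "pull \<C> \<E> f Y \<rho> \<in> elts \<C> \<E> M Y" and b: "push \<C> (pext n) L f \<mu> \<in> elts \<C> (pext n) L N"
    using Suc.prems \<sigma> by blast+
  show ?case
    unfolding \<sigma>(3) cup_assoc[OF a \<sigma>(1,2)] cupr_push[OF \<sigma>(1,2) Suc.prems(1)]
      cup_assoc[OF Suc.prems(2) b \<sigma>(2)] Suc.IH[OF Suc.prems(1,2) \<sigma>(1)] ..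
qed

lemma cupr_zero_left:
  assumes "\<kappa> \<in> elts \<C> \<E> X M" "Y \<in> Obj \<C>"
  shows "cupr n X M Y \<zero>\<^bsub>Val (pext n) M Y\<^esub> \<kappa> = \<zero>\<^bsub>Val (pext (Suc n)) X Y\<^esub>"
  using Mod_morphismD(5)[OF cupr_Mod_morphism[OF assms(1), of n], of Y] assms by (simp add: elts_iff)

lemma cupl_zero_left:
  "\<sigma> \<in> elts \<C> (pext n) X M \<Longrightarrow> Y \<in> Obj \<C> \<Longrightarrow> cupl n X M Y \<zero>\<^bsub>Val \<E> M Y\<^esub> \<sigma> = \<zero>\<^bsub>Val (pext (Suc n)) X Y\<^esub>"
proof (induction n arbitrary: X \<sigma>)
  case 0
  then obtain f where f: "f \<in> homs \<C> X M" "\<sigma> = Mor f" by (auto simp: pext_0(1) simp del: pos_ext.simps)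
  then show ?case using pull_zero[OF f(1) 0(2)] by simp
next
  case (Suc n)
  obtain L \<mu> \<kappa> where \<sigma>: "\<mu> \<in> elts \<C> (pext n) L M" "\<kappa> \<in> elts \<C> \<E> X L" "\<sigma> = cupr n X L M \<mu> \<kappa>"
    using cupr_cases[OF Suc.prems(1)] .
  have z: "\<zero>\<^bsub>Val \<E> M Y\<^esub> \<in> elts \<C> \<E> M Y"
    using Suc.prems by (intro zero_elts) (simp_all add: elts_iff)
  show ?case
    unfolding \<sigma>(3) cup_assoc[OF z \<sigma>(1,2)] Suc.IH[OF \<sigma>(1) Suc.prems(2)] by (rule cupr_zero_left[OF \<sigma>(2) Suc.prems(2)])
qed

lemma push_biproduct_components:
  assumes bp: "biproduct \<C> M N P i i' p p'" and F: "bilinear_functor R \<C> F"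
    and \<mu>: "\<mu> \<in> elts \<C> F X M" "\<mu>' \<in> elts \<C> F X N"
  shows "push \<C> F X p (push \<C> F X i \<mu> \<oplus>\<^bsub>Val F X P\<^esub> push \<C> F X i' \<mu>') = \<mu>"
    and "push \<C> F X p' (push \<C> F X i \<mu> \<oplus>\<^bsub>Val F X P\<^esub> push \<C> F X i' \<mu>') = \<mu>'"
proof -
  interpret D: coend_triangle R "op_cat \<C>" "op_bif \<E>" "\<lambda>A x B y C. T C y B x A" "op_bif F"
    by (intro coend_triangle.intro triangle_category_op bilinear_functor.bilinear_functor_op F)
  show "push \<C> F X p (push \<C> F X i \<mu> \<oplus>\<^bsub>Val F X P\<^esub> push \<C> F X i' \<mu>') = \<mu>"
    "push \<C> F X p' (push \<C> F X i \<mu> \<oplus>\<^bsub>Val F X P\<^esub> push \<C> F X i' \<mu>') = \<mu>'"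
    using D.biproduct_components[of M N P p p' i i' \<mu> X \<mu>'] assms by simp_all
qed

text \<open>The product \<open>(\<rho> \<union> \<mu>) \<union> \<kappa>\<close> vanishes, so \<open>\<rho> \<union> \<mu> = f\<^sup>*\<tau>\<close> and \<open>f\<^sub>*\<kappa> = 0\<close>. Writing \<open>\<tau> = \<rho>' \<union> \<mu>'\<close> one obtains the
  relation \<open>(\<rho>, \<rho>') \<union> (\<mu>, - f\<^sup>*\<mu>') = 0\<close> over \<open>M \<oplus> M'\<close> in degree \<open>n + 1\<close>. A witness for it has components
  \<open>g\<^sub>1 : W \<rightarrow> M\<close> and \<open>g\<^sub>2 : W \<rightarrow> M'\<close> and an element \<open>\<nu>'\<close> with \<open>g\<^sub>1\<^sub>*\<nu>' = \<mu>\<close>, \<open>g\<^sub>2\<^sub>*\<nu>' = - f\<^sup>*\<mu>'\<close> and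
  \<open>g\<^sub>1\<^sup>*\<rho> + g\<^sub>2\<^sup>*\<rho>' = 0\<close>. Now \<open>g\<^sub>1\<^sub>*(\<nu>' \<union> \<kappa>) = \<mu> \<union> \<kappa>\<close>, while \<open>g\<^sub>2\<^sub>*(\<nu>' \<union> \<kappa>) = - \<mu>' \<union> f\<^sub>*\<kappa> = 0\<close>. By the dual of
  \<open>half_exact_annihilate\<close> the element \<open>\<nu>' \<union> \<kappa>\<close> comes from an object \<open>V\<close> over \<open>W\<close> on which \<open>g\<^sub>2\<^sup>*\<rho>'\<close>, and with it
  \<open>g\<^sub>1\<^sup>*\<rho>\<close>, vanishes.\<close>

lemma cupl_vanishes:
  assumes pres: "\<And>X. X \<in> Obj \<C> \<Longrightarrow> cup_presentation R (op_cat \<C>) (op_bif \<E>) (\<lambda>A x B y C. T C y B x A)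
      (functor_from \<C> (pext n) X) (functor_from \<C> (pext (Suc n)) X) (\<lambda>Y M \<sigma> \<rho>. cupl n X M Y \<rho> \<sigma>)"
    and \<rho>: "\<rho> \<in> elts \<C> \<E> M Y" and \<mu>: "\<mu> \<in> elts \<C> (pext n) N M" and \<kappa>: "\<kappa> \<in> elts \<C> \<E> X N"
    and z: "cupl (Suc n) X M Y \<rho> (cupr n X N M \<mu> \<kappa>) = \<zero>\<^bsub>Val (pext (Suc (Suc n))) X Y\<^esub>"
  shows "\<exists>Q g \<xi>. g \<in> homs \<C> Q M \<and> \<xi> \<in> carrier (Val (pext (Suc n)) X Q) \<and>
    cupr n X N M \<mu> \<kappa> = push \<C> (pext (Suc n)) X g \<xi> \<and> pull \<C> \<E> g Y \<rho> = \<zero>\<^bsub>Val \<E> Q Y\<^esub>"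
proof -
  have o: "M \<in> Obj \<C>" "N \<in> Obj \<C>" "X \<in> Obj \<C>" "Y \<in> Obj \<C>" using \<rho> \<kappa> by (auto simp: elts_iff)
  interpret E: bilinear_functor R \<C> "pext n" by (rule pos_ext_bilinear)
  interpret E1: bilinear_functor R \<C> "pext (Suc n)" by (rule pos_ext_bilinear)
  have \<omega>: "cupl n N M Y \<rho> \<mu> \<in> elts \<C> (pext (Suc n)) N Y" by (rule cupl_elts[OF \<rho> \<mu>])
  interpret P1: cup_presentation R \<C> \<E> T "functor_to \<C> (pext (Suc n)) Y" "functor_to \<C> (pext (Suc (Suc n))) Y"
    "\<lambda>X M \<rho> \<kappa>. cupr (Suc n) X M Y \<rho> \<kappa>" by (rule cupr_presentation[OF o(4)])
  have "cupr (Suc n) X N Y (cupl n N M Y \<rho> \<mu>) \<kappa> = \<zero>\<^bsub>Val (pext (Suc (Suc n))) X Y\<^esub>"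
    using z cup_assoc[OF \<rho> \<mu> \<kappa>] by metis
  then obtain N1 f \<tau> where f: "f \<in> homs \<C> N N1" "\<tau> \<in> carrier (Val (pext (Suc n)) N1 Y)"
      "cupl n N M Y \<rho> \<mu> = pull \<C> (pext (Suc n)) f Y \<tau>" "push \<C> \<E> X f \<kappa> = \<zero>\<^bsub>Val \<E> X N1\<^esub>"
    using P1.cp_null[OF _ \<kappa>, of "cupl n N M Y \<rho> \<mu>"] \<omega>
    by (auto simp: elts_iff simp del: cup.simps pos_ext.simps)
  have oN1: "N1 \<in> Obj \<C>" using f by (simp add: homs_iff)
  interpret Q1: cup_presentation R "op_cat \<C>" "op_bif \<E>" "\<lambda>A x B y C. T C y B x A"
      "functor_from \<C> (pext n) N1" "functor_from \<C> (pext (Suc n)) N1" "\<lambda>Y M \<sigma> \<rho>. cupl n N1 M Y \<rho> \<sigma>"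
    by (rule pres[OF oN1])
  obtain M' \<rho>' \<mu>' where m: "\<rho>' \<in> elts \<C> \<E> M' Y" "\<mu>' \<in> carrier (Val (pext n) N1 M')" "\<tau> = cupl n N1 M' Y \<rho>' \<mu>'"
    using Q1.cp_surj[of Y \<tau>] o(4) f(2) by (auto simp del: cup.simps pos_ext.simps)
  have oM': "M' \<in> Obj \<C>" using m by (simp add: elts_iff)
  have \<mu>': "\<mu>' \<in> elts \<C> (pext n) N1 M'" using m oM' oN1 by (simp add: elts_iff)
  \<comment> \<open>\<open>\<rho> \<union> \<mu> = f\<^sup>*\<tau> = \<rho>' \<union> f\<^sup>*\<mu>'\<close>, so the sum \<open>(\<rho>, \<rho>') \<union> (\<mu>, - f\<^sup>*\<mu>')\<close> over \<open>M \<oplus> M'\<close> vanishes\<close>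
  define \<nu> where "\<nu> = pull \<C> (pext n) f M' \<mu>'"
  have \<nu>: "\<nu> \<in> elts \<C> (pext n) N M'" unfolding \<nu>_def using f \<mu>' by blast
  define \<nu>n where "\<nu>n = \<ominus>\<^bsub>Val (pext n) N M'\<^esub> \<nu>"
  have \<nu>n: "\<nu>n \<in> elts \<C> (pext n) N M'" unfolding \<nu>n_def using \<nu> by blast
  have eq: "cupl n N M Y \<rho> \<mu> = cupl n N M' Y \<rho>' \<nu>"
    unfolding \<nu>_def cupl_pull[OF m(1) \<mu>' f(1)] using f(3) m(3) by simp
  note L = Mod_morphismD[OF cupl_Mod_morphism[OF m(1), of n] oM' o(4)]
  have cancel: "cupl n N M Y \<rho> \<mu> \<oplus>\<^bsub>Val (pext (Suc n)) N Y\<^esub> cupl n N M' Y \<rho>' \<nu>n = \<zero>\<^bsub>Val (pext (Suc n)) N Y\<^esub>"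
    using L(2)[OF \<nu> \<nu>n] L(5)[OF o(2)] E.add_neg_elts[OF \<nu>] eq \<nu>n_def by simp
  obtain S i i' p p' where bp: "biproduct \<C> M M' S i i' p p'"
    using has_biproducts o oM' by blast
  note b = biproductD[OF bp]
  have oS: "S \<in> Obj \<C>" using b by (simp add: homs_iff)
  define \<theta> where "\<theta> = pull \<C> \<E> p Y \<rho> \<oplus>\<^bsub>Val \<E> S Y\<^esub> pull \<C> \<E> p' Y \<rho>'"
  have \<theta>: "\<theta> \<in> elts \<C> \<E> S Y" unfolding \<theta>_def using b \<rho> m by blast
  have im: "push \<C> (pext n) N i \<mu> \<in> elts \<C> (pext n) N S" "push \<C> (pext n) N i' \<nu>n \<in> elts \<C> (pext n) N S"
    using b \<mu> \<nu>n by blast+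
  define \<nu>0 where "\<nu>0 = push \<C> (pext n) N i \<mu> \<oplus>\<^bsub>Val (pext n) N S\<^esub> push \<C> (pext n) N i' \<nu>n"
  have \<nu>0: "\<nu>0 \<in> elts \<C> (pext n) N S" unfolding \<nu>0_def using im by blast
  interpret D: coend_triangle R \<C> \<E> T \<E>
    by (intro coend_triangle.intro triangle_category_axioms bilinear_functor_axioms)
  have "cupl n N S Y \<theta> \<nu>0 = cupl n N M Y (pull \<C> \<E> i Y \<theta>) \<mu> \<oplus>\<^bsub>Val (pext (Suc n)) N Y\<^esub> cupl n N M' Y (pull \<C> \<E> i' Y \<theta>) \<nu>n"
    unfolding \<nu>0_def cupl_dinatural[OF b(1) \<theta> \<mu>] cupl_dinatural[OF b(2) \<theta> \<nu>n]
    by (rule Mod_morphismD(2)[OF cupl_Mod_morphism[OF \<theta>, of n] oS o(4) im])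
  also have "\<dots> = \<zero>\<^bsub>Val (pext (Suc n)) N Y\<^esub>"
    unfolding \<theta>_def D.biproduct_components[OF bp \<rho> m(1)] by (rule cancel)
  finally have z0: "cupl n N S Y \<theta> \<nu>0 = \<zero>\<^bsub>Val (pext (Suc n)) N Y\<^esub>" .
  interpret Q: cup_presentation R "op_cat \<C>" "op_bif \<E>" "\<lambda>A x B y C. T C y B x A"
      "functor_from \<C> (pext n) N" "functor_from \<C> (pext (Suc n)) N" "\<lambda>Y M \<sigma> \<rho>. cupl n N M Y \<rho> \<sigma>"
    by (rule pres[OF o(2)])
  obtain W g \<nu>' where g: "g \<in> homs \<C> W S" "\<nu>' \<in> carrier (Val (pext n) N W)" "\<nu>0 = push \<C> (pext n) N g \<nu>'"
      "pull \<C> \<E> g Y \<theta> = \<zero>\<^bsub>Val \<E> W Y\<^esub>"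
    using Q.cp_null[of \<nu>0 S \<theta> Y] \<nu>0 \<theta> z0 by (auto simp: elts_iff simp del: cup.simps pos_ext.simps)
  have oW: "W \<in> Obj \<C>" using g by (simp add: homs_iff)
  have \<nu>': "\<nu>' \<in> elts \<C> (pext n) N W" using g oW o by (simp add: elts_iff)
  let ?g1 = "p \<circ>\<^bsub>\<C>\<^esub> g" and ?g2 = "p' \<circ>\<^bsub>\<C>\<^esub> g"
  have g12: "?g1 \<in> homs \<C> W M" "?g2 \<in> homs \<C> W M'" using b g by blast+
  have pg: "push \<C> (pext n) N ?g1 \<nu>' = \<mu>" "push \<C> (pext n) N ?g2 \<nu>' = \<nu>n"
    using E.push_Comp[OF g(1) b(3) \<nu>'] E.push_Comp[OF g(1) b(4) \<nu>'] g(3)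
      push_biproduct_components[OF bp pos_ext_bilinear \<mu> \<nu>n] by (simp_all add: \<nu>0_def)
  have e12: "pull \<C> \<E> ?g1 Y \<rho> \<in> elts \<C> \<E> W Y" "pull \<C> \<E> ?g2 Y \<rho>' \<in> elts \<C> \<E> W Y"
    using g12 \<rho> m by blast+
  have "pull \<C> \<E> ?g1 Y \<rho> \<oplus>\<^bsub>Val \<E> W Y\<^esub> pull \<C> \<E> ?g2 Y \<rho>' = \<zero>\<^bsub>Val \<E> W Y\<^esub>"
    using g(4) pull_add[OF g(1) pull_elts[OF b(3) \<rho>] pull_elts[OF b(4) m(1)]]
      pull_Comp[OF b(3) g(1) \<rho>] pull_Comp[OF b(4) g(1) m(1)] by (simp add: \<theta>_def)
  then have neg: "pull \<C> \<E> ?g1 Y \<rho> = \<ominus>\<^bsub>Val \<E> W Y\<^esub> pull \<C> \<E> ?g2 Y \<rho>'"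
    using neg_unique[OF e12] by blast
  define \<omega>0 where "\<omega>0 = cupr n X N W \<nu>' \<kappa>"
  have \<omega>0: "\<omega>0 \<in> elts \<C> (pext (Suc n)) X W" unfolding \<omega>0_def by (rule cupr_elts[OF \<nu>' \<kappa>])
  have pl1: "push \<C> (pext (Suc n)) X ?g1 \<omega>0 = cupr n X N M \<mu> \<kappa>"
    unfolding \<omega>0_def cupr_push[OF \<nu>' \<kappa> g12(1)] pg ..
  interpret P0: cup_presentation R \<C> \<E> T "functor_to \<C> (pext n) M'" "functor_to \<C> (pext (Suc n)) M'"
    "\<lambda>X M \<rho> \<kappa>. cupr n X M M' \<rho> \<kappa>" by (rule cupr_presentation[OF oM'])
  have nm: "\<ominus>\<^bsub>Val (pext n) N1 M'\<^esub> \<mu>' \<in> elts \<C> (pext n) N1 M'" using \<mu>' by blast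
  have "push \<C> (pext (Suc n)) X ?g2 \<omega>0 = cupr n X N M' \<nu>n \<kappa>"
    unfolding \<omega>0_def cupr_push[OF \<nu>' \<kappa> g12(2)] pg ..
  also have "\<dots> = cupr n X N M' (pull \<C> (pext n) f M' (\<ominus>\<^bsub>Val (pext n) N1 M'\<^esub> \<mu>')) \<kappa>"
    unfolding \<nu>n_def \<nu>_def E.pull_neg[OF f(1) \<mu>'] ..
  also have "\<dots> = cupr n X N1 M' (\<ominus>\<^bsub>Val (pext n) N1 M'\<^esub> \<mu>') (push \<C> \<E> X f \<kappa>)"
    using P0.cp_dinatural[OF f(1) _ \<kappa>, of "\<ominus>\<^bsub>Val (pext n) N1 M'\<^esub> \<mu>'"] nm
    by (simp add: elts_iff del: cup.simps pos_ext.simps)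
  also have "\<dots> = \<zero>\<^bsub>Val (pext (Suc n)) X M'\<^esub>"
    unfolding f(4) using P0.cp_zero[OF o(3) oN1, of "\<ominus>\<^bsub>Val (pext n) N1 M'\<^esub> \<mu>'"] nm
    by (simp add: elts_iff del: cup.simps pos_ext.simps)
  finally have pl2: "push \<C> (pext (Suc n)) X ?g2 \<omega>0 = \<zero>\<^bsub>Val (pext (Suc n)) X M'\<^esub>" .
  interpret QX: cup_presentation R "op_cat \<C>" "op_bif \<E>" "\<lambda>A x B y C. T C y B x A"
      "functor_from \<C> (pext n) X" "functor_from \<C> (pext (Suc n)) X" "\<lambda>Y M \<sigma> \<rho>. cupl n X M Y \<rho> \<sigma>"
    by (rule pres[OF o(3)])
  have "?g2 \<in> homs (op_cat \<C>) M' W" "\<omega>0 \<in> carrier (Fib (functor_from \<C> (pext (Suc n)) X) W)"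
    "Trans (functor_from \<C> (pext (Suc n)) X) ?g2 \<omega>0 = \<zero>\<^bsub>Fib (functor_from \<C> (pext (Suc n)) X) M'\<^esub>"
    "\<rho>' \<in> elts (op_cat \<C>) (op_bif \<E>) Y M'"
    using g12 \<omega>0 pl2 m(1) by (simp_all add: elts_iff del: pos_ext.simps)
  from triangle_category.half_exact_annihilate[OF triangle_category_op QX.F'.Mod_object_axioms QX.half_exact_target this]
  obtain V h \<omega>1 where h: "h \<in> homs \<C> V W" "\<omega>1 \<in> carrier (Val (pext (Suc n)) X V)"
      "push \<C> (pext (Suc n)) X h \<omega>1 = \<omega>0" "pull \<C> \<E> h Y (pull \<C> \<E> ?g2 Y \<rho>') = \<zero>\<^bsub>Val \<E> V Y\<^esub>"
    by (simp del: pos_ext.simps) blast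
  have oV: "V \<in> Obj \<C>" using h by (simp add: homs_iff)
  have \<omega>1: "\<omega>1 \<in> elts \<C> (pext (Suc n)) X V" using h oV o by (simp add: elts_iff)
  have "cupr n X N M \<mu> \<kappa> = push \<C> (pext (Suc n)) X (?g1 \<circ>\<^bsub>\<C>\<^esub> h) \<omega>1"
    using E1.push_Comp[OF h(1) g12(1) \<omega>1] h(3) pl1 by simp
  moreover have "pull \<C> \<E> (?g1 \<circ>\<^bsub>\<C>\<^esub> h) Y \<rho> = \<zero>\<^bsub>Val \<E> V Y\<^esub>"
    using pull_Comp[OF g12(1) h(1) \<rho>] neg pull_neg[OF h(1) e12(2)] h(4) neg_zero_elts[OF oV o(4)] by simp
  moreover have "?g1 \<circ>\<^bsub>\<C>\<^esub> h \<in> homs \<C> V M" using g12(1) h(1) by blast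
  ultimately show ?thesis using h(2) by blast
qed

text \<open>In the opposite category the functor is \<open>\<E>\<^sup>n(X,-)\<close> and the extension is the first factor of the product.\<close>

lemma cupl_presentation:
  "X \<in> Obj \<C> \<Longrightarrow> cup_presentation R (op_cat \<C>) (op_bif \<E>) (\<lambda>A x B y C. T C y B x A)
    (functor_from \<C> (pext n) X) (functor_from \<C> (pext (Suc n)) X) (\<lambda>Y M \<sigma> \<rho>. cupl n X M Y \<rho> \<sigma>)"
proof (induction n arbitrary: X)
  case (0 X)
  have M: "Mod_object R (op_cat \<C>) (functor_from \<C> (pext m) X)" for m
    using bilinear_functor.functor_to_Mod[OF bilinear_functor.bilinear_functor_op[OF pos_ext_bilinear]] 0 by simp
  show ?case
  proof (intro cup_presentation.intro triangle_category_op M cup_presentation_axioms.intro, goal_cases)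
    case (1 \<sigma> M \<rho> Y)
    then show ?case using cupl_elts[of \<rho> M Y \<sigma> 0 X] 0 by (simp add: elts_iff del: pos_ext.simps cup.simps)
  next
    case (2 f M N \<sigma> \<rho> Y)
    then show ?case using cupl_dinatural[of f N M \<rho> Y \<sigma> 0 X] 0 by (simp add: elts_iff homs_iff del: pos_ext.simps cup.simps)
  next
    case (3 a Y' Y \<sigma> M \<rho>)
    then show ?case using cupl_push[of \<rho> M Y \<sigma> 0 X a Y'] 0 by (simp add: elts_iff homs_iff del: pos_ext.simps cup.simps)
  next
    case (4 Y M \<sigma>)
    then show ?case using cupl_zero_left[of \<sigma> 0 X M Y] 0 by (simp add: elts_iff homs_iff del: pos_ext.simps cup.simps)
  next
    case (5 Y \<omega>)
    then obtain \<delta> where d: "\<delta> \<in> elts \<C> \<E> X Y" "\<omega> = Ext \<delta>" using 0 by (auto simp: elts_iff)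
    have "Mor (Id \<C> X) \<in> carrier (Val (pext 0) X X)" using pext_0(2)[OF 0 0] Id_homs[OF 0] by blast
    moreover have "\<omega> = cupl 0 X X Y \<delta> (Mor (Id \<C> X))" using d pull_Id by simp
    ultimately show ?case using d(1) by (simp del: pos_ext.simps cup.simps) blast
  next
    case (6 \<sigma> M \<rho> Y)
    then obtain f where f: "f \<in> homs \<C> X M" "\<sigma> = Mor f"
      using pext_0(2)[of X M] 0 by (auto simp: elts_iff simp del: pos_ext.simps cup.simps)
    have "Mor (Id \<C> X) \<in> carrier (Val (pext 0) X X)" using pext_0(2)[OF 0 0] Id_homs[OF 0] by blast
    moreover have "\<sigma> = push \<C> (pext 0) X f (Mor (Id \<C> X))"
      using pext_0(5)[OF f(1) Id_homs[OF 0]] Comp_Id_right[OF f(1)] f(2) by simp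
    moreover have "pull \<C> \<E> f Y \<rho> = \<zero>\<^bsub>Val \<E> X Y\<^esub>" using 6(3) f(2) by simp
    ultimately show ?case using f(1) by (simp del: pos_ext.simps cup.simps) blast
  qed
next
  case (Suc n X)
  have M: "Mod_object R (op_cat \<C>) (functor_from \<C> (pext m) X)" for m
    using bilinear_functor.functor_to_Mod[OF bilinear_functor.bilinear_functor_op[OF pos_ext_bilinear]] Suc.prems by simp
  show ?case
  proof (intro cup_presentation.intro triangle_category_op M cup_presentation_axioms.intro, goal_cases)
    case (1 \<sigma> M \<rho> Y)
    then show ?case using cupl_elts[of \<rho> M Y \<sigma> "Suc n" X] Suc.prems by (simp add: elts_iff del: pos_ext.simps cup.simps)
  next
    case (2 f M N \<sigma> \<rho> Y)
    then show ?case using cupl_dinatural[of f N M \<rho> Y \<sigma> "Suc n" X] Suc.prems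
      by (simp add: elts_iff homs_iff del: pos_ext.simps cup.simps)
  next
    case (3 a Y' Y \<sigma> M \<rho>)
    then show ?case using cupl_push[of \<rho> M Y \<sigma> "Suc n" X a Y'] Suc.prems
      by (simp add: elts_iff homs_iff del: pos_ext.simps cup.simps)
  next
    case (4 Y M \<sigma>)
    then show ?case using cupl_zero_left[of \<sigma> "Suc n" X M Y] Suc.prems
      by (simp add: elts_iff homs_iff del: pos_ext.simps cup.simps)
  next
    case (5 Y \<omega>)
    then have "\<omega> \<in> elts \<C> (pext (Suc (Suc n))) X Y" using Suc.prems by (simp add: elts_iff del: pos_ext.simps)
    then obtain N \<tau> \<kappa> where t: "\<tau> \<in> elts \<C> (pext (Suc n)) N Y" "\<kappa> \<in> elts \<C> \<E> X N" "\<omega> = cupr (Suc n) X N Y \<tau> \<kappa>"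
      by (rule cupr_cases)
    have N: "N \<in> Obj \<C>" using t by (simp add: elts_iff)
    interpret Q: cup_presentation R "op_cat \<C>" "op_bif \<E>" "\<lambda>A x B y C. T C y B x A"
      "functor_from \<C> (pext n) N" "functor_from \<C> (pext (Suc n)) N" "\<lambda>Y M \<sigma> \<rho>. cupl n N M Y \<rho> \<sigma>"
      by (rule Suc.IH[OF N])
    obtain M' \<rho> \<mu> where m: "\<rho> \<in> elts \<C> \<E> M' Y" "\<mu> \<in> carrier (Val (pext n) N M')" "\<tau> = cupl n N M' Y \<rho> \<mu>"
      using Q.cp_surj[of Y \<tau>] t(1) by (auto simp: elts_iff simp del: cup.simps pos_ext.simps)
    have \<mu>: "\<mu> \<in> elts \<C> (pext n) N M'" using m N by (simp add: elts_iff)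
    have "\<omega> = cupl (Suc n) X M' Y \<rho> (cupr n X N M' \<mu> \<kappa>)"
      unfolding t(3) m(3) by (rule cup_assoc[OF m(1) \<mu> t(2), symmetric])
    then show ?case
      using m(1) cupr_elts[OF \<mu> t(2)] by (simp del: cup.simps pos_ext.simps) (use elts_iff in fast)
  next
    case (6 \<sigma> M \<rho> Y)
    then have "\<sigma> \<in> elts \<C> (pext (Suc n)) X M" using Suc.prems by (simp add: elts_iff del: pos_ext.simps cup.simps)
    then obtain N \<mu> \<kappa> where s: "\<mu> \<in> elts \<C> (pext n) N M" "\<kappa> \<in> elts \<C> \<E> X N" "\<sigma> = cupr n X N M \<mu> \<kappa>"
      by (rule cupr_cases)
    show ?case
      using cupl_vanishes[OF Suc.IH _ s(1,2), of \<rho> Y] 6(2,3) s(3)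
      by (simp del: cup.simps pos_ext.simps)
  qed
qed

end

section \<open>The long exact sequences\<close>

text \<open>The three exactness statements for a tower of bifunctors each of which is presented by the previous one.
  It is used for the positive extensions and for their opposites.\<close>

lemma (in triangle_category) rows_exact:
  assumes bil: "\<And>n. bilinear_functor R \<C> (F n)"
    and pres: "\<And>n Y. Y \<in> Obj \<C> \<Longrightarrow>
      cup_presentation R \<C> \<E> T (functor_to \<C> (F n) Y) (functor_to \<C> (F (Suc n)) Y) (cp n Y)"
    and half: "\<And>Y. Y \<in> Obj \<C> \<Longrightarrow> half_exact T (functor_to \<C> (F 0) Y)"
    and T: "T A x B y C \<delta>" and Y: "Y \<in> Obj \<C>"
  shows "pull \<C> (F n) y Y ` carrier (Val (F n) C Y) = a_kernel (Val (F n) B Y) (Val (F n) A Y) (pull \<C> (F n) x Y)"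
    and "pull \<C> (F n) x Y ` carrier (Val (F n) B Y) =
      a_kernel (Val (F n) A Y) (Val (F (Suc n)) C Y) (\<lambda>v. cp n Y C A v \<delta>)"
    and "(\<lambda>v. cp n Y C A v \<delta>) ` carrier (Val (F n) A Y) =
      a_kernel (Val (F (Suc n)) C Y) (Val (F (Suc n)) B Y) (pull \<C> (F (Suc n)) y Y)"
proof -
  note c = triangle_closed[OF T]
  have o: "A \<in> Obj \<C>" using c by (auto simp: homs_iff)
  interpret P: cup_presentation R \<C> \<E> T "functor_to \<C> (F n) Y" "functor_to \<C> (F (Suc n)) Y" "cp n Y"
    by (rule pres[OF Y])
  have he: "half_exact T (functor_to \<C> (F n) Y)"
  proof (cases n)
    case 0
    then show ?thesis using half[OF Y] by simp
  next
    case (Suc m)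
    then show ?thesis using cup_presentation.half_exact_target[OF pres[OF Y, of m]] by simp
  qed
  have cl: "pull \<C> (F m) y Y v \<in> carrier (Val (F m) B Y)" if "v \<in> carrier (Val (F m) C Y)" for v m
    using bilinear_functor.pull_elts[OF bil, of y B C v m Y] c that Y by (simp add: elts_iff homs_iff)
  have cl': "pull \<C> (F n) x Y v \<in> carrier (Val (F n) A Y)" if "v \<in> carrier (Val (F n) B Y)" for v
    using bilinear_functor.pull_elts[OF bil, of x A B v n Y] c that Y by (simp add: elts_iff homs_iff)
  have z: "pull \<C> (F n) x Y (pull \<C> (F n) y Y v) = \<zero>\<^bsub>Val (F n) A Y\<^esub>" if "v \<in> carrier (Val (F n) C Y)" for v
    using P.F.Trans_Comp'[of x A B y C v] c that triangle_comp_zero[OF T] P.F.Trans_zero_arr[of v C A] o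
    by (simp add: homs_iff)
  show "pull \<C> (F n) y Y ` carrier (Val (F n) C Y) = a_kernel (Val (F n) B Y) (Val (F n) A Y) (pull \<C> (F n) x Y)"
    using he[unfolded half_exact_def] T cl z unfolding a_kernel_def' functor_to_simps by blast
  show "pull \<C> (F n) x Y ` carrier (Val (F n) B Y) =
      a_kernel (Val (F n) A Y) (Val (F (Suc n)) C Y) (\<lambda>v. cp n Y C A v \<delta>)"
    using P.exact_at_first[OF T] cl' unfolding a_kernel_def' functor_to_simps by blast
  show "(\<lambda>v. cp n Y C A v \<delta>) ` carrier (Val (F n) A Y) =
      a_kernel (Val (F (Suc n)) C Y) (Val (F (Suc n)) B Y) (pull \<C> (F (Suc n)) y Y)"
    using P.exact_at_second[OF T] P.cp_closed[of _ A \<delta> C] c unfolding a_kernel_def' functor_to_simps by blast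
qed

lemma (in triangle_category) hom_half_exact:
  assumes Y: "Y \<in> Obj \<C>"
  shows "half_exact T (functor_to \<C> (pext 0) Y)"
  unfolding half_exact_def
proof (intro allI impI ballI)
  fix A x B y C \<delta> v
  assume T: "T A x B y C \<delta>" and v: "v \<in> carrier (Fib (functor_to \<C> (pext 0) Y) B)"
    and z: "Trans (functor_to \<C> (pext 0) Y) x v = \<zero>\<^bsub>Fib (functor_to \<C> (pext 0) Y) A\<^esub>"
  note c = triangle_closed[OF T]
  have o: "B \<in> Obj \<C>" "C \<in> Obj \<C>" using c by (auto simp: homs_iff)
  obtain g where g: "g \<in> homs \<C> B Y" "v = Mor g"
    using v pext_0(2)[OF o(1) Y] by (auto simp del: pos_ext.simps)
  have "g \<circ>\<^bsub>\<C>\<^esub> x = \<zero>\<^bsub>Hom \<C> A Y\<^esub>"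
    using z pext_0(4)[of x A B g Y] pext_0(3) c g by (simp del: pos_ext.simps)
  then obtain h where h: "h \<in> homs \<C> C Y" "g = h \<circ>\<^bsub>\<C>\<^esub> y"
    using hom_row_middle[OF T g(1)] by blast
  have "Mor h \<in> carrier (Val (pext 0) C Y)" "v = pull \<C> (pext 0) y Y (Mor h)"
    using pext_0(2)[OF o(2) Y] pext_0(4)[of y B C h Y] h g c by auto
  then show "\<exists>w\<in>carrier (Fib (functor_to \<C> (pext 0) Y) C). v = Trans (functor_to \<C> (pext 0) Y) y w"
    unfolding functor_to_simps by blast
qed

lemma (in triangle_category) hom_half_exact_op:
  assumes X: "X \<in> Obj \<C>"
  shows "half_exact (\<lambda>A x B y C. T C y B x A) (functor_from \<C> (pext 0) X)"
  unfolding half_exact_def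
proof (intro allI impI ballI)
  fix A x B y C \<delta> v
  assume T: "T C y B x A \<delta>" and v: "v \<in> carrier (Fib (functor_from \<C> (pext 0) X) B)"
    and z: "Trans (functor_from \<C> (pext 0) X) x v = \<zero>\<^bsub>Fib (functor_from \<C> (pext 0) X) A\<^esub>"
  note c = triangle_closed[OF T]
  have o: "B \<in> Obj \<C>" "C \<in> Obj \<C>" using c by (auto simp: homs_iff)
  obtain g where g: "g \<in> homs \<C> X B" "v = Mor g"
    using v pext_0(2)[OF X o(1)] by (auto simp del: pos_ext.simps)
  have "x \<circ>\<^bsub>\<C>\<^esub> g = \<zero>\<^bsub>Hom \<C> X A\<^esub>"
    using z pext_0(5)[of x B A g X] pext_0(3) c g by (simp del: pos_ext.simps)
  then obtain h where h: "h \<in> homs \<C> X C" "g = y \<circ>\<^bsub>\<C>\<^esub> h"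
    using triangle_category.hom_row_middle[OF triangle_category_op T, of g X] g(1) by auto
  have "Mor h \<in> carrier (Val (pext 0) X C)" "v = push \<C> (pext 0) X y (Mor h)"
    using pext_0(2)[OF X o(2)] pext_0(5)[of y C B h X] h g c by auto
  then show "\<exists>w\<in>carrier (Fib (functor_from \<C> (pext 0) X) C). v = Trans (functor_from \<C> (pext 0) X) y w"
    by (simp del: pos_ext.simps) blast
qed

lemma ext_to_eq: "ext_to R \<C> \<E> Y n = functor_to \<C> (pos_ext R \<C> \<E> n) Y"
  by (simp add: ext_to_def functor_to_def)

lemma ext_from_eq: "ext_from R \<C> \<E> X n = functor_from \<C> (pos_ext R \<C> \<E> n) X"
  by (simp add: ext_from_def functor_to_def)

theorem (in triangle_category) long_exact_sequences:
  assumes T: "T A x B y C \<delta>"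
  shows "long_exact_Mod R \<C>
      (ext_to R \<C> \<E> A) (\<lambda>n X. push \<C> (pext n) X x) (ext_to R \<C> \<E> B) (\<lambda>n X. push \<C> (pext n) X y)
      (ext_to R \<C> \<E> C) (delta_lower_sharp R \<C> \<E> C A \<delta>)"
    and "long_exact_Mod R (op_cat \<C>)
      (ext_from R \<C> \<E> C) (\<lambda>n Y. pull \<C> (pext n) y Y) (ext_from R \<C> \<E> B) (\<lambda>n Y. pull \<C> (pext n) x Y)
      (ext_from R \<C> \<E> A) (delta_upper_sharp R \<C> \<E> C A \<delta>)"
proof -
  note c = triangle_closed[OF T]
  have \<delta>: "\<delta> \<in> elts \<C> \<E> C A" and x: "x \<in> homs \<C> A B" and y: "y \<in> homs \<C> B C" using c by auto
  have dl: "delta_lower_sharp R \<C> \<E> C A \<delta> n = (\<lambda>X. cupl n X C A \<delta>)" for n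
    by (simp add: delta_lower_sharp_def fun_eq_iff del: cup.simps)
  have du: "delta_upper_sharp R \<C> \<E> C A \<delta> n = (\<lambda>Y \<sigma>. cupr n C A Y \<sigma> \<delta>)" for n
    by (simp add: delta_upper_sharp_def fun_eq_iff del: cup.simps)
  have bil: "bilinear_functor R \<C> (pext n)" for n by (rule pos_ext_bilinear)
  note ml = cupl_Mod_morphism[OF \<delta>] and mr = cupr_Mod_morphism[OF \<delta>]
  note px = bilinear_functor.push_Mod_morphism[OF bil x] and py = bilinear_functor.push_Mod_morphism[OF bil y]
  note qx = bilinear_functor.pull_Mod_morphism[OF bil x] and qy = bilinear_functor.pull_Mod_morphism[OF bil y]
  note r = rows_exact[of pext, OF bil cupr_presentation hom_half_exact T]
  note r' = triangle_category.rows_exact[OF triangle_category_op, of "\<lambda>n. op_bif (pext n)",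
      OF bilinear_functor.bilinear_functor_op[OF bil] cupl_presentation hom_half_exact_op T]
  show "long_exact_Mod R (op_cat \<C>)
      (ext_from R \<C> \<E> C) (\<lambda>n Y. pull \<C> (pext n) y Y) (ext_from R \<C> \<E> B) (\<lambda>n Y. pull \<C> (pext n) x Y)
      (ext_from R \<C> \<E> A) (delta_upper_sharp R \<C> \<E> C A \<delta>)"
    unfolding long_exact_Mod_def Mod_exact_def ext_from_eq du
    using qx qy mr r by (simp del: cup.simps pos_ext.simps)
  show "long_exact_Mod R \<C>
      (ext_to R \<C> \<E> A) (\<lambda>n X. push \<C> (pext n) X x) (ext_to R \<C> \<E> B) (\<lambda>n X. push \<C> (pext n) X y)
      (ext_to R \<C> \<E> C) (delta_lower_sharp R \<C> \<E> C A \<delta>)"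
    unfolding long_exact_Mod_def Mod_exact_def ext_to_eq dl
    using px py ml r' by (simp del: cup.simps pos_ext.simps)
qed

lemma (in additive_realization) s_triangle_closed:
  assumes "s_triangle \<C> \<E> \<ss> A x B y C \<delta>"
  shows "x \<in> homs \<C> A B" "y \<in> homs \<C> B C" "\<delta> \<in> elts \<C> \<E> C A"
proof -
  have t: "A \<in> Obj \<C>" "C \<in> Obj \<C>" "\<delta> \<in> carrier (Val \<E> C A)" "(B, x, y) \<in> \<ss> C A \<delta>"
    using assms by (auto simp: s_triangle_def)
  obtain q where "\<ss> C A \<delta> = equivalent_sequences \<C> A C `` {q}"
    using s_class[OF t(2,1,3)] by (auto simp: quotient_def)
  then have "(B, x, y) \<in> sequences \<C> A C"
    using t(4) by (auto simp: equivalent_sequences_def)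
  then show "x \<in> homs \<C> A B" "y \<in> homs \<C> B C" "\<delta> \<in> elts \<C> \<E> C A"
    using t by (auto simp: sequences_def homs_iff elts_iff)
qed

lemma (in additive_realization) s_triangle_exists:
  assumes "\<delta> \<in> elts \<C> \<E> C A"
  shows "\<exists>B x y. s_triangle \<C> \<E> \<ss> A x B y C \<delta>"
proof -
  have t: "A \<in> Obj \<C>" "C \<in> Obj \<C>" "\<delta> \<in> carrier (Val \<E> C A)"
    using assms by (auto simp: elts_iff)
  obtain q where q: "\<ss> C A \<delta> = equivalent_sequences \<C> A C `` {q}" "q \<in> sequences \<C> A C"
    using s_class[OF t(2,1,3)] by (auto simp: quotient_def)
  obtain B x y where b: "q = (B, x, y)" by (cases q)
  have h: "B \<in> Obj \<C>" "x \<in> homs \<C> A B" "y \<in> homs \<C> B C"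
    using q(2) t by (auto simp: sequences_def b homs_iff)
  have "isomorphism \<C> B B (Id \<C> B)"
    using Id_arr[OF h(1)] Comp_Id[OF h(1) h(1) Id_arr[OF h(1)]] by (auto simp: isomorphism_def)
  then have "(q, q) \<in> equivalent_sequences \<C> A C"
    using q(2) Comp_Id_left[OF h(2)] Comp_Id_right[OF h(3)] by (auto simp: equivalent_sequences_def b)
  then show ?thesis
    using t q(1) b by (auto simp: s_triangle_def)
qed

text \<open>Realizations are classes of sequences, so each member of \<open>\<ss> C A \<delta>\<close> counts as a triangle; in particular every
  biproduct decomposition gives one with extension zero.\<close>

lemma (in extriangulated_category) triangle_category: "triangle_category R \<C> \<E> (s_triangle \<C> \<E> \<ss>)"
proof (intro triangle_category.intro triangle_category_axioms.intro additive_linear_category_axioms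
    bilinear_functor_axioms, goal_cases)
  case (1 A x B y C \<delta>)
  then show ?case using s_triangle_closed by blast
next
  case (2 \<delta> C A)
  then show ?case by (rule s_triangle_exists)
next
  case (3 A C P i i' p p')
  then show ?case
    using s_zero[OF 3] zero_elts[of C A] by (auto simp: s_triangle_def biproduct_def elts_iff)
next
  case (4 A x B y C \<delta> A' x' B' y' C' \<delta>' a c)
  have "B \<in> Obj \<C>" "B' \<in> Obj \<C>" using s_triangle_closed[OF 4(1)] s_triangle_closed[OF 4(2)] by (auto simp: homs_iff)
  then show ?case using s_morphism[OF 4(1,2) _ _ 4(5)] 4(3,4) by (auto simp: homs_iff)
next
  case (5 A x B y C \<delta> A' x' B' y' C' \<delta>' a b)
  have "C \<in> Obj \<C>" "C' \<in> Obj \<C>" using s_triangle_closed[OF 5(1)] s_triangle_closed[OF 5(2)] by (auto simp: homs_iff)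
  then show ?case using ET3[OF 5(1,2) _ _ 5(5)] 5(3,4) by (auto simp: homs_iff)
next
  case (6 A x B y C \<delta> A' x' B' y' C' \<delta>' b c)
  have "A \<in> Obj \<C>" "A' \<in> Obj \<C>" using s_triangle_closed[OF 6(1)] s_triangle_closed[OF 6(2)] by (auto simp: homs_iff)
  then show ?case using ET3_op[OF 6(1,2) _ _ 6(5)] 6(3,4) by (auto simp: homs_iff)
next
  case (7 A f B f' D \<delta> g C g' F \<delta>')
  then show ?case using ET4[OF 7] by blast
next
  case (8 D f' B f A \<delta> F g' C g \<delta>')
  then show ?case using ET4_op[OF 8] by blast
qed

theorem theorem3p5:
  fixes R :: "('r, 'q) ring_scheme"
    and \<C> :: "('r, 'o, 'm) lin_cat"
    and \<E> :: "('r, 'o, 'm, 'e) bifunctor"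
    and \<ss> :: "'o \<Rightarrow> 'o \<Rightarrow> 'e \<Rightarrow> ('o \<times> 'm \<times> 'm) set"
    and A B C :: 'o and x y :: 'm and \<delta> :: 'e
  assumes "extriangulated_category R \<C> \<E> \<ss>"
    and "s_triangle \<C> \<E> \<ss> A x B y C \<delta>"
  shows "long_exact_Mod R \<C>
      (ext_to R \<C> \<E> A) (\<lambda>n X. push \<C> (pos_ext R \<C> \<E> n) X x)
      (ext_to R \<C> \<E> B) (\<lambda>n X. push \<C> (pos_ext R \<C> \<E> n) X y)
      (ext_to R \<C> \<E> C) (delta_lower_sharp R \<C> \<E> C A \<delta>)
    \<and> long_exact_Mod R (op_cat \<C>)
      (ext_from R \<C> \<E> C) (\<lambda>n Y. pull \<C> (pos_ext R \<C> \<E> n) y Y)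
      (ext_from R \<C> \<E> B) (\<lambda>n Y. pull \<C> (pos_ext R \<C> \<E> n) x Y)
      (ext_from R \<C> \<E> A) (delta_upper_sharp R \<C> \<E> C A \<delta>)"
  using triangle_category.long_exact_sequences[OF
      extriangulated_category.triangle_category[OF assms(1)] assms(2)] by blast

end
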